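(* Let $(V,Q,\varphi)$ be an irreducible polarized CM $\mathbb{Q}$-Hodge structure of odd weight. If $\dim_{\mathbb{Q}}(V)=2p$ where $p>2$ is prime, then its Mumford-Tate group $M_\varphi$ satisfies $\dim(M_\varphi)=p$.
   Context: $V$ is a finite-dimensional $\mathbb{Q}$-vector space, $Q$ is a polarization (a $\mathbb{Q}$-bilinear form, alternating since the weight is odd), and the Hodge structure $\varphi$ is regarded as a real representation of $\mathbb{C}^*$ on $V_{\mathbb{R}}$. Let $G=\{g\in \mathrm{Aut}(V)\mid Q(gu,gv)=Q(u,v)\ \forall u,v\in V\}$, a symplectic $\mathbb{Q}$-algebraic group. By the first Hodge-Riemann relation, $\varphi(S^1)\subset G_{\mathbb{R}}$. The Mumford-Tate group $M_\varphi$ is the smallest $\mathbb{Q}$-algebraic group whose real points contain $\varphi(S^1)$. The Hodge structure is CM if $M_\varphi$ is abelian. It is irreducible if it has no rational sub-Hodge structures other than $0$ and $V$. *)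

theory Defs
  imports "HOL-Analysis.Analysis" "HOL-Library.Extended_Nat"
begin

text \<open>
  A finite-dimensional \<open>\<rat>\<close>-vector space \<open>V\<close> is \<open>rat^'n\<close> for an arbitrary finite index type \<open>'n\<close>,
  so that \<open>V\<^sub>\<real> = real^'n\<close> and \<open>V\<^sub>\<complex> = complex^'n\<close>.
\<close>

section \<open>Zariski topology, Krull dimension, algebraic groups\<close>

inductive_set polynomial_functions :: "complex set \<Rightarrow> ((complex^'n^'n) \<Rightarrow> complex) set"
  for K :: "complex set" where
  const: "c \<in> K \<Longrightarrow> (\<lambda>_. c) \<in> polynomial_functions K"
| entry: "(\<lambda>A. A $ i $ j) \<in> polynomial_functions K"
| add: "f \<in> polynomial_functions K \<Longrightarrow> g \<in> polynomial_functions K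
    \<Longrightarrow> (\<lambda>A. f A + g A) \<in> polynomial_functions K"
| mult: "f \<in> polynomial_functions K \<Longrightarrow> g \<in> polynomial_functions K
    \<Longrightarrow> (\<lambda>A. f A * g A) \<in> polynomial_functions K"

definition zariski_topology :: "complex set \<Rightarrow> (complex^'n^'n) topology" where
  "zariski_topology K =
     topology (\<lambda>U. \<exists>F \<subseteq> polynomial_functions K. U = {A. \<exists>f\<in>F. f A \<noteq> 0})"

lemma istopology_zariski:
  "istopology (\<lambda>U :: (complex^'n^'n) set. \<exists>F \<subseteq> polynomial_functions K. U = {A. \<exists>f\<in>F. f A \<noteq> 0})"
  unfolding istopology_def
proof (intro conjI allI impI)
  fix S T :: "(complex^'n^'n) set"
  assume "\<exists>F \<subseteq> polynomial_functions K. S = {A. \<exists>f\<in>F. f A \<noteq> 0}"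
    and "\<exists>F \<subseteq> polynomial_functions K. T = {A. \<exists>f\<in>F. f A \<noteq> 0}"
  then obtain F G where F: "F \<subseteq> polynomial_functions K" "S = {A. \<exists>f\<in>F. f A \<noteq> 0}"
    and G: "G \<subseteq> polynomial_functions K" "T = {A. \<exists>f\<in>G. f A \<noteq> 0}" by blast
  let ?H = "(\<lambda>(f,g) A. f A * g A) ` (F \<times> G)"
  have "?H \<subseteq> polynomial_functions K"
    using F(1) G(1) by (auto intro!: polynomial_functions.mult)
  moreover have "S \<inter> T = {A. \<exists>h\<in>?H. h A \<noteq> 0}"
    unfolding F(2) G(2) by auto
  ultimately show "\<exists>H \<subseteq> polynomial_functions K. S \<inter> T = {A. \<exists>f\<in>H. f A \<noteq> 0}" by blast
next
  fix \<K> :: "(complex^'n^'n) set set"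
  assume \<K>: "\<forall>S\<in>\<K>. \<exists>F \<subseteq> polynomial_functions K. S = {A. \<exists>f\<in>F. f A \<noteq> 0}"
  let ?H = "{f \<in> polynomial_functions K. \<exists>S\<in>\<K>. {A. f A \<noteq> 0} \<subseteq> S}"
  have "A \<in> {A. \<exists>f\<in>?H. f A \<noteq> 0}" if S: "S \<in> \<K>" "A \<in> S" for S A
  proof -
    obtain F where F: "F \<subseteq> polynomial_functions K" "S = {A. \<exists>f\<in>F. f A \<noteq> 0}"
      using bspec[OF \<K> S(1)] by (elim exE conjE)
    with S(2) obtain f where f: "f \<in> F" "f A \<noteq> 0" by auto
    then have "{A. f A \<noteq> 0} \<subseteq> S" using F(2) by auto
    then have "f \<in> ?H" using f(1) F(1) S(1) by auto
    then show ?thesis using f(2) by auto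
  qed
  then have "\<Union>\<K> = {A. \<exists>f\<in>?H. f A \<noteq> 0}"
    by (intro equalityI subsetI) (erule UnionE, simp, auto)
  then show "\<exists>H \<subseteq> polynomial_functions K. \<Union>\<K> = {A. \<exists>f\<in>H. f A \<noteq> 0}"
    by (intro exI[of _ ?H] conjI) auto
qed

lemma openin_zariski:
  "openin (zariski_topology K) U \<longleftrightarrow> (\<exists>F \<subseteq> polynomial_functions K. U = {A. \<exists>f\<in>F. f A \<noteq> 0})"
  unfolding zariski_topology_def topology_inverse'[OF istopology_zariski] ..

lemma topspace_zariski [simp]:
  assumes "1 \<in> K"
  shows "topspace (zariski_topology K) = UNIV"
proof -
  have "openin (zariski_topology K) UNIV"
    unfolding openin_zariski
    by (rule exI[of _ "{\<lambda>_. 1}"]) (use assms in \<open>auto intro: polynomial_functions.const\<close>)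
  then show ?thesis using openin_subset by blast
qed

lemma closedin_zariski:
  fixes Z :: "(complex^'n^'n) set"
  assumes "1 \<in> K"
  shows "closedin (zariski_topology K) Z \<longleftrightarrow>
    (\<exists>F \<subseteq> polynomial_functions K. Z = {A. \<forall>f\<in>F. f A = 0})"
proof -
  have "UNIV - Z = {A. \<exists>f\<in>F. f A \<noteq> 0} \<longleftrightarrow> Z = {A. \<forall>f\<in>F. f A = 0}"
    for F :: "((complex^'n^'n) \<Rightarrow> complex) set" by blast
  then show ?thesis
    using assms by (simp add: closedin_def openin_zariski)
qed

definition irreducible_closedin :: "'a topology \<Rightarrow> 'a set \<Rightarrow> bool" where
  "irreducible_closedin X Z \<longleftrightarrow> closedin X Z \<and> Z \<noteq> {} \<and>
     (\<forall>A B. closedin X A \<longrightarrow> closedin X B \<longrightarrow> Z \<subseteq> A \<union> B \<longrightarrow> Z \<subseteq> A \<or> Z \<subseteq> B)"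

definition krull_dim :: "'a topology \<Rightarrow> enat" where
  "krull_dim X = Sup {enat d | d. \<exists>Z :: nat \<Rightarrow> 'a set.
     (\<forall>i\<le>d. irreducible_closedin X (Z i)) \<and> (\<forall>i<d. Z i \<subset> Z (Suc i))}"

definition general_linear :: "(complex^'n^'n) set" where
  "general_linear = {A. invertible A}"

text \<open>
  An algebraic subgroup of \<open>GL(V)\<close> defined over \<open>\<rat>\<close> is given by its group of complex points
  (algebraic groups in characteristic zero are reduced, so nothing is lost).
\<close>

definition rational_algebraic_group :: "(complex^'n^'n) set \<Rightarrow> bool" where
  "rational_algebraic_group H \<longleftrightarrow>
     closedin (subtopology (zariski_topology \<rat>) general_linear) H \<and>
     mat 1 \<in> H \<and> (\<forall>A\<in>H. \<forall>B\<in>H. A ** B \<in> H) \<and> (\<forall>A\<in>H. matrix_inv A \<in> H)"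

definition real_points :: "(complex^'n^'n) set \<Rightarrow> (real^'n^'n) set" where
  "real_points H = {A. map_matrix of_real A \<in> H}"

definition algebraic_group_dim :: "(complex^'n^'n) set \<Rightarrow> enat" where
  "algebraic_group_dim H = krull_dim (subtopology (zariski_topology UNIV) H)"

section \<open>Polarized Hodge structures\<close>

text \<open>
  A Hodge structure is a representation \<open>\<phi>\<close> of \<open>\<complex>\<^sup>*\<close> on \<open>V\<^sub>\<real>\<close> (the value \<open>\<phi> 0\<close> is irrelevant), with the
  convention that \<open>\<phi> z\<close> acts on \<open>V\<^bsup>p,q\<^esup>\<close> as \<open>z\<^sup>p (cnj z)\<^sup>q\<close>. Since \<open>\<phi>\<close> is real, \<open>V\<^bsup>q,p\<^esup>\<close> is automatically
  the complex conjugate of \<open>V\<^bsup>p,q\<^esup>\<close>.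
\<close>

definition hodge_component ::
    "(complex \<Rightarrow> real^'n^'n) \<Rightarrow> int \<Rightarrow> int \<Rightarrow> (complex^'n) set" where
  "hodge_component \<phi> p q =
     {v. \<forall>z. z \<noteq> 0 \<longrightarrow> map_matrix of_real (\<phi> z) *v v = (z powi p * cnj z powi q) *s v}"

text \<open>
  The sum of the \<open>V\<^bsup>p,q\<^esup>\<close> is automatically direct, as they are simultaneous eigenspaces
  for distinct characters of \<open>\<complex>\<^sup>*\<close>.
\<close>

definition hodge_structure :: "int \<Rightarrow> (complex \<Rightarrow> real^'n^'n) \<Rightarrow> bool" where
  "hodge_structure n \<phi> \<longleftrightarrow>
     \<phi> 1 = mat 1 \<and>
     (\<forall>z w. z \<noteq> 0 \<longrightarrow> w \<noteq> 0 \<longrightarrow> \<phi> (z * w) = \<phi> z ** \<phi> w) \<and>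
     vec.span (\<Union>p. hodge_component \<phi> p (n - p)) = UNIV"

definition rational_bilinear :: "(rat^'n \<Rightarrow> rat^'n \<Rightarrow> rat) \<Rightarrow> bool" where
  "rational_bilinear Q \<longleftrightarrow>
     (\<forall>u. Vector_Spaces.linear (*s) (*) (\<lambda>v. Q u v)) \<and>
     (\<forall>v. Vector_Spaces.linear (*s) (*) (\<lambda>u. Q u v))"

definition complexify_form ::
    "(rat^'n \<Rightarrow> rat^'n \<Rightarrow> rat) \<Rightarrow> complex^'n \<Rightarrow> complex^'n \<Rightarrow> complex" where
  "complexify_form Q u v = (\<Sum>i\<in>UNIV. \<Sum>j\<in>UNIV. u $ i * v $ j * of_rat (Q (axis i 1) (axis j 1)))"

text \<open>The last two conjuncts are the first and second Hodge-Riemann bilinear relations.\<close>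

definition polarization ::
    "int \<Rightarrow> (rat^'n \<Rightarrow> rat^'n \<Rightarrow> rat) \<Rightarrow> (complex \<Rightarrow> real^'n^'n) \<Rightarrow> bool" where
  "polarization n Q \<phi> \<longleftrightarrow>
     rational_bilinear Q \<and>
     (\<forall>u. (\<forall>v. Q u v = 0) \<longrightarrow> u = 0) \<and>
     (\<forall>u v. Q u v = (-1) powi n * Q v u) \<and>
     (\<forall>p p'. p + p' \<noteq> n \<longrightarrow> (\<forall>u \<in> hodge_component \<phi> p (n - p).
        \<forall>v \<in> hodge_component \<phi> p' (n - p'). complexify_form Q u v = 0)) \<and>
     (\<forall>p q. p + q = n \<longrightarrow> (\<forall>u \<in> hodge_component \<phi> p q. u \<noteq> 0 \<longrightarrow>
        (\<exists>r>0. \<i> powi (p - q) * complexify_form Q u (\<chi> i. cnj (u $ i)) = complex_of_real r)))"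

definition polarized_hodge_structure ::
    "int \<Rightarrow> (rat^'n \<Rightarrow> rat^'n \<Rightarrow> rat) \<Rightarrow> (complex \<Rightarrow> real^'n^'n) \<Rightarrow> bool" where
  "polarized_hodge_structure n Q \<phi> \<longleftrightarrow> hodge_structure n \<phi> \<and> polarization n Q \<phi>"

definition realify_subspace :: "(rat^'n) set \<Rightarrow> (real^'n) set" where
  "realify_subspace W = vec.span ((\<lambda>w. \<chi> i. of_rat (w $ i)) ` W)"

definition sub_hodge_structure :: "(complex \<Rightarrow> real^'n^'n) \<Rightarrow> (rat^'n) set \<Rightarrow> bool" where
  "sub_hodge_structure \<phi> W \<longleftrightarrow> vec.subspace W \<and>
     (\<forall>z. z \<noteq> 0 \<longrightarrow> (\<forall>w \<in> realify_subspace W. \<phi> z *v w \<in> realify_subspace W))"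

definition irreducible_hodge_structure :: "(complex \<Rightarrow> real^'n^'n) \<Rightarrow> bool" where
  "irreducible_hodge_structure \<phi> \<longleftrightarrow>
     (\<forall>W. sub_hodge_structure \<phi> W \<longrightarrow> W = {0} \<or> W = UNIV)"

section \<open>The Mumford-Tate group\<close>

text \<open>Only the circle \<open>S\<^sup>1 \<subseteq> \<complex>\<^sup>*\<close> is used here, so this group does not contain the homotheties
  coming from the weight; many authors call it the Hodge group or special Mumford-Tate group.
  By the first Hodge-Riemann relation it lies in the isometry group of any polarization, so it does
  not matter whether the minimum is taken in \<open>GL(V)\<close> or in that symplectic group.\<close>

definition mumford_tate_group :: "(complex \<Rightarrow> real^'n^'n) \<Rightarrow> (complex^'n^'n) set" where
  "mumford_tate_group \<phi> =
     \<Inter> {H. rational_algebraic_group H \<and> \<phi> ` sphere 0 1 \<subseteq> real_points H}"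

definition CM_hodge_structure :: "(complex \<Rightarrow> real^'n^'n) \<Rightarrow> bool" where
  "CM_hodge_structure \<phi> \<longleftrightarrow>
     (\<forall>A \<in> mumford_tate_group \<phi>. \<forall>B \<in> mumford_tate_group \<phi>. A ** B = B ** A)"

lemma matrix_inv_general_linear:
  assumes "A \<in> general_linear"
  shows "matrix_inv A \<in> general_linear"
proof -
  have "\<exists>B. A ** B = mat 1 \<and> B ** A = mat 1"
    using assms by (simp add: general_linear_def invertible_def)
  then have "A ** matrix_inv A = mat 1 \<and> matrix_inv A ** A = mat 1"
    unfolding matrix_inv_def by (rule someI_ex)
  then show ?thesis
    unfolding general_linear_def invertible_def by blast
qed

lemma rational_algebraic_group_general_linear:
  "rational_algebraic_group (general_linear :: (complex^'n^'n) set)"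
proof -
  have "closedin (subtopology (zariski_topology \<rat>) general_linear)
      (general_linear :: (complex^'n^'n) set)"
    using closedin_topspace[of "subtopology (zariski_topology \<rat>)
      (general_linear :: (complex^'n^'n) set)"] by simp
  moreover have "mat 1 \<in> (general_linear :: (complex^'n^'n) set)"
    by (auto simp: general_linear_def invertible_def intro: exI[of _ "mat 1"])
  ultimately show ?thesis
    unfolding rational_algebraic_group_def
    by (simp add: matrix_inv_general_linear) (simp add: general_linear_def invertible_mult)
qed

lemma hodge_structure_general_linear:
  assumes "hodge_structure n \<phi>" "z \<noteq> 0"
  shows "\<phi> z \<in> real_points general_linear"
proof -
  have mult: "map_matrix complex_of_real (A ** B) =
      map_matrix complex_of_real A ** map_matrix complex_of_real B" for A B :: "real^'n^'n"
    by (simp add: vec_eq_iff matrix_matrix_mult_def)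
  have one: "map_matrix complex_of_real (mat 1 :: real^'n^'n) = mat 1"
    by (simp add: vec_eq_iff mat_def)
  have "\<phi> z ** \<phi> (inverse z) = mat 1" "\<phi> (inverse z) ** \<phi> z = mat 1"
    using assms unfolding hodge_structure_def
    by (metis inverse_nonzero_iff_nonzero left_inverse right_inverse)+
  then have "invertible (map_matrix complex_of_real (\<phi> z))"
    unfolding invertible_def by (metis mult one)
  then show ?thesis by (simp add: real_points_def general_linear_def)
qed

lemma mumford_tate_group_smallest:
  assumes "hodge_structure n \<phi>"
  shows "rational_algebraic_group (mumford_tate_group \<phi>)"
    and "\<phi> ` sphere 0 1 \<subseteq> real_points (mumford_tate_group \<phi>)"
    and "\<And>H. rational_algebraic_group H \<Longrightarrow> \<phi> ` sphere 0 1 \<subseteq> real_points H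
          \<Longrightarrow> mumford_tate_group \<phi> \<subseteq> H"
proof -
  let ?S = "{H. rational_algebraic_group H \<and> \<phi> ` sphere 0 1 \<subseteq> real_points H}"
  have "\<phi> z \<in> real_points general_linear" if "z \<in> sphere 0 1" for z
  proof (rule hodge_structure_general_linear[OF assms])
    show "z \<noteq> 0" using that by auto
  qed
  then have "\<phi> ` sphere 0 1 \<subseteq> real_points general_linear" by (rule image_subsetI)
  with rational_algebraic_group_general_linear have "general_linear \<in> ?S" by (intro CollectI conjI)
  then have "?S \<noteq> {}" by blast
  then have "closedin (subtopology (zariski_topology \<rat>) general_linear) (\<Inter>?S)"
    by (rule closedin_Inter) (simp add: rational_algebraic_group_def)
  then show "rational_algebraic_group (mumford_tate_group \<phi>)"
    unfolding mumford_tate_group_def rational_algebraic_group_def by blast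
  show "\<phi> ` sphere 0 1 \<subseteq> real_points (mumford_tate_group \<phi>)"
    unfolding mumford_tate_group_def real_points_def by blast
  show "mumford_tate_group \<phi> \<subseteq> H"
    if "rational_algebraic_group H" "\<phi> ` sphere 0 1 \<subseteq> real_points H" for H
    unfolding mumford_tate_group_def using that by blast
qed

end

theory Submission
  imports Defs "HOL-Complex_Analysis.Conformal_Mappings"
    "HOL-Computational_Algebra.Fundamental_Theorem_Algebra" "HOL-Computational_Algebra.Polynomial_Factorial"
    "HOL-Algebra.Sylow" "HOL-Combinatorics.Permutations"
begin

text \<open>
  The Mumford-Tate group \<open>M\<close> is stable under \<open>Aut(\<complex>)\<close>, whose fixed field is \<open>\<rat>\<close>, so a stable complex
  subspace is defined over \<open>\<rat>\<close>. As \<open>M\<close> is abelian, the Galois conjugates of \<open>\<phi> z\<close> commute.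
  Splitting a rational vector into common eigenvectors of these gives a set \<open>S\<close> permuted by \<open>Aut(\<complex>)\<close>;
  its span is a rational sub-Hodge structure, so by irreducibility \<open>S\<close> is a basis, permuted transitively.
  On \<open>s \<in> S\<close> the circle acts by a weight \<open>h s\<close>, which is odd; complex conjugation is a central involution
  of \<open>S\<close> with \<open>h (cnj s) = - h s\<close>; and the translates of \<open>h\<close> separate the points of \<open>S\<close>. Invariance of \<open>Q\<close>
  puts \<open>M\<close> inside the \<open>p\<close>-dimensional torus \<open>{x. x s * x (cnj s) = 1}\<close> of diagonal matrices.

  Conversely, a Sylow subgroup provides an automorphism that permutes \<open>S\<close> in two conjugate \<open>p\<close>-cycles. The
  shifts of \<open>h\<close> along one of them form a circulant matrix, which is invertible: the sum of \<open>p\<close> odd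
  numbers is nonzero, and since the \<open>p\<close>-th cyclotomic polynomial is irreducible the other eigenvalues
  vanish only if \<open>h\<close> is constant, which separation lets us avoid. So \<open>M\<close> is the whole torus.

  For its Krull dimension: along a strict chain of irreducible closed sets, adjoining a function that
  vanishes on the smaller set but not on the larger one preserves algebraic independence, and counting
  Laurent monomials bounds the number of independent functions by \<open>p\<close>.
\<close>

section \<open>Automorphisms of the complex field\<close>

text \<open>A group given by its complex points is acted on by automorphisms of all of \<complex>,
  and descent to \<rat> requires that these fix no irrational number \<open>x\<close>. A subfield
  maximal among those omitting \<open>x\<close> is chosen for this: \<complex> is algebraic over it,
  so a conjugation of \<open>x\<close> extends to \<complex> by algebraic steps alone, without a
  transcendence basis.

  Such automorphisms do not commute with \<open>exp\<close>. Conjugates of the circle are therefore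
  reached through the numbers \<open>\<sigma> (exp u)\<close>, for which new logarithms are chosen.

  The bound \<open>p > 2\<close> enters in three ways: \<open>2 * p < p ^ 2\<close> keeps the orbits
  of a \<open>p\<close>-element from being longer than \<open>p\<close>; \<open>p\<close> does not
  divide 2, so the central involution cannot preserve a \<open>p\<close>-cycle; and a sum of
  \<open>p\<close> odd weights is odd.

  The weight itself may be constant along a \<open>p\<close>-cycle, so the circulant is built from a
  translate of it that is not. Nonconstancy is all that irreducibility of the cyclotomic polynomial
  asks for.\<close>

text \<open>Graphs of isomorphisms between subfields of \<open>\<complex>\<close>; the graphs below \<open>Id\<close> are the subfields themselves.\<close>

definition partial_iso :: "(complex \<times> complex) set \<Rightarrow> bool" where
  "partial_iso R \<longleftrightarrow> (1, 1) \<in> R \<and>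
     (\<forall>a b c d. (a, b) \<in> R \<longrightarrow> (c, d) \<in> R \<longrightarrow> (a - c, b - d) \<in> R \<and> (a / c, b / d) \<in> R) \<and>
     (\<forall>a b. (a, b) \<in> R \<longrightarrow> (a = 0 \<longleftrightarrow> b = 0))"

lemma partial_iso_one: "partial_iso R \<Longrightarrow> (1, 1) \<in> R"
  and partial_iso_diff: "partial_iso R \<Longrightarrow> (a, b) \<in> R \<Longrightarrow> (c, d) \<in> R \<Longrightarrow> (a - c, b - d) \<in> R"
  and partial_iso_divide: "partial_iso R \<Longrightarrow> (a, b) \<in> R \<Longrightarrow> (c, d) \<in> R \<Longrightarrow> (a / c, b / d) \<in> R"
  and partial_iso_zero_iff: "partial_iso R \<Longrightarrow> (a, b) \<in> R \<Longrightarrow> a = 0 \<longleftrightarrow> b = 0"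
  unfolding partial_iso_def by blast+

lemma partial_iso_zero: "partial_iso R \<Longrightarrow> (0, 0) \<in> R"
  using partial_iso_diff[of R 1 1 1 1] partial_iso_one[of R] by simp

lemma partial_iso_add:
  assumes "partial_iso R" "(a, b) \<in> R" "(c, d) \<in> R"
  shows "(a + c, b + d) \<in> R"
  using partial_iso_diff[OF assms(1,2) partial_iso_diff[OF assms(1) partial_iso_zero[OF assms(1)] assms(3)]]
  by simp

lemma partial_iso_mult:
  assumes "partial_iso R" "(a, b) \<in> R" "(c, d) \<in> R"
  shows "(a * c, b * d) \<in> R"
  using partial_iso_divide[OF assms(1,2) partial_iso_divide[OF assms(1) partial_iso_one[OF assms(1)] assms(3)]]
  by simp

lemma partial_iso_sum:
  assumes "partial_iso R" "\<And>i. i \<in> I \<Longrightarrow> (f i, g i) \<in> R"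
  shows "(sum f I, sum g I) \<in> R"
  using assms(2)
  by (induction I rule: infinite_finite_induct)
    (auto intro: partial_iso_add[OF assms(1)] partial_iso_zero[OF assms(1)])

lemma partial_iso_of_nat: "partial_iso R \<Longrightarrow> (of_nat n, of_nat n) \<in> R"
  by (induction n) (auto intro: partial_iso_zero partial_iso_add partial_iso_one)

lemma partial_iso_unique:
  assumes "partial_iso R" "(a, b) \<in> R" "(a, c) \<in> R"
  shows "b = c"
  using partial_iso_zero_iff[OF assms(1) partial_iso_diff[OF assms]] by simp

lemma partial_iso_converse: "partial_iso R \<Longrightarrow> partial_iso (R\<inverse>)"
  unfolding partial_iso_def by auto

lemma partial_iso_Union_chain:
  assumes "\<C> \<noteq> {}" "\<And>R S. R \<in> \<C> \<Longrightarrow> S \<in> \<C> \<Longrightarrow> R \<subseteq> S \<or> S \<subseteq> R" "\<And>R. R \<in> \<C> \<Longrightarrow> partial_iso R"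
  shows "partial_iso (\<Union>\<C>)"
proof -
  have common: "\<exists>R\<in>\<C>. p \<in> R \<and> q \<in> R" if pq: "p \<in> \<Union>\<C>" "q \<in> \<Union>\<C>" for p q
  proof -
    obtain R S where "R \<in> \<C>" "p \<in> R" "S \<in> \<C>" "q \<in> S" using pq by blast
    then show ?thesis using assms(2)[of R S] by blast
  qed
  show ?thesis
    unfolding partial_iso_def
  proof (intro conjI allI impI)
    show "(1, 1) \<in> \<Union>\<C>" using assms(1,3) partial_iso_one by blast
  next
    fix a b c d assume "(a, b) \<in> \<Union>\<C>" "(c, d) \<in> \<Union>\<C>"
    with common obtain R where "R \<in> \<C>" "(a, b) \<in> R" "(c, d) \<in> R" by metis
    then show "(a - c, b - d) \<in> \<Union>\<C>" "(a / c, b / d) \<in> \<Union>\<C>"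
      using assms(3) partial_iso_diff partial_iso_divide by blast+
  next
    fix a b assume "(a, b) \<in> \<Union>\<C>"
    then show "a = 0 \<longleftrightarrow> b = 0" using assms(3) partial_iso_zero_iff by blast
  qed
qed

section \<open>Simple extensions of a partial isomorphism\<close>

definition rel_polys :: "(complex \<times> complex) set \<Rightarrow> complex poly \<Rightarrow> complex poly \<Rightarrow> bool" where
  "rel_polys R g g' \<longleftrightarrow> (\<forall>i. (coeff g i, coeff g' i) \<in> R)"

context
  fixes R assumes R: "partial_iso R"
begin

lemma rel_polys_diff:
  "rel_polys R g g' \<Longrightarrow> rel_polys R k k' \<Longrightarrow> rel_polys R (g - k) (g' - k')"
  by (auto simp: rel_polys_def intro: partial_iso_diff[OF R])

lemma rel_polys_add:
  "rel_polys R g g' \<Longrightarrow> rel_polys R k k' \<Longrightarrow> rel_polys R (g + k) (g' + k')"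
  by (auto simp: rel_polys_def intro: partial_iso_add[OF R])

lemma rel_polys_mult:
  "rel_polys R g g' \<Longrightarrow> rel_polys R k k' \<Longrightarrow> rel_polys R (g * k) (g' * k')"
  by (auto simp: rel_polys_def coeff_mult intro!: partial_iso_sum[OF R] partial_iso_mult[OF R])

lemma rel_polys_monom: "(a, b) \<in> R \<Longrightarrow> rel_polys R (monom a n) (monom b n)"
  by (auto simp: rel_polys_def intro: partial_iso_zero[OF R])

lemma rel_polys_const: "(a, b) \<in> R \<Longrightarrow> rel_polys R [:a:] [:b:]"
  using rel_polys_monom[of a b 0] by (simp add: monom_0)

lemma rel_polys_0: "rel_polys R 0 0"
  by (auto simp: rel_polys_def intro: partial_iso_zero[OF R])

lemma rel_polys_1: "rel_polys R 1 1"
  using rel_polys_const[OF partial_iso_one[OF R]] by (simp add: one_pCons)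

lemma rel_polys_X: "rel_polys R [:0, 1:] [:0, 1:]"
  using rel_polys_monom[OF partial_iso_one[OF R], of 1] by (simp add: monom_Suc monom_0)

lemma rel_polys_coeff_zero_iff: "rel_polys R g g' \<Longrightarrow> coeff g i = 0 \<longleftrightarrow> coeff g' i = 0"
  using partial_iso_zero_iff[OF R] by (auto simp: rel_polys_def)

lemma rel_polys_degree: "rel_polys R g g' \<Longrightarrow> degree g' = degree g"
  by (simp add: degree_def rel_polys_coeff_zero_iff)

lemma rel_polys_eq_0_iff: "rel_polys R g g' \<Longrightarrow> g' = 0 \<longleftrightarrow> g = 0"
  using rel_polys_coeff_zero_iff[of g g'] by (simp add: poly_eq_iff)

text \<open>Long division uses only field operations on coefficients, so it runs in lockstep on both
  sides of \<open>R\<close>. Induction on the degree of \<open>g\<close>: cancelling the leading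
  terms of \<open>g\<close> and \<open>g'\<close> leaves a related pair.\<close>

lemma rel_polys_division:
  assumes "rel_polys R f f'" "f \<noteq> 0" "rel_polys R g g'"
  shows "\<exists>q q' r r'. rel_polys R q q' \<and> rel_polys R r r' \<and> g = q * f + r \<and> g' = q' * f' + r' \<and>
    (r = 0 \<or> degree r < degree f)"
  using assms(3)
proof (induction "degree g" arbitrary: g g' rule: less_induct)
  case less
  show ?case
  proof (cases "g = 0 \<or> degree g < degree f")
    case True
    then show ?thesis
      using less(2) rel_polys_0 by (intro exI[of _ 0] exI[of _ g] exI[of _ g']) auto
  next
    case False
    define n where "n = degree g - degree f"
    define c where "c = lead_coeff g / lead_coeff f"
    define c' where "c' = lead_coeff g' / lead_coeff f'"
    have deg: "degree g' = degree g" "degree f' = degree f"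
      using rel_polys_degree assms(1) less(2) by auto
    have c: "(c, c') \<in> R"
      unfolding c_def c'_def deg
      using assms(1) less(2) by (auto simp: rel_polys_def intro: partial_iso_divide[OF R])
    define k where "k = g - monom c n * f"
    define k' where "k' = g' - monom c' n * f'"
    have k: "rel_polys R k k'"
      unfolding k_def k'_def
      by (intro rel_polys_diff rel_polys_mult rel_polys_monom c assms(1) less(2))
    have kd: "k = 0 \<or> degree k < degree g"
    proof (cases "k = 0")
      case False
      have "c \<noteq> 0" using \<open>\<not> (g = 0 \<or> degree g < degree f)\<close> assms(2) by (simp add: c_def)
      then have "degree (monom c n * f) = degree g"
        using assms(2) \<open>\<not> (g = 0 \<or> degree g < degree f)\<close>
        by (simp add: degree_mult_eq degree_monom_eq monom_eq_0_iff n_def)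
      then have "degree k \<le> degree g" unfolding k_def by (metis degree_diff_le order_refl)
      moreover have "coeff k (degree g) = 0"
        using \<open>\<not> (g = 0 \<or> degree g < degree f)\<close> assms(2)
        by (simp add: k_def n_def c_def coeff_monom_mult)
      ultimately show ?thesis
        using False by (metis leading_coeff_0_iff order_le_less)
    qed simp
    have "\<exists>q q' r r'. rel_polys R q q' \<and> rel_polys R r r' \<and> k = q * f + r \<and> k' = q' * f' + r' \<and>
      (r = 0 \<or> degree r < degree f)"
    proof (cases "k = 0")
      case True
      moreover have "k' = 0" using True rel_polys_eq_0_iff[OF k] by simp
      ultimately show ?thesis using rel_polys_0 by (intro exI[of _ 0]) auto
    next
      case False
      then show ?thesis using less(1)[OF _ k] kd by auto
    qed
    then obtain q q' r r' where q: "rel_polys R q q'" "rel_polys R r r'" "k = q * f + r"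
      "k' = q' * f' + r'" "r = 0 \<or> degree r < degree f" by blast
    show ?thesis
    proof (intro exI conjI)
      show "rel_polys R (q + monom c n) (q' + monom c' n)"
        by (intro rel_polys_add q rel_polys_monom c)
      show "g = (q + monom c n) * f + r" "g' = (q' + monom c' n) * f' + r'"
        using q(3,4) unfolding k_def k'_def by (simp_all add: algebra_simps)
    qed (use q in auto)
  qed
qed

text \<open>The hypothesis says that evaluation at \<open>y\<close> and at \<open>z\<close> have
  corresponding kernels, so \<open>y\<close> can be sent to \<open>z\<close> and \<open>R'\<close>
  is the induced isomorphism of the generated fields. Denominators are allowed to vanish: they do so
  on both sides at once, and the quotient is then 0 on both sides.\<close>

lemma partial_iso_extend:
  assumes "\<And>g g'. rel_polys R g g' \<Longrightarrow> poly g y = 0 \<longleftrightarrow> poly g' z = 0"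
  defines "R' \<equiv> {(poly g y / poly k y, poly g' z / poly k' z) | g g' k k'.
      rel_polys R g g' \<and> rel_polys R k k'}"
  shows "partial_iso R'" "R \<subseteq> R'" "(y, z) \<in> R'"
proof -
  have I: "(poly g y / poly k y, poly g' z / poly k' z) \<in> R'"
    if "rel_polys R g g'" "rel_polys R k k'" for g g' k k'
    using that unfolding R'_def by blast
  show "R \<subseteq> R'"
    using I[OF rel_polys_const rel_polys_1] by auto
  show "(y, z) \<in> R'"
    using I[OF rel_polys_X rel_polys_1] by auto
  show "partial_iso R'"
    unfolding partial_iso_def
  proof (intro conjI allI impI)
    show "(1, 1) \<in> R'" using I[OF rel_polys_1 rel_polys_1] by simp
  next
    fix a b c d assume "(a, b) \<in> R'" "(c, d) \<in> R'"
    then obtain g g' k k' l l' m m' where *: "rel_polys R g g'" "rel_polys R k k'"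
      "rel_polys R l l'" "rel_polys R m m'"
      and ab: "a = poly g y / poly k y" "b = poly g' z / poly k' z"
      and cd: "c = poly l y / poly m y" "d = poly l' z / poly m' z"
      unfolding R'_def by blast
    show "(a / c, b / d) \<in> R'"
      using I[OF rel_polys_mult[OF *(1,4)] rel_polys_mult[OF *(2,3)]]
      by (simp add: ab cd field_simps)
    note z = assms(1)[OF *(2)] assms(1)[OF *(4)]
    consider "poly k y = 0" | "poly m y = 0" | "poly k y \<noteq> 0" "poly m y \<noteq> 0" by blast
    then show "(a - c, b - d) \<in> R'"
    proof cases
      case 1
      then show ?thesis
        using I[OF rel_polys_diff[OF rel_polys_0 *(3)] *(4)] z by (simp add: ab cd)
    next
      case 2
      then show ?thesis using I[OF *(1,2)] z by (simp add: ab cd)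
    next
      case 3
      then show ?thesis
        using I[OF rel_polys_diff[OF rel_polys_mult[OF *(1,4)] rel_polys_mult[OF *(3,2)]]
            rel_polys_mult[OF *(2,4)]] z
        by (simp add: ab cd diff_frac_eq)
    qed
  next
    fix a b assume "(a, b) \<in> R'"
    then show "a = 0 \<longleftrightarrow> b = 0" using assms(1) unfolding R'_def by auto
  qed
qed

text \<open>Division by the minimal polynomial \<open>f\<close> of \<open>y\<close> gives one
  direction. For the other, take \<open>k\<close> of least degree such that its partner vanishes at
  \<open>z\<close>. Then \<open>k\<close> divides \<open>f\<close>, and if \<open>k\<close> did not
  vanish at \<open>y\<close>, the cofactor would; minimality of \<open>f\<close> would make
  \<open>k\<close> a nonzero constant. So \<open>k\<close> vanishes at \<open>y\<close>, and it
  divides every \<open>g\<close> whose partner vanishes at \<open>z\<close>.\<close>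

lemma minimal_rel_polys:
  assumes f: "rel_polys R f f'" "f \<noteq> 0" "poly f y = 0"
    and min: "\<And>g g'. rel_polys R g g' \<Longrightarrow> g \<noteq> 0 \<Longrightarrow> poly g y = 0 \<Longrightarrow> degree f \<le> degree g"
    and z: "poly f' z = 0"
    and g: "rel_polys R g g'"
  shows "poly g y = 0 \<longleftrightarrow> poly g' z = 0"
proof -
  have *: "poly k' z = 0" if k: "rel_polys R k k'" "poly k y = 0" for k k'
  proof -
    obtain q q' r r' where q: "rel_polys R q q'" "rel_polys R r r'" "k = q * f + r"
      "k' = q' * f' + r'" "r = 0 \<or> degree r < degree f"
      using rel_polys_division[OF f(1,2) k(1)] by blast
    have "poly r y = 0" using q(3) k(2) f(3) by simp
    then have "r = 0" using min[OF q(2)] q(5) by (metis not_le)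
    then have "r' = 0" using rel_polys_eq_0_iff[OF q(2)] by simp
    then show ?thesis using q(4) z by simp
  qed
  have "poly g y = 0" if g'z: "poly g' z = 0" "g \<noteq> 0"
  proof -
    obtain k where "\<exists>k'. rel_polys R k k' \<and> k \<noteq> 0 \<and> poly k' z = 0"
      and min_k: "\<And>m. (\<exists>m'. rel_polys R m m' \<and> m \<noteq> 0 \<and> poly m' z = 0) \<Longrightarrow> degree k \<le> degree m"
      using ex_has_least_nat[of "\<lambda>k. \<exists>k'. rel_polys R k k' \<and> k \<noteq> 0 \<and> poly k' z = 0" g degree] g g'z
      by blast
    then obtain k' where k: "rel_polys R k k'" "k \<noteq> 0" "poly k' z = 0" by blast
    have div: "\<exists>q q'. rel_polys R q q' \<and> m = q * k" if m: "rel_polys R m m'" "poly m' z = 0" for m m'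
    proof -
      obtain q q' r r' where q: "rel_polys R q q'" "rel_polys R r r'" "m = q * k + r"
        "m' = q' * k' + r'" "r = 0 \<or> degree r < degree k"
        using rel_polys_division[OF k(1,2) m(1)] by blast
      have "poly r' z = 0" using q(4) m(2) k(3) by simp
      then have "r = 0" using min_k[of r] q(2,5) by (metis not_le)
      then show ?thesis using q(1,3) by auto
    qed
    obtain q q' where q: "rel_polys R q q'" "f = q * k" using div[OF f(1) z] by blast
    have "poly k y = 0"
    proof (rule ccontr)
      assume "poly k y \<noteq> 0"
      then have "poly q y = 0" "q \<noteq> 0" using q(2) f(2,3) by auto
      then have "degree f \<le> degree q" using min[OF q(1)] by simp
      then have "degree k' = 0"
        using q(2) \<open>q \<noteq> 0\<close> k(2) rel_polys_degree[OF k(1)] by (simp add: degree_mult_eq)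
      then obtain c where "k' = [:c:]" by (metis degree_eq_zeroE)
      then have "k' = 0" using k(3) by simp
      then show False using rel_polys_eq_0_iff[OF k(1)] k(2) by simp
    qed
    then show ?thesis using div[OF g g'z(1)] by auto
  qed
  then show ?thesis using * g by (cases "g = 0") (auto simp: rel_polys_eq_0_iff)
qed

text \<open>The image of \<open>y\<close> may be any root of the partner of its minimal polynomial;
  such a root exists as \<complex> is algebraically closed.\<close>

lemma partial_iso_extend_algebraic:
  assumes "rel_polys R g g'" "g \<noteq> 0" "poly g y = 0"
  shows "\<exists>S z. partial_iso S \<and> R \<subseteq> S \<and> (y, z) \<in> S"
proof -
  obtain f where "\<exists>f'. rel_polys R f f' \<and> f \<noteq> 0 \<and> poly f y = 0"
    and min: "\<And>g. (\<exists>g'. rel_polys R g g' \<and> g \<noteq> 0 \<and> poly g y = 0) \<Longrightarrow> degree f \<le> degree g"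
    using ex_has_least_nat[of "\<lambda>f. \<exists>f'. rel_polys R f f' \<and> f \<noteq> 0 \<and> poly f y = 0" g degree] assms
    by blast
  then obtain f' where f: "rel_polys R f f'" "f \<noteq> 0" "poly f y = 0" by blast
  have "degree f \<noteq> 0"
  proof
    assume "degree f = 0"
    then obtain c where "f = [:c:]" by (metis degree_eq_zeroE)
    then show False using f by simp
  qed
  then have "degree f' \<noteq> 0" using rel_polys_degree[OF f(1)] by simp
  then have "\<not> constant (poly f')" by (simp add: constant_degree)
  then obtain z where z: "poly f' z = 0" using fundamental_theorem_of_algebra by blast
  have "degree f \<le> degree g" if "rel_polys R g g'" "g \<noteq> 0" "poly g y = 0" for g g'
    using min that by blast
  then have "poly g y = 0 \<longleftrightarrow> poly g' z = 0" if "rel_polys R g g'" for g g'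
    using minimal_rel_polys[OF f _ z that] by blast
  note S = partial_iso_extend[OF this]
  show ?thesis using S by blast
qed

end

section \<open>A maximal subfield omitting a given number\<close>

lemma rel_polys_Id_eq: "R \<subseteq> Id \<Longrightarrow> rel_polys R g g' \<Longrightarrow> g' = g"
  unfolding rel_polys_def poly_eq_iff by (metis IdD subsetD)

lemma partial_iso_rationals: "partial_iso (Id_on \<rat>)"
  unfolding partial_iso_def by (auto simp: Id_on_iff)

text \<open>Zorn's lemma with a set \<open>T\<close> of forbidden pairs. With \<open>T\<close>
  consisting of \<open>(x, x)\<close> and all pairs off the diagonal it yields a maximal subfield
  omitting \<open>x\<close>; with \<open>T\<close> empty, a maximal isomorphism.\<close>

lemma partial_iso_maximal:
  assumes "partial_iso S" "S \<inter> T = {}"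
  obtains R where "partial_iso R" "S \<subseteq> R" "R \<inter> T = {}"
    "\<And>U. partial_iso U \<Longrightarrow> R \<subseteq> U \<Longrightarrow> U \<inter> T = {} \<Longrightarrow> U = R"
proof -
  let ?A = "{R. partial_iso R \<and> S \<subseteq> R \<and> R \<inter> T = {}}"
  have "\<exists>R\<in>?A. \<forall>U\<in>?A. R \<subseteq> U \<longrightarrow> U = R"
  proof (rule subset_Zorn_nonempty)
    show "?A \<noteq> {}" using assms by auto
  next
    fix \<C> assume "\<C> \<noteq> {}" "subset.chain ?A \<C>"
    then have \<C>: "\<C> \<noteq> {}" "\<And>R S. R \<in> \<C> \<Longrightarrow> S \<in> \<C> \<Longrightarrow> R \<subseteq> S \<or> S \<subseteq> R" "\<And>R. R \<in> \<C> \<Longrightarrow> R \<in> ?A"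
      unfolding subset.chain_def by blast+
    then have "partial_iso (\<Union>\<C>)" by (intro partial_iso_Union_chain) auto
    moreover have "S \<subseteq> \<Union>\<C>" "\<Union>\<C> \<inter> T = {}" using \<C>(1,3) by blast+
    ultimately show "\<Union>\<C> \<in> ?A" by simp
  qed
  then obtain R where "R \<in> ?A" "\<forall>U\<in>?A. R \<subseteq> U \<longrightarrow> U = R" by (elim bexE)
  then show thesis by (intro that[of R]) auto
qed

lemma partial_iso_avoiding_maximal:
  fixes x :: complex
  assumes "x \<notin> \<rat>"
  obtains R where "partial_iso R" "R \<subseteq> Id" "(x, x) \<notin> R"
    "\<And>S. partial_iso S \<Longrightarrow> S \<subseteq> Id \<Longrightarrow> (x, x) \<notin> S \<Longrightarrow> R \<subseteq> S \<Longrightarrow> S = R"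
proof -
  have iff: "U \<inter> (- Id \<union> {(x, x)}) = {} \<longleftrightarrow> U \<subseteq> Id \<and> (x, x) \<notin> U" for U by blast
  have "Id_on \<rat> \<inter> (- Id \<union> {(x, x)}) = {}" unfolding iff using assms by auto
  from partial_iso_maximal[OF partial_iso_rationals this] that show thesis unfolding iff by metis
qed

text \<open>The rational function \<open>g / k\<close> takes its infinitely many values among the
  finitely many roots of \<open>f\<close>, so it takes one of them infinitely often and is
  constant.\<close>

lemma poly_eq_constant_multiple:
  fixes f g k :: "complex poly"
  assumes f: "f \<noteq> 0" and "k \<noteq> 0"
    and root: "\<And>t. poly k t \<noteq> 0 \<Longrightarrow> poly f (poly g t / poly k t) = 0"
  shows "\<exists>r. g = smult r k"
proof -
  have "infinite {t. poly k t \<noteq> 0}"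
  proof
    assume "finite {t. poly k t \<noteq> 0}"
    then have "finite ({t. poly k t \<noteq> 0} \<union> {t. poly k t = 0})"
      using poly_roots_finite[OF assms(2)] by simp
    moreover have "{t. poly k t \<noteq> 0} \<union> {t. poly k t = 0} = UNIV" by auto
    ultimately show False using infinite_UNIV_char_0 by metis
  qed
  moreover have "{t. poly k t \<noteq> 0} = (\<Union>r\<in>{r. poly f r = 0}. {t. poly k t \<noteq> 0 \<and> poly g t / poly k t = r})"
    using root by auto
  moreover have "finite {r. poly f r = 0}" using poly_roots_finite[OF f] .
  ultimately have "\<exists>r. infinite {t. poly k t \<noteq> 0 \<and> poly g t / poly k t = r}"
    by (metis (no_types, lifting) finite_UN)
  then obtain r where r: "infinite {t. poly k t \<noteq> 0 \<and> poly g t / poly k t = r}" by blast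
  have "{t. poly k t \<noteq> 0 \<and> poly g t / poly k t = r} \<subseteq> {t. poly (g - smult r k) t = 0}" by auto
  then have "infinite {t. poly (g - smult r k) t = 0}" using r finite_subset by blast
  then have "g - smult r k = 0" using poly_roots_finite by blast
  then show ?thesis by (intro exI[of _ r]) simp
qed

lemma poly_homogenize:
  fixes f g k :: "'a::field poly"
  assumes "poly k t \<noteq> 0"
  shows "poly (\<Sum>i\<le>degree f. smult (coeff f i) (g ^ i * k ^ (degree f - i))) t =
    poly k t ^ degree f * poly f (poly g t / poly k t)"
proof -
  have "coeff f i * (poly g t ^ i * poly k t ^ (degree f - i)) =
      poly k t ^ degree f * (coeff f i * (poly g t / poly k t) ^ i)" if "i \<le> degree f" for i
    using assms that by (simp add: power_divide power_diff)
  then show ?thesis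
    unfolding poly_sum poly_altdef[of f] sum_distrib_left by (intro sum.cong) simp_all
qed

context
  fixes R and x :: complex
  assumes R: "partial_iso R" "R \<subseteq> Id" "(x, x) \<notin> R"
    and max: "\<And>S. partial_iso S \<Longrightarrow> S \<subseteq> Id \<Longrightarrow> (x, x) \<notin> S \<Longrightarrow> R \<subseteq> S \<Longrightarrow> S = R"
begin

text \<open>Adjoining a transcendental \<open>y\<close> enlarges the subfield properly, so by
  maximality the larger field contains \<open>x\<close>, which is thus a rational function of
  \<open>y\<close>. For \<open>R\<close> below \<open>Id\<close>, the relation
  \<open>rel_polys R g g\<close> says that \<open>g\<close> has coefficients in the
  subfield.\<close>

lemma transcendental_extension:
  assumes y: "\<And>g. rel_polys R g g \<Longrightarrow> g \<noteq> 0 \<Longrightarrow> poly g y \<noteq> 0"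
  obtains g k where "rel_polys R g g" "rel_polys R k k" "k \<noteq> 0" "x * poly k y = poly g y"
proof -
  let ?S = "{(poly g y / poly k y, poly g' y / poly k' y) | g g' k k'.
      rel_polys R g g' \<and> rel_polys R k k'}"
  have "poly g y = 0 \<longleftrightarrow> poly g' y = 0" if "rel_polys R g g'" for g g'
    using rel_polys_Id_eq[OF R(2) that] by simp
  note S = partial_iso_extend[OF R(1) this]
  have "?S \<subseteq> Id"
  proof
    fix p assume "p \<in> ?S"
    then obtain g g' k k' where "p = (poly g y / poly k y, poly g' y / poly k' y)"
      "rel_polys R g g'" "rel_polys R k k'" by blast
    then show "p \<in> Id" by (metis rel_polys_Id_eq[OF R(2)] IdI)
  qed
  have "(y, y) \<notin> R"
  proof
    assume "(y, y) \<in> R"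
    then have "rel_polys R ([:0, 1:] - [:y:]) ([:0, 1:] - [:y:])"
      by (intro rel_polys_diff rel_polys_X rel_polys_const R)
    then show False using y by fastforce
  qed
  have "(x, x) \<in> ?S"
  proof (rule ccontr)
    assume "(x, x) \<notin> ?S"
    with S(1,2) \<open>?S \<subseteq> Id\<close> have "?S = R" by (intro max)
    then show False using S(3) \<open>(y, y) \<notin> R\<close> by (metis (no_types, lifting))
  qed
  then obtain g g' k k' where *: "rel_polys R g g'" "rel_polys R k k'" "x = poly g y / poly k y"
    by auto
  then have **: "rel_polys R g g" "rel_polys R k k" using rel_polys_Id_eq[OF R(2)] by blast+
  have "poly k y \<noteq> 0"
  proof
    assume "poly k y = 0"
    then have "x = 0" using * by simp
    then show False using R partial_iso_zero by blast
  qed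
  then show thesis using that[OF **] *(3) by force
qed

text \<open>A transcendental \<open>y\<close> would make \<open>x\<close> a rational function of
  \<open>y\<close>. If \<open>x\<close> is algebraic over \<open>R\<close>, this function is
  constant and \<open>x\<close> lies in \<open>R\<close>. If \<open>x\<close> is transcendental, so
  is \<open>x ^ 2\<close>, and with it in place of \<open>y\<close>, \<open>x\<close> becomes a
  rational function of \<open>x ^ 2\<close>; after clearing denominators one side has odd and the
  other even degree.\<close>

lemma algebraic_over_maximal: "\<exists>g. rel_polys R g g \<and> g \<noteq> 0 \<and> poly g y = 0"
proof (rule ccontr)
  assume "\<not> ?thesis"
  then have y: "poly g y \<noteq> 0" if "rel_polys R g g" "g \<noteq> 0" for g using that by blast
  show False
  proof (cases "\<exists>f. rel_polys R f f \<and> f \<noteq> 0 \<and> poly f x = 0")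
    case True
    then obtain f where f: "rel_polys R f f" "f \<noteq> 0" "poly f x = 0" by blast
    obtain g k where gk: "rel_polys R g g" "rel_polys R k k" "k \<noteq> 0" "x * poly k y = poly g y"
      using transcendental_extension[OF y] by blast
    \<comment> \<open>The numerator of \<open>f (g / k)\<close>. Its coefficients lie in the
      subfield and it vanishes at the transcendental \<open>y\<close>, hence identically.\<close>
    define H where "H = (\<Sum>i\<le>degree f. smult (coeff f i) (g ^ i * k ^ (degree f - i)))"
    have pw: "rel_polys R (l ^ i) (l ^ i)" if "rel_polys R l l" for l i
      by (induction i) (auto intro: rel_polys_1 rel_polys_mult that R(1))
    have sm: "rel_polys R (smult (coeff f i) l) (smult (coeff f i) l)" if "rel_polys R l l" for l i
      using that f(1) by (auto simp: rel_polys_def intro: partial_iso_mult[OF R(1)])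
    have "rel_polys R (\<Sum>i\<in>I. smult (coeff f i) (g ^ i * k ^ (degree f - i)))
        (\<Sum>i\<in>I. smult (coeff f i) (g ^ i * k ^ (degree f - i)))" for I
      by (induction I rule: infinite_finite_induct)
        (auto intro!: rel_polys_0 rel_polys_add rel_polys_mult sm pw gk(1,2) R(1))
    then have H: "rel_polys R H H" unfolding H_def .
    have ky: "poly k y \<noteq> 0" using y gk(2,3) by blast
    then have "poly H y = 0" using gk(4) f(3) poly_homogenize[OF ky, of f g] unfolding H_def
      by (metis mult_zero_right nonzero_mult_div_cancel_right)
    then have "H = 0" using y[OF H] by blast
    then have "poly f (poly g t / poly k t) = 0" if "poly k t \<noteq> 0" for t
      using poly_homogenize[OF that, of f g] that unfolding H_def by simp
    then obtain r where r: "g = smult r k" using poly_eq_constant_multiple[OF f(2) gk(3)] by blast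
    then have "x = r" using gk(4) ky by simp
    moreover have "r = coeff g (degree k) / coeff k (degree k)" using r gk(3) by simp
    moreover have "(coeff g (degree k) / coeff k (degree k), coeff g (degree k) / coeff k (degree k)) \<in> R"
      using gk by (intro partial_iso_divide[OF R(1)]) (auto simp: rel_polys_def)
    ultimately show False using R(3) by metis
  next
    case False
    then have x: "poly f x \<noteq> 0" if "rel_polys R f f" "f \<noteq> 0" for f using that by blast
    let ?sq = "monom (1::complex) 2"
    have sq: "rel_polys R (pcompose g ?sq) (pcompose g ?sq)" if "rel_polys R g g" for g
      using that
    proof (induction g)
      case (pCons a g)
      have "(a, a) \<in> R" "rel_polys R g g"
        using pCons.prems unfolding rel_polys_def by (metis coeff_pCons_0, metis coeff_pCons_Suc)
      then show ?case
        unfolding pcompose_pCons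
        by (intro rel_polys_add rel_polys_mult rel_polys_const rel_polys_monom
            partial_iso_one pCons.IH R(1))
    qed (simp add: rel_polys_0[OF R(1)])
    have "poly g (x ^ 2) \<noteq> 0" if "rel_polys R g g" "g \<noteq> 0" for g
    proof -
      have "pcompose g ?sq \<noteq> 0" using that(2) pcompose_eq_0[of g ?sq] by (auto simp: degree_monom_eq)
      then show ?thesis using x[OF sq[OF that(1)]] by (simp add: poly_pcompose poly_monom)
    qed
    then obtain g k where gk: "rel_polys R g g" "rel_polys R k k" "k \<noteq> 0"
        "x * poly k (x ^ 2) = poly g (x ^ 2)"
      using transcendental_extension by metis
    let ?f = "[:0, 1:] * pcompose k ?sq - pcompose g ?sq"
    have "rel_polys R ?f ?f"
      by (intro rel_polys_diff rel_polys_mult rel_polys_X sq gk R(1))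
    moreover have "poly ?f x = 0" using gk(4) by (simp add: poly_pcompose poly_monom)
    moreover have "?f \<noteq> 0"
    proof
      assume "?f = 0"
      then have eq: "[:0, 1:] * pcompose k ?sq = pcompose g ?sq" by simp
      have "degree ([:0, 1:] * pcompose k ?sq) = Suc (2 * degree k)"
        using gk(3) pcompose_eq_0[of k ?sq] by (auto simp: degree_monom_eq degree_pcompose)
      then have "degree g * 2 = Suc (2 * degree k)"
        unfolding eq by (simp add: degree_monom_eq degree_pcompose)
      then show False by presburger
    qed
    ultimately show False using x by blast
  qed
qed

text \<open>The minimal polynomial \<open>f\<close> of \<open>x\<close> has degree at least 2
  because \<open>x\<close> is not in \<open>R\<close>. In characteristic 0 its derivative has
  smaller degree and cannot vanish at \<open>x\<close>, so \<open>x\<close> is a simple root and any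
  root of \<open>f / (X - x)\<close> is a different conjugate.\<close>

lemma conjugate_over_maximal:
  obtains S x' where "partial_iso S" "R \<subseteq> S" "(x, x') \<in> S" "x' \<noteq> x"
proof -
  obtain f where f: "rel_polys R f f \<and> f \<noteq> 0 \<and> poly f x = 0"
    and min: "\<And>g. rel_polys R g g \<and> g \<noteq> 0 \<and> poly g x = 0 \<Longrightarrow> degree f \<le> degree g"
    using ex_has_least_nat[of "\<lambda>f. rel_polys R f f \<and> f \<noteq> 0 \<and> poly f x = 0"] algebraic_over_maximal by metis
  then obtain q where q: "f = [:- x, 1:] * q" using poly_eq_0_iff_dvd by blast
  have q0: "q \<noteq> 0" using f q by auto
  have d: "degree f = Suc (degree q)" unfolding q using q0 by (subst degree_mult_eq) auto
  have "rel_polys R (pderiv f) (pderiv f)"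
    using f by (auto simp: rel_polys_def coeff_pderiv intro!: partial_iso_mult partial_iso_of_nat[of _ "Suc _", simplified] R(1))
  moreover have "pderiv f \<noteq> 0" using d by (simp add: pderiv_eq_0_iff)
  ultimately have "poly (pderiv f) x \<noteq> 0"
    using min[of "pderiv f"] d by (auto simp: degree_pderiv)
  moreover have "poly (pderiv f) x = poly q x" unfolding q pderiv_mult by (simp add: pderiv_pCons)
  ultimately have qx: "poly q x \<noteq> 0" by simp
  have "degree q \<noteq> 0"
  proof
    assume "degree q = 0"
    then obtain c where "q = [:c:]" by (metis degree_eq_zeroE)
    then have "coeff f 0 = - x * c" "coeff f 1 = c" "c \<noteq> 0" using q q0 by auto
    then have "x = 0 - coeff f 0 / coeff f 1" by simp
    moreover have "(0 - coeff f 0 / coeff f 1, 0 - coeff f 0 / coeff f 1) \<in> R"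
      using f by (intro partial_iso_diff partial_iso_divide partial_iso_zero R) (auto simp: rel_polys_def)
    ultimately show False using R(3) by metis
  qed
  then have "\<not> constant (poly q)" by (simp add: constant_degree)
  then obtain x' where x': "poly q x' = 0" using fundamental_theorem_of_algebra by blast
  have "poly f x' = 0" using q x' by simp
  then have "poly g x = 0 \<longleftrightarrow> poly g' x' = 0" if "rel_polys R g g'" for g g'
    using minimal_rel_polys[OF R(1) _ _ _ _ _ that, of f f x x'] f min rel_polys_Id_eq[OF R(2)]
    by blast
  note S = partial_iso_extend[OF R(1) this]
  show thesis using that[OF S] x' qx by metis
qed

end

definition field_aut :: "(complex \<Rightarrow> complex) \<Rightarrow> bool" where
  "field_aut \<sigma> \<longleftrightarrow>
     bij \<sigma> \<and> (\<forall>x y. \<sigma> (x + y) = \<sigma> x + \<sigma> y) \<and> (\<forall>x y. \<sigma> (x * y) = \<sigma> x * \<sigma> y)"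

text \<open>A maximal extension \<open>T\<close> of the conjugation of \<open>x\<close> is total and
  onto: every number is algebraic over the fixed subfield \<open>R\<close>, so a missing one could
  still be adjoined to \<open>T\<close> or to its converse.\<close>

lemma fixed_by_automorphisms_rational:
  assumes "\<And>\<sigma>. field_aut \<sigma> \<Longrightarrow> \<sigma> x = x"
  shows "x \<in> \<rat>"
proof (rule ccontr)
  assume "x \<notin> \<rat>"
  then obtain R where R: "partial_iso R" "R \<subseteq> Id" "(x, x) \<notin> R"
    and max_R: "\<And>S. partial_iso S \<Longrightarrow> S \<subseteq> Id \<Longrightarrow> (x, x) \<notin> S \<Longrightarrow> R \<subseteq> S \<Longrightarrow> S = R"
    using partial_iso_avoiding_maximal by metis
  note alg = algebraic_over_maximal[OF R max_R]
  obtain S x' where S: "partial_iso S" "R \<subseteq> S" "(x, x') \<in> S" "x' \<noteq> x"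
    using conjugate_over_maximal[OF R max_R] by blast
  obtain T where T: "partial_iso T" "S \<subseteq> T"
    and max_T: "\<And>U. partial_iso U \<Longrightarrow> T \<subseteq> U \<Longrightarrow> U = T"
    using partial_iso_maximal[OF S(1) Int_empty_right] by (metis Int_empty_right)
  have conv: "T\<inverse> \<subseteq> U \<Longrightarrow> T \<subseteq> U\<inverse>" for U by auto
  have dom: "\<exists>z. (y, z) \<in> T" for y
  proof -
    obtain g where g: "rel_polys R g g" "g \<noteq> 0" "poly g y = 0" using alg by blast
    have "rel_polys T g g" using g(1) S(2) T(2) by (auto simp: rel_polys_def)
    from partial_iso_extend_algebraic[OF T(1) this g(2,3)] show ?thesis using max_T by blast
  qed
  have ran: "\<exists>y. (y, z) \<in> T" for z
  proof -
    obtain g where g: "rel_polys R g g" "g \<noteq> 0" "poly g z = 0" using alg by blast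
    have "rel_polys (T\<inverse>) g g" using g(1) S(2) T(2) R(2) by (auto simp: rel_polys_def)
    from partial_iso_extend_algebraic[OF partial_iso_converse[OF T(1)] this g(2,3)]
    obtain U y where "partial_iso U" "T\<inverse> \<subseteq> U" "(z, y) \<in> U" by blast
    then have "U\<inverse> = T" using max_T[OF partial_iso_converse conv] by blast
    then show ?thesis using \<open>(z, y) \<in> U\<close> by blast
  qed
  define \<sigma> where "\<sigma> y = (THE z. (y, z) \<in> T)" for y
  have \<sigma>: "\<sigma> y = z \<longleftrightarrow> (y, z) \<in> T" for y z
  proof -
    have "\<exists>!z. (y, z) \<in> T" using dom partial_iso_unique[OF T(1)] by blast
    then show ?thesis unfolding \<sigma>_def by (metis theI')
  qed
  have "bij \<sigma>"
  proof (rule bijI)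
    show "inj \<sigma>"
      using partial_iso_unique[OF partial_iso_converse[OF T(1)]] \<sigma> by (intro injI) (metis converse_iff)
    show "surj \<sigma>" using ran \<sigma> by (metis surjI)
  qed
  then have "field_aut \<sigma>"
    unfolding field_aut_def
    using \<sigma> partial_iso_add[OF T(1)] partial_iso_mult[OF T(1)] by metis
  moreover have "\<sigma> x = x'" using \<sigma> S(3) T(2) by blast
  ultimately show False using assms S(4) by metis
qed

section \<open>Galois descent\<close>

lemma field_aut_add: "field_aut \<sigma> \<Longrightarrow> \<sigma> (x + y) = \<sigma> x + \<sigma> y"
  and field_aut_mult: "field_aut \<sigma> \<Longrightarrow> \<sigma> (x * y) = \<sigma> x * \<sigma> y"
  and field_aut_bij: "field_aut \<sigma> \<Longrightarrow> bij \<sigma>"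
  by (auto simp: field_aut_def)

lemma field_aut_id: "field_aut id"
  by (simp add: field_aut_def)

lemma field_aut_cnj: "field_aut cnj"
  by (auto simp: field_aut_def intro!: bijI injI surjI[of _ cnj])

lemma field_aut_comp: "field_aut \<sigma> \<Longrightarrow> field_aut \<tau> \<Longrightarrow> field_aut (\<sigma> \<circ> \<tau>)"
  by (auto simp: field_aut_def intro: bij_comp)

lemma field_aut_inv:
  assumes "field_aut \<sigma>"
  shows "field_aut (inv_into UNIV \<sigma>)"
proof -
  have b: "bij \<sigma>" using assms field_aut_bij by blast
  have "inv_into UNIV \<sigma> (x + y) = inv_into UNIV \<sigma> x + inv_into UNIV \<sigma> y" "inv_into UNIV \<sigma> (x * y) = inv_into UNIV \<sigma> x * inv_into UNIV \<sigma> y" for x y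
    using b by (metis assms bij_inv_eq_iff field_aut_add, metis assms bij_inv_eq_iff field_aut_mult)
  then show ?thesis using bij_imp_bij_inv[OF b] by (simp add: field_aut_def)
qed

context
  fixes \<sigma> assumes \<sigma>: "field_aut \<sigma>"
begin

lemma field_aut_0: "\<sigma> 0 = 0"
  using field_aut_add[OF \<sigma>, of 0 0] by simp

lemma field_aut_eq_0_iff: "\<sigma> x = 0 \<longleftrightarrow> x = 0"
  using field_aut_bij[OF \<sigma>] field_aut_0 by (metis bij_pointE)

lemma field_aut_1: "\<sigma> 1 = 1"
  using field_aut_mult[OF \<sigma>, of 1 1] field_aut_eq_0_iff[of 1] by simp

lemma field_aut_minus: "\<sigma> (- x) = - \<sigma> x"
  using field_aut_add[OF \<sigma>, of x "- x"] field_aut_0 by (simp add: add_eq_0_iff)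

lemma field_aut_sum: "\<sigma> (sum f I) = (\<Sum>i\<in>I. \<sigma> (f i))"
  by (induction I rule: infinite_finite_induct)
    (simp_all add: field_aut_0 field_aut_add[OF \<sigma>])

lemma field_aut_inverse: "\<sigma> (inverse x) = inverse (\<sigma> x)"
proof (cases "x = 0")
  case False
  then have "\<sigma> x * \<sigma> (inverse x) = 1"
    using field_aut_mult[OF \<sigma>, of x "inverse x"] field_aut_1 by simp
  then show ?thesis by (metis inverse_unique)
qed (simp add: field_aut_0)

lemma field_aut_power: "\<sigma> (x ^ k) = \<sigma> x ^ k"
  by (induction k) (simp_all add: field_aut_1 field_aut_mult[OF \<sigma>])

lemma field_aut_power_int: "\<sigma> (x powi k) = \<sigma> x powi k"
  by (simp add: power_int_def field_aut_power field_aut_inverse)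

lemma field_aut_of_rat: "\<sigma> (of_rat q) = of_rat q"
proof -
  have nat: "\<sigma> (of_nat k) = of_nat k" for k
    by (induction k) (simp_all add: field_aut_0 field_aut_1 field_aut_add[OF \<sigma>])
  have int: "\<sigma> (of_int k) = of_int k" for k
    by (cases k rule: int_cases2) (simp_all add: nat field_aut_minus)
  show ?thesis
    by (cases q) (simp add: of_rat_rat divide_inverse field_aut_mult[OF \<sigma>] field_aut_inverse int)
qed

lemma field_aut_Rats: "x \<in> \<rat> \<Longrightarrow> \<sigma> x = x"
  by (auto simp: Rats_def field_aut_of_rat)

end

section \<open>Entrywise action on vectors and matrices\<close>

definition map_vec :: "('a \<Rightarrow> 'b) \<Rightarrow> 'a^'n \<Rightarrow> 'b^'n" where
  "map_vec f v = (\<chi> i. f (v $ i))"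

lemma map_vec_nth [simp]: "map_vec f v $ i = f (v $ i)"
  by (simp add: map_vec_def)

lemma map_vec_comp: "map_vec f (map_vec g v) = map_vec (f \<circ> g) v"
  by (simp add: vec_eq_iff)

lemma map_matrix_comp: "map_matrix f (map_matrix g A) = map_matrix (f \<circ> g) A"
  by (simp add: vec_eq_iff)

context
  fixes \<sigma> assumes \<sigma>: "field_aut \<sigma>"
begin

lemma map_vec_add: "map_vec \<sigma> (v + w) = map_vec \<sigma> v + map_vec \<sigma> w"
  by (simp add: vec_eq_iff field_aut_add[OF \<sigma>])

lemma map_vec_scale: "map_vec \<sigma> (c *s v) = \<sigma> c *s map_vec \<sigma> v"
  by (simp add: vec_eq_iff field_aut_mult[OF \<sigma>])

lemma map_vec_0: "map_vec \<sigma> 0 = 0"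
  by (simp add: vec_eq_iff field_aut_0[OF \<sigma>])

lemma map_vec_eq_0_iff: "map_vec \<sigma> v = 0 \<longleftrightarrow> v = 0"
  by (simp add: vec_eq_iff field_aut_eq_0_iff[OF \<sigma>])

lemma map_vec_sum: "map_vec \<sigma> (sum f I) = (\<Sum>i\<in>I. map_vec \<sigma> (f i))"
  by (induction I rule: infinite_finite_induct) (simp_all add: map_vec_0 map_vec_add)

lemma map_vec_matrix_vector: "map_vec \<sigma> (A *v v) = map_matrix \<sigma> A *v map_vec \<sigma> v"
  by (simp add: vec_eq_iff matrix_vector_mult_def field_aut_sum[OF \<sigma>] field_aut_mult[OF \<sigma>])

lemma map_matrix_mult: "map_matrix \<sigma> (A ** B) = map_matrix \<sigma> A ** map_matrix \<sigma> B"
  by (simp add: vec_eq_iff matrix_matrix_mult_def field_aut_sum[OF \<sigma>] field_aut_mult[OF \<sigma>])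

lemma map_matrix_mat_1: "map_matrix \<sigma> (mat 1) = mat 1"
  by (simp add: vec_eq_iff mat_def field_aut_0[OF \<sigma>] field_aut_1[OF \<sigma>])

lemma inj_map_vec: "inj (map_vec \<sigma>)"
  using field_aut_bij[OF \<sigma>] by (auto simp: inj_def vec_eq_iff bij_def)

lemma map_vec_in_span:
  assumes "v \<in> vec.span B"
  shows "map_vec \<sigma> v \<in> vec.span (map_vec \<sigma> ` B)"
  using assms
proof (induction rule: vec.span_induct_alt)
  case base
  then show ?case by (simp add: map_vec_0 vec.span_zero)
next
  case (step c x y)
  then show ?case
    by (simp add: map_vec_add map_vec_scale vec.span_add vec.span_scale vec.span_base)
qed

lemma polynomial_functions_automorphism:
  "f \<in> polynomial_functions \<rat> \<Longrightarrow> f (map_matrix \<sigma> A) = \<sigma> (f A)"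
  by (induction rule: polynomial_functions.induct)
    (simp_all add: field_aut_Rats[OF \<sigma>] field_aut_add[OF \<sigma>] field_aut_mult[OF \<sigma>])

lemma rational_algebraic_group_automorphism:
  assumes "rational_algebraic_group H" "A \<in> H"
  shows "map_matrix \<sigma> A \<in> H"
proof -
  obtain F where F: "F \<subseteq> polynomial_functions \<rat>" "H = {A\<in>general_linear. \<forall>f\<in>F. f A = 0}"
    using assms(1) unfolding rational_algebraic_group_def closedin_subtopology by (auto simp: closedin_zariski)
  have "f (map_matrix \<sigma> A) = 0" if "f \<in> F" for f
  proof -
    have "f \<in> polynomial_functions \<rat>" "f A = 0" using that assms(2) F by auto
    then show ?thesis using polynomial_functions_automorphism[of f A] field_aut_0[OF \<sigma>] by simp
  qed
  moreover have "invertible A" using assms(2) F(2) by (simp add: general_linear_def)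
  then have "invertible (map_matrix \<sigma> A)"
    unfolding invertible_def by (metis map_matrix_mult map_matrix_mat_1)
  ultimately show ?thesis using F(2) by (auto simp: general_linear_def)
qed

end

lemma stable_subspace_rational_span:
  fixes W :: "(complex^'n) set"
  assumes W: "vec.subspace W" and stable: "\<And>\<sigma> v. field_aut \<sigma> \<Longrightarrow> v \<in> W \<Longrightarrow> map_vec \<sigma> v \<in> W"
  shows "W \<subseteq> vec.span (W \<inter> {v. \<forall>i. v $ i \<in> \<rat>})"
proof
  define supp where "supp v = {i. v $ i \<noteq> 0}" for v :: "complex^'n"
  fix v assume "v \<in> W"
  then show "v \<in> vec.span (W \<inter> {v. \<forall>i. v $ i \<in> \<rat>})"
  proof (induction "card (supp v)" arbitrary: v rule: less_induct)
    case less
    show ?case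
    proof (cases "v = 0")
      case False
      \<comment> \<open>A normalized vector of minimal support is fixed by every automorphism.\<close>
      obtain w where w: "w \<in> W \<and> w \<noteq> 0 \<and> supp w \<subseteq> supp v"
        and min: "\<And>u. u \<in> W \<and> u \<noteq> 0 \<and> supp u \<subseteq> supp v \<Longrightarrow> card (supp w) \<le> card (supp u)"
        using ex_has_least_nat[of "\<lambda>w. w \<in> W \<and> w \<noteq> 0 \<and> supp w \<subseteq> supp v" v "\<lambda>w. card (supp w)"] less.prems False
        by blast
      then obtain i where i: "w $ i \<noteq> 0" by (auto simp: vec_eq_iff)
      define u where "u = inverse (w $ i) *s w"
      have u: "u \<in> W" "u $ i = 1" "supp u = supp w"
        using w i W by (auto simp: u_def supp_def vec.subspace_scale)
      have rat: "u $ k \<in> \<rat>" for k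
      proof (rule fixed_by_automorphisms_rational)
        fix \<sigma> assume \<sigma>: "field_aut \<sigma>"
        have sub: "supp (map_vec \<sigma> u - u) \<subseteq> supp w - {i}"
        proof
          fix k assume "k \<in> supp (map_vec \<sigma> u - u)"
          then have "\<sigma> (u $ k) \<noteq> u $ k" by (simp add: supp_def)
          then have "u $ k \<noteq> 0" "k \<noteq> i"
            using u(2) field_aut_0[OF \<sigma>] field_aut_1[OF \<sigma>] by metis+
          then show "k \<in> supp w - {i}" using u(3) by (auto simp: supp_def)
        qed
        have "i \<in> supp w" using i by (simp add: supp_def)
        then have "card (supp (map_vec \<sigma> u - u)) < card (supp w)"
          using sub by (intro psubset_card_mono) auto
        moreover have "map_vec \<sigma> u - u \<in> W" using stable[OF \<sigma> u(1)] u(1) W by (intro vec.subspace_diff)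
        ultimately have "map_vec \<sigma> u - u = 0" using min[of "map_vec \<sigma> u - u"] w sub by force
        then have "map_vec \<sigma> u = u" by simp
        then show "\<sigma> (u $ k) = u $ k" by (metis map_vec_nth)
      qed
      \<comment> \<open>The support of \<open>u\<close> lies inside that of \<open>v\<close>, so
        subtracting this multiple clears coordinate \<open>i\<close> without creating new nonzero
        ones.\<close>
      have "supp (v - v $ i *s u) \<subseteq> supp v - {i}"
        using u w by (auto simp: supp_def)
      moreover have "i \<in> supp v" using w i by (auto simp: supp_def)
      ultimately have "card (supp (v - v $ i *s u)) < card (supp v)"
        by (intro psubset_card_mono) auto
      then have "v - v $ i *s u \<in> vec.span (W \<inter> {v. \<forall>i. v $ i \<in> \<rat>})"
        using less u(1) W by (auto intro: vec.subspace_diff vec.subspace_scale)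
      moreover have "v $ i *s u \<in> vec.span (W \<inter> {v. \<forall>i. v $ i \<in> \<rat>})"
        using u(1) rat by (intro vec.span_scale vec.span_base) auto
      ultimately show ?thesis using vec.span_add by fastforce
    qed (simp add: vec.span_zero)
  qed
qed

section \<open>Common eigenvectors\<close>

lemmas mat_scale = vec.linear_scale[OF matrix_vector_mul_linear_gen]
lemmas mat_sum = vec.linear_sum[OF matrix_vector_mul_linear_gen]
lemmas mat_diff = vec.linear_diff[OF matrix_vector_mul_linear_gen]

text \<open>The operators single out the individual components of a sum of eigenvectors, and
  \<open>U\<close> is stable under them. The choice \<open>U = {0}\<close> gives linear
  independence; an invariant line shows that an eigenvector has a single component.\<close>

lemma eigen_components_in_subspace:
  fixes A :: "'i \<Rightarrow> 'a::field^'n^'n" and f :: "'x \<Rightarrow> 'a^'n"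
  assumes "finite X" and eig: "\<And>x i. x \<in> X \<Longrightarrow> i \<in> I \<Longrightarrow> A i *v f x = e x i *s f x"
    and sep: "\<And>x y. x \<in> X \<Longrightarrow> y \<in> X \<Longrightarrow> x \<noteq> y \<Longrightarrow> \<exists>i\<in>I. e x i \<noteq> e y i"
    and U: "vec.subspace U" "\<And>i u. i \<in> I \<Longrightarrow> u \<in> U \<Longrightarrow> A i *v u \<in> U"
    and "(\<Sum>x\<in>X. f x) \<in> U" and "x \<in> X"
  shows "f x \<in> U"
  using assms(1) eig sep assms(6,7)
proof (induction X arbitrary: f x rule: finite_induct)
  case (insert y X)
  have *: "f x \<in> U" if x: "x \<in> X" for x
  proof -
    obtain i where i: "i \<in> I" "e x i \<noteq> e y i" using insert.prems(2)[of x y] x insert.hyps by auto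
    \<comment> \<open>Applying \<open>A i\<close> minus the scalar \<open>e y i\<close> kills the
      component of \<open>y\<close> and multiplies that of \<open>x\<close> by a nonzero
      number.\<close>
    have "(\<Sum>x\<in>X. (e x i - e y i) *s f x) = A i *v (\<Sum>x\<in>insert y X. f x) - e y i *s (\<Sum>x\<in>insert y X. f x)"
      using insert.hyps insert.prems(1) i(1)
      by (simp add: matrix_vector_right_distrib vec.scale_right_distrib vec.scale_sum_right
          mat_sum vec.scale_left_diff_distrib sum_subtractf)
    then have "(\<Sum>x\<in>X. (e x i - e y i) *s f x) \<in> U"
      using insert.prems(3) U i(1) by (simp add: vec.subspace_diff vec.subspace_scale)
    moreover have "A j *v ((e x i - e y i) *s f x) = e x j *s ((e x i - e y i) *s f x)" if "x \<in> X" "j \<in> I" for x j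
    proof -
      have "A j *v ((e x i - e y i) *s f x) = (e x i - e y i) *s (A j *v f x)"
        by (rule mat_scale)
      then show ?thesis using insert.prems(1)[of x j] that by (simp only: insert_iff vec.scale_scale mult.commute simp_thms)
    qed
    ultimately have "(e x i - e y i) *s f x \<in> U"
      using insert.IH[of "\<lambda>x. (e x i - e y i) *s f x" x] insert.prems(2) x by auto
    then have "inverse (e x i - e y i) *s ((e x i - e y i) *s f x) \<in> U"
      using U(1) vec.subspace_scale by blast
    then show ?thesis using i(2) by (simp only: vec.scale_scale) simp
  qed
  have "f y = (\<Sum>x\<in>insert y X. f x) - (\<Sum>x\<in>X. f x)" using insert.hyps by simp
  moreover have "(\<Sum>x\<in>X. f x) \<in> U" using * U(1) by (intro vec.subspace_sum)
  ultimately have "f y \<in> U" using insert.prems(3) U(1) vec.subspace_diff by metis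
  then show ?case using * insert.prems(4) by blast
qed simp

lemma span_Union_decomposition:
  fixes E :: "'x \<Rightarrow> ('a::field^'n) set"
  assumes E: "\<And>x. vec.subspace (E x)" and "v \<in> vec.span (\<Union>x. E x)"
  shows "\<exists>X f. finite X \<and> (\<forall>x. f x \<in> E x) \<and> v = (\<Sum>x\<in>X. f x)"
  using assms(2)
proof (induction rule: vec.span_induct_alt)
  case base
  show ?case using E by (intro exI[of _ "{}"] exI[of _ "\<lambda>_. 0"]) (auto simp: vec.subspace_0)
next
  case (step c u w)
  obtain y where y: "u \<in> E y" using step by blast
  obtain X f where f: "finite X" "\<forall>x. f x \<in> E x" "w = (\<Sum>x\<in>X. f x)" using step by blast
  let ?f = "\<lambda>x. (if x \<in> X then f x else 0) + (if x = y then c *s u else 0)"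
  have "(\<Sum>x\<in>insert y X. ?f x) = c *s u + w"
  proof -
    have "(\<Sum>x\<in>insert y X. if x \<in> X then f x else 0) = w"
      unfolding f(3) using f(1) by (intro sum.mono_neutral_cong_right) auto
    then show ?thesis using f(1) by (simp add: sum.distrib)
  qed
  moreover have "?f x \<in> E x" for x
    using f(2) y E by (auto intro!: vec.subspace_add vec.subspace_scale vec.subspace_0)
  ultimately show ?case using f(1) by (intro exI[of _ "insert y X"] exI[of _ ?f]) auto
qed

text \<open>The index set may be infinite, so the induction is on the dimension of \<open>U\<close>.
  Some \<open>A i\<close> not acting by a scalar on each vector splits \<open>U\<close> into proper
  pieces \<open>U \<inter> E c\<close>, which the whole family preserves because it
  commutes.\<close>

lemma simultaneous_eigenvectors_span:
  fixes A :: "'i \<Rightarrow> 'a::field^'n^'n"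
  assumes comm: "\<And>i j. i \<in> I \<Longrightarrow> j \<in> I \<Longrightarrow> A i ** A j = A j ** A i"
    and diag: "\<And>i. i \<in> I \<Longrightarrow> vec.span {v. \<exists>c. A i *v v = c *s v} = UNIV"
    and U: "vec.subspace U" "\<And>i u. i \<in> I \<Longrightarrow> u \<in> U \<Longrightarrow> A i *v u \<in> U"
  shows "U \<subseteq> vec.span {u\<in>U. \<forall>i\<in>I. \<exists>c. A i *v u = c *s u}"
  using U
proof (induction "vec.dim U" arbitrary: U rule: less_induct)
  case less
  show ?case
  proof (cases "\<forall>u\<in>U. \<forall>i\<in>I. \<exists>c. A i *v u = c *s u")
    case True
    then have "{u\<in>U. \<forall>i\<in>I. \<exists>c. A i *v u = c *s u} = U" by blast
    then show ?thesis using vec.span_superset by metis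
  next
    case False
    then obtain u0 i where i: "i \<in> I" "u0 \<in> U" "\<And>c. A i *v u0 \<noteq> c *s u0" by blast
    define E where "E c = {v. A i *v v = c *s v}" for c
    have E: "vec.subspace (E c)" for c
      by (rule vec.subspaceI) (simp_all add: E_def matrix_vector_right_distrib vec.scale_right_distrib
          mat_scale vec.scale_left_commute)
    have IH: "U \<inter> E c \<subseteq> vec.span {u\<in>U \<inter> E c. \<forall>i\<in>I. \<exists>c. A i *v u = c *s u}" for c
    proof (rule less.hyps)
      have "U \<inter> E c \<subset> U" using i unfolding E_def by blast
      moreover have "vec.span (U \<inter> E c) = U \<inter> E c" "vec.span U = U"
        using less.prems(1) E by (metis vec.span_eq_iff vec.subspace_inter)+
      ultimately show "vec.dim (U \<inter> E c) < vec.dim U" by (intro vec.dim_psubset) (simp only:)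
      show "vec.subspace (U \<inter> E c)" using less.prems(1) E vec.subspace_inter by blast
      show "A j *v u \<in> U \<inter> E c" if "j \<in> I" "u \<in> U \<inter> E c" for j u
      proof -
        have "A i *v (A j *v u) = A j *v (A i *v u)"
          using comm[OF i(1) that(1)] by (simp add: matrix_vector_mul_assoc)
        also have "\<dots> = c *s (A j *v u)"
          using that(2) by (simp add: E_def mat_scale)
        finally show ?thesis using less.prems(2) that by (simp add: E_def)
      qed
    qed
    show ?thesis
    proof
      fix u assume u: "u \<in> U"
      have "{v. \<exists>c. A i *v v = c *s v} = (\<Union>c. E c)" by (auto simp: E_def)
      then have "u \<in> vec.span (\<Union>c. E c)" using diag[OF i(1)] by simp
      then obtain X f where f: "finite X" "\<forall>c. f c \<in> E c" "u = (\<Sum>c\<in>X. f c)"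
        using span_Union_decomposition[of E u, OF E] by metis
      have "f c \<in> vec.span {u\<in>U. \<forall>i\<in>I. \<exists>c. A i *v u = c *s u}" if c: "c \<in> X" for c
      proof -
        have "f c \<in> U"
          by (rule eigen_components_in_subspace[where X = X and I = "{i}" and A = A and e = "\<lambda>c _. c" and f = f])
            (use f less.prems i(1) u c in \<open>auto simp: E_def\<close>)
        then have "f c \<in> vec.span {u\<in>U \<inter> E c. \<forall>i\<in>I. \<exists>c. A i *v u = c *s u}" using IH f(2) by blast
        moreover have "{u\<in>U \<inter> E c. \<forall>i\<in>I. \<exists>c. A i *v u = c *s u} \<subseteq> {u\<in>U. \<forall>i\<in>I. \<exists>c. A i *v u = c *s u}"
          by blast
        ultimately show ?thesis using vec.span_mono by blast
      qed
      then show "u \<in> vec.span {u\<in>U. \<forall>i\<in>I. \<exists>c. A i *v u = c *s u}"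
        unfolding f(3) by (intro vec.span_sum) auto
    qed
  qed
qed

lemma eigen_components_zero:
  fixes A :: "'i \<Rightarrow> 'a::field^'n^'n" and f :: "'x \<Rightarrow> 'a^'n"
  assumes "finite X" "\<And>x i. x \<in> X \<Longrightarrow> i \<in> I \<Longrightarrow> A i *v f x = e x i *s f x"
    and "\<And>x y. x \<in> X \<Longrightarrow> y \<in> X \<Longrightarrow> x \<noteq> y \<Longrightarrow> \<exists>i\<in>I. e x i \<noteq> e y i"
    and "(\<Sum>x\<in>X. f x) = 0" "x \<in> X"
  shows "f x = 0"
proof -
  have "f x \<in> {0}"
    by (rule eigen_components_in_subspace[OF assms(1-3)])
      (use assms(4,5) in \<open>auto simp: matrix_vector_mult_0_right vec.subspace_def\<close>)
  then show ?thesis by simp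
qed

definition eigenvalue_of :: "('a::field)^'n^'n \<Rightarrow> 'a^'n \<Rightarrow> 'a" where
  "eigenvalue_of A v = (THE c. A *v v = c *s v)"

lemma eigenvalue_of_eq: "v \<noteq> 0 \<Longrightarrow> A *v v = c *s v \<Longrightarrow> eigenvalue_of A v = c"
  unfolding eigenvalue_of_def by (rule the_equality) simp_all

text \<open>Distinct members have distinct systems of eigenvalues. A vector is therefore the sum of
  at most one such set, and this uniqueness lets an automorphism that fixes the vector permute the
  set.\<close>

definition eigen_decomposition :: "'i set \<Rightarrow> ('i \<Rightarrow> ('a::field)^'n^'n) \<Rightarrow> ('a^'n) set \<Rightarrow> bool" where
  "eigen_decomposition I A S \<longleftrightarrow> finite S \<and> 0 \<notin> S \<and>
     (\<forall>s\<in>S. \<forall>i\<in>I. A i *v s = eigenvalue_of (A i) s *s s) \<and>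
     (\<forall>s\<in>S. \<forall>t\<in>S. s \<noteq> t \<longrightarrow> (\<exists>i\<in>I. eigenvalue_of (A i) s \<noteq> eigenvalue_of (A i) t))"

lemma ex_eigen_decomposition:
  fixes A :: "'i \<Rightarrow> 'a::field^'n^'n"
  assumes "v \<in> vec.span {u. \<forall>i\<in>I. \<exists>c. A i *v u = c *s u}"
  shows "\<exists>S. eigen_decomposition I A S \<and> v = \<Sum>S"
proof -
  \<comment> \<open>A nonzero vector belongs to \<open>E \<kappa>\<close> only if \<kappa> is zero
    off \<open>I\<close>. Different \<kappa> with nonzero components thus already differ on
    \<open>I\<close>.\<close>
  define E where "E \<kappa> = {u. (\<forall>i\<in>I. A i *v u = \<kappa> i *s u) \<and> ((\<exists>i. i \<notin> I \<and> \<kappa> i \<noteq> 0) \<longrightarrow> u = 0)}" for \<kappa>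
  have E: "vec.subspace (E \<kappa>)" for \<kappa>
    by (rule vec.subspaceI) (simp_all add: E_def matrix_vector_right_distrib vec.scale_right_distrib
        mat_scale vec.scale_left_commute)
  have "{u. \<forall>i\<in>I. \<exists>c. A i *v u = c *s u} \<subseteq> (\<Union>\<kappa>. E \<kappa>)"
  proof
    fix u assume u: "u \<in> {u. \<forall>i\<in>I. \<exists>c. A i *v u = c *s u}"
    define \<kappa> where "\<kappa> i = (if i \<in> I then SOME c. A i *v u = c *s u else 0)" for i
    have "A i *v u = \<kappa> i *s u" if "i \<in> I" for i
      using u that someI_ex[of "\<lambda>c. A i *v u = c *s u"] by (simp add: \<kappa>_def)
    then have "u \<in> E \<kappa>" by (auto simp: E_def \<kappa>_def)
    then show "u \<in> (\<Union>\<kappa>. E \<kappa>)" by blast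
  qed
  then have "v \<in> vec.span (\<Union>\<kappa>. E \<kappa>)" using assms vec.span_mono by blast
  then obtain X f where f: "finite X" "\<forall>\<kappa>. f \<kappa> \<in> E \<kappa>" "v = (\<Sum>\<kappa>\<in>X. f \<kappa>)"
    using span_Union_decomposition[of E v, OF E] by metis
  let ?X = "{\<kappa>\<in>X. f \<kappa> \<noteq> 0}"
  have eig: "A i *v f \<kappa> = \<kappa> i *s f \<kappa>" if "i \<in> I" for i \<kappa> using f(2) that by (auto simp: E_def)
  have ev: "eigenvalue_of (A i) (f \<kappa>) = \<kappa> i" if "i \<in> I" "f \<kappa> \<noteq> 0" for i \<kappa>
    by (rule eigenvalue_of_eq) (use that eig in auto)
  have ext: "\<kappa> i = 0" if "i \<notin> I" "f \<kappa> \<noteq> 0" for i \<kappa> using f(2) that by (auto simp: E_def)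
  have sep: "\<exists>i\<in>I. eigenvalue_of (A i) (f \<kappa>) \<noteq> eigenvalue_of (A i) (f \<psi>)"
    if "\<kappa> \<noteq> \<psi>" "f \<kappa> \<noteq> 0" "f \<psi> \<noteq> 0" for \<kappa> \<psi>
  proof (rule ccontr)
    assume "\<not> ?thesis"
    then have "\<kappa> i = \<psi> i" if "i \<in> I" for i using that ev \<open>f \<kappa> \<noteq> 0\<close> \<open>f \<psi> \<noteq> 0\<close> by metis
    moreover have "\<kappa> i = \<psi> i" if "i \<notin> I" for i using that ext \<open>f \<kappa> \<noteq> 0\<close> \<open>f \<psi> \<noteq> 0\<close> by metis
    ultimately show False using that(1) by blast
  qed
  have "v = (\<Sum>\<kappa>\<in>?X. f \<kappa>)" unfolding f(3) by (rule sum.mono_neutral_right) (use f(1) in auto)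
  also have "\<dots> = \<Sum>(f ` ?X)"
  proof (rule sum.reindex[symmetric, unfolded o_def, where h = f and g = "\<lambda>x. x"])
    show "inj_on f ?X" using sep by (intro inj_onI) (metis (mono_tags, lifting) mem_Collect_eq)
  qed
  finally have "v = \<Sum>(f ` ?X)" .
  moreover have "eigen_decomposition I A (f ` ?X)"
    unfolding eigen_decomposition_def
  proof (intro conjI ballI impI)
    fix s t assume st: "s \<in> f ` ?X" "t \<in> f ` ?X" "s \<noteq> t"
    then obtain \<kappa> \<psi> where *: "s = f \<kappa>" "t = f \<psi>" "f \<kappa> \<noteq> 0" "f \<psi> \<noteq> 0" by auto
    show "\<exists>i\<in>I. eigenvalue_of (A i) s \<noteq> eigenvalue_of (A i) t"
      using sep[of \<kappa> \<psi>] st(3) unfolding * by (metis *(3,4))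
  qed (use f(1) in \<open>auto simp: eig ev\<close>)
  ultimately show ?thesis by blast
qed

text \<open>Sort the difference of the two sums by systems of eigenvalues: each sorted part
  \<open>g \<kappa>\<close> must vanish. As each set has at most one member for a given system, the
  member of \<open>S\<close> equals that of \<open>T\<close>.\<close>

lemma eigen_decomposition_subset:
  fixes A :: "'i \<Rightarrow> 'a::field^'n^'n"
  assumes S: "eigen_decomposition I A S" and T: "eigen_decomposition I A T" and eq: "\<Sum>S = \<Sum>T"
  shows "S \<subseteq> T"
proof
  fix s assume s: "s \<in> S"
  define ev where "ev v = (\<lambda>i. if i \<in> I then eigenvalue_of (A i) v else 0)" for v
  have ev_eq: "v = w" if "eigen_decomposition I A R" "v \<in> R" "w \<in> R" "ev v = ev w" for v w R
    using that unfolding eigen_decomposition_def ev_def by (metis (no_types, lifting))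
  have fin: "finite S" "finite T" using S T by (auto simp: eigen_decomposition_def)
  let ?X = "ev ` (S \<union> T)"
  define g where "g \<kappa> = (\<Sum>v\<in>{v\<in>S. ev v = \<kappa>}. v) - (\<Sum>v\<in>{v\<in>T. ev v = \<kappa>}. v)" for \<kappa>
  have "(\<Sum>\<kappa>\<in>?X. \<Sum>v\<in>{v\<in>R. ev v = \<kappa>}. v) = \<Sum>R" if "finite R" "R \<subseteq> S \<union> T" for R
    by (rule sum.group) (use that fin in auto)
  then have g0: "(\<Sum>\<kappa>\<in>?X. g \<kappa>) = 0" unfolding g_def sum_subtractf using fin eq by simp
  have g_eig: "A i *v g \<kappa> = \<kappa> i *s g \<kappa>" if i: "i \<in> I" for \<kappa> i
  proof -
    have "A i *v (\<Sum>v\<in>{v\<in>R. ev v = \<kappa>}. v) = \<kappa> i *s (\<Sum>v\<in>{v\<in>R. ev v = \<kappa>}. v)"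
      if "eigen_decomposition I A R" for R
    proof -
      have "A i *v v = \<kappa> i *s v" if "v \<in> R" "ev v = \<kappa>" for v
      proof -
        have "A i *v v = eigenvalue_of (A i) v *s v"
          using \<open>eigen_decomposition I A R\<close> that(1) i by (simp add: eigen_decomposition_def)
        also have "eigenvalue_of (A i) v = \<kappa> i" using that(2) i by (auto simp: ev_def)
        finally show ?thesis .
      qed
      then show ?thesis
        by (simp add: mat_sum vec.scale_sum_right)
    qed
    then show ?thesis using S T
      by (simp only: g_def mat_diff vec.scale_right_diff_distrib)
  qed
  have sep: "\<exists>i\<in>I. \<kappa> i \<noteq> \<psi> i" if "\<kappa> \<in> ?X" "\<psi> \<in> ?X" "\<kappa> \<noteq> \<psi>" for \<kappa> \<psi>
    using that by (auto simp: ev_def fun_eq_iff split: if_splits)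
  have "finite ?X" "ev s \<in> ?X" using fin s by auto
  then have "g (ev s) = 0"
    using eigen_components_zero[where f = g and e = "\<lambda>\<kappa>. \<kappa>", OF _ g_eig sep g0] by blast
  moreover have "{v\<in>S. ev v = ev s} = {s}" using ev_eq[OF S _ s] s by blast
  ultimately have eq: "(\<Sum>v\<in>{v\<in>T. ev v = ev s}. v) = s" by (simp add: g_def)
  have "s \<noteq> 0" using S s by (auto simp: eigen_decomposition_def)
  have "{v\<in>T. ev v = ev s} \<noteq> {}"
  proof
    assume "{v\<in>T. ev v = ev s} = {}"
    with eq have "(\<Sum>v\<in>{}. v) = s" by (simp only:)
    then show False using \<open>s \<noteq> 0\<close> by simp
  qed
  then obtain t where t: "t \<in> T" "ev t = ev s" by blast
  have "{v\<in>T. ev v = ev s} = {t}"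
  proof (intro equalityI subsetI)
    fix v assume "v \<in> {v\<in>T. ev v = ev s}"
    then have "v = t" using t(2) by (intro ev_eq[OF T _ t(1)]) auto
    then show "v \<in> {t}" by simp
  qed (use t in simp)
  with eq have "(\<Sum>v\<in>{t}. v) = s" by (simp only:)
  then show "s \<in> T" using t(1) by simp
qed

lemma eigen_decomposition_independent:
  fixes A :: "'i \<Rightarrow> 'a::field^'n^'n"
  assumes S: "eigen_decomposition I A S"
  shows "vec.independent S"
proof (rule vec.independent_if_scalars_zero)
  show "finite S" using S by (simp add: eigen_decomposition_def)
next
  fix c x assume c: "(\<Sum>s\<in>S. c s *s s) = 0" and x: "x \<in> S"
  have "c x *s x = 0"
  proof (rule eigen_components_zero[where X = S and I = I and A = A and f = "\<lambda>s. c s *s s"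
        and e = "\<lambda>s i. eigenvalue_of (A i) s"])
    show "A i *v (c s *s s) = eigenvalue_of (A i) s *s (c s *s s)" if "s \<in> S" "i \<in> I" for s i
    proof -
      have "A i *v (c s *s s) = c s *s (A i *v s)"
        by (rule mat_scale)
      then show ?thesis using S that by (simp add: eigen_decomposition_def mult.commute)
    qed
    show "\<exists>i\<in>I. eigenvalue_of (A i) s \<noteq> eigenvalue_of (A i) t" if "s \<in> S" "t \<in> S" "s \<noteq> t" for s t
      using S that by (simp add: eigen_decomposition_def)
    show "finite S" using S by (simp add: eigen_decomposition_def)
  qed (fact c x)+
  moreover have "x \<noteq> 0" using S x by (auto simp: eigen_decomposition_def)
  ultimately show "c x = 0" by simp
qed

text \<open>Commutation gives \<open>X *v s\<close> the system of eigenvalues of \<open>s\<close>.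
  Subtracting it in the slot of \<open>s\<close> from its expansion in \<open>S\<close> leaves a
  vanishing sum of eigenvectors with distinct systems, so the entry at \<open>s\<close> is
  zero.\<close>

lemma commuting_matrix_diagonal:
  fixes A :: "'i \<Rightarrow> 'a::field^'n^'n"
  assumes S: "eigen_decomposition I A S" "vec.span S = UNIV"
    and comm: "\<And>i. i \<in> I \<Longrightarrow> X ** A i = A i ** X" and s: "s \<in> S"
  shows "\<exists>c. X *v s = c *s s"
proof -
  have fin: "finite S" using S by (simp add: eigen_decomposition_def)
  have "X *v s \<in> vec.span S" using S(2) by simp
  then obtain c where c: "X *v s = (\<Sum>t\<in>S. c t *s t)" using vec.span_finite[OF fin] by auto
  let ?f = "\<lambda>t. c t *s t - (if t = s then X *v s else 0)"
  have "?f s = 0"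
  proof (rule eigen_components_zero[where X = S and I = I and A = A and f = ?f
        and e = "\<lambda>s i. eigenvalue_of (A i) s"])
    show "A i *v ?f t = eigenvalue_of (A i) t *s ?f t" if "t \<in> S" "i \<in> I" for t i
    proof -
      have "A i *v t = eigenvalue_of (A i) t *s t" "A i *v s = eigenvalue_of (A i) s *s s"
        using S s that by (auto simp: eigen_decomposition_def)
      moreover have "A i *v (X *v s) = X *v (A i *v s)"
        using comm[OF that(2)] by (simp add: matrix_vector_mul_assoc)
      ultimately show ?thesis
        by (simp add: mat_diff mat_scale
            mult.commute matrix_vector_mult_0_right)
    qed
    show "(\<Sum>t\<in>S. ?f t) = 0" using c s fin by (simp add: sum_subtractf)
    show "\<exists>i\<in>I. eigenvalue_of (A i) s \<noteq> eigenvalue_of (A i) t" if "s \<in> S" "t \<in> S" "s \<noteq> t" for s t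
      using S that by (simp add: eigen_decomposition_def)
  qed (fact fin s)+
  then show ?thesis by (intro exI[of _ "c s"]) simp
qed

section \<open>Stable subspaces of an irreducible Hodge structure\<close>

lemma real_vector_in_complex_span:
  fixes X :: "(real^'n) set"
  assumes "map_vec complex_of_real u \<in> vec.span (map_vec complex_of_real ` X)"
  shows "u \<in> vec.span X"
proof -
  have "map_vec Re v \<in> vec.span X \<and> map_vec Im v \<in> vec.span X"
    if "v \<in> vec.span (map_vec complex_of_real ` X)" for v
    using that
  proof (induction rule: vec.span_induct_alt)
    case base
    have "map_vec Re 0 = (0::real^'n)" "map_vec Im 0 = (0::real^'n)" by (simp_all add: vec_eq_iff)
    then show ?case by (simp add: vec.span_zero)
  next
    case (step c x y)
    then obtain w where w: "w \<in> X" "x = map_vec complex_of_real w" by blast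
    have "map_vec Re (c *s x + y) = Re c *s w + map_vec Re y"
      "map_vec Im (c *s x + y) = Im c *s w + map_vec Im y"
      by (simp_all add: vec_eq_iff w(2))
    then show ?case using step w(1) by (simp add: vec.span_add vec.span_scale vec.span_base)
  qed
  moreover have "map_vec Re (map_vec complex_of_real u) = u" by (simp add: vec_eq_iff)
  ultimately show ?thesis using assms by metis
qed

lemma map_vec_of_real_matrix_vector:
  "map_vec complex_of_real (A *v v) = map_matrix complex_of_real A *v map_vec complex_of_real v"
  by (simp add: vec_eq_iff matrix_vector_mult_def)

text \<open>By descent \<open>W\<close> is spanned by its rational vectors. These form a rational
  sub-Hodge structure \<open>V\<close> whose complexification is \<open>W\<close>, so irreducibility
  over \<rat> passes to all stable complex subspaces.\<close>

lemma irreducible_stable_subspace: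
  fixes W :: "(complex^'n) set"
  assumes irr: "irreducible_hodge_structure \<phi>"
    and W: "vec.subspace W" and stable: "\<And>\<sigma> v. field_aut \<sigma> \<Longrightarrow> v \<in> W \<Longrightarrow> map_vec \<sigma> v \<in> W"
    and \<phi>: "\<And>z v. z \<noteq> 0 \<Longrightarrow> v \<in> W \<Longrightarrow> map_matrix complex_of_real (\<phi> z) *v v \<in> W"
  shows "W = {0} \<or> W = UNIV"
proof -
  define V where "V = {w :: rat^'n. map_vec of_rat w \<in> W}"
  let ?R = "(\<lambda>w. \<chi> i. of_rat (w $ i)) ` V :: (real^'n) set"
  have real_rat: "complex_of_real (real_of_rat q) = of_rat q" for q
    by (cases q) (simp add: of_rat_rat)
  have "map_vec complex_of_real ` ?R = W \<inter> {v. \<forall>i. v $ i \<in> \<rat>}"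
  proof (intro equalityI subsetI)
    fix v assume "v \<in> map_vec complex_of_real ` ?R"
    then obtain w where w: "w \<in> V" "v = map_vec complex_of_real (\<chi> i. of_rat (w $ i))" by blast
    then have "v = map_vec of_rat w" by (simp add: vec_eq_iff real_rat)
    then show "v \<in> W \<inter> {v. \<forall>i. v $ i \<in> \<rat>}" using w(1) by (auto simp: V_def)
  next
    fix v assume v: "v \<in> W \<inter> {v. \<forall>i. v $ i \<in> \<rat>}"
    then have "\<forall>i. \<exists>q. v $ i = of_rat q" by (auto elim: Rats_cases)
    then obtain q where q: "\<And>i. v $ i = of_rat (q i)" by metis
    let ?w = "\<chi> i. q i"
    have "v = map_vec of_rat ?w" "v = map_vec complex_of_real (\<chi> i. of_rat (?w $ i))"
      using q by (simp_all add: vec_eq_iff real_rat)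
    moreover from this have "?w \<in> V" using v by (simp add: V_def)
    ultimately show "v \<in> map_vec complex_of_real ` ?R" by blast
  qed
  then have W_span: "W \<subseteq> vec.span (map_vec complex_of_real ` ?R)"
    using stable_subspace_rational_span[OF W stable] by simp
  have to_W: "map_vec complex_of_real u \<in> W" if "u \<in> realify_subspace V" for u
    using that unfolding realify_subspace_def
  proof (induction rule: vec.span_induct_alt)
    case base
    have "map_vec complex_of_real 0 = (0::complex^'n)" by (simp add: vec_eq_iff)
    then show ?case using W by (simp add: vec.subspace_0)
  next
    case (step c x y)
    then have "map_vec complex_of_real x \<in> W" using \<open>map_vec complex_of_real ` ?R = _\<close> by blast
    moreover have "map_vec complex_of_real (c *s x + y) =
        complex_of_real c *s map_vec complex_of_real x + map_vec complex_of_real y"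
      by (simp add: vec_eq_iff)
    ultimately show ?case using step W by (simp add: vec.subspace_add vec.subspace_scale)
  qed
  have "sub_hodge_structure \<phi> V"
    unfolding sub_hodge_structure_def
  proof (intro conjI allI impI ballI)
    have *: "map_vec of_rat 0 = (0::complex^'n)"
        "map_vec of_rat (v + w) = map_vec of_rat v + (map_vec of_rat w :: complex^'n)"
        "map_vec of_rat (c *s v) = of_rat c *s (map_vec of_rat v :: complex^'n)" for v w :: "rat^'n" and c
      by (simp_all add: vec_eq_iff of_rat_add of_rat_mult)
    show "vec.subspace V"
      by (rule vec.subspaceI) (use W in \<open>auto simp: V_def * vec.subspace_0 vec.subspace_add vec.subspace_scale\<close>)
    fix z :: complex and w assume "z \<noteq> 0" "w \<in> realify_subspace V"
    then have "map_vec complex_of_real (\<phi> z *v w) \<in> W"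
      unfolding map_vec_of_real_matrix_vector using \<phi> to_W by blast
    then show "\<phi> z *v w \<in> realify_subspace V"
      unfolding realify_subspace_def using W_span real_vector_in_complex_span by blast
  qed
  then consider "V = {0}" | "V = UNIV" using irr unfolding irreducible_hodge_structure_def by blast
  then show ?thesis
  proof cases
    case 1
    have "map_vec complex_of_real ` ?R = {0}" unfolding 1 by (auto simp: vec_eq_iff)
    then have "W \<subseteq> {0}" using W_span by (simp add: vec.span_singleton) 
    then show ?thesis using W vec.subspace_0 by blast
  next
    case 2
    have "v \<in> W" for v
    proof -
      have "axis i 1 \<in> W" for i :: 'n
      proof -
        have "map_vec of_rat (axis i 1) = (axis i 1 :: complex^'n)" by (simp add: vec_eq_iff axis_def)
        moreover have "axis i 1 \<in> V" using 2 by simp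
        ultimately show ?thesis unfolding V_def by (metis mem_Collect_eq)
      qed
      then have "(\<Sum>i\<in>UNIV. v $ i *s axis i 1) \<in> W"
        using W by (intro vec.subspace_sum vec.subspace_scale)
      then show ?thesis by (simp add: basis_expansion)
    qed
    then show ?thesis by blast
  qed
qed

section \<open>Vanishing sums of roots of unity\<close>

text \<open>Let \<open>a\<close> and \<open>b\<close> be the least indices at which \<open>p\<close>
  does not divide the coefficient of \<open>g\<close> and of \<open>k\<close>. Then \<open>p\<close>
  does not divide coefficient \<open>a + b\<close> of the product, which forces \<open>a\<close> and
  \<open>b\<close> to be the full degrees; were both positive, \<open>p ^ 2\<close> would divide the
  constant term.\<close>

lemma eisenstein_irreducible:
  fixes f :: "int poly"
  assumes p: "prime p" and monic: "lead_coeff f = 1" and deg: "degree f > 0"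
    and low: "\<And>i. i < degree f \<Longrightarrow> p dvd coeff f i" and const: "\<not> p ^ 2 dvd coeff f 0"
  shows "irreducible f"
proof (rule irreducibleI)
  show "f \<noteq> 0" using deg by auto
  show "\<not> f dvd 1" using deg by (auto simp: is_unit_poly_iff)
next
  fix g k assume f: "f = g * k"
  have lead: "lead_coeff g * lead_coeff k = 1" using monic by (simp add: f lead_coeff_mult)
  have nd: "\<not> p dvd lead_coeff g" "\<not> p dvd lead_coeff k"
    using lead p not_prime_unit[of p] by (metis dvd_mult dvd_mult2 prime_def prime_elem_def)+
  define a where "a = (LEAST i. \<not> p dvd coeff g i)"
  define b where "b = (LEAST i. \<not> p dvd coeff k i)"
  have a: "\<not> p dvd coeff g a" "\<And>i. i < a \<Longrightarrow> p dvd coeff g i" "a \<le> degree g"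
    unfolding a_def using LeastI[of "\<lambda>i. \<not> p dvd coeff g i", OF nd(1)] not_less_Least
      Least_le[of "\<lambda>i. \<not> p dvd coeff g i", OF nd(1)] by auto
  have b: "\<not> p dvd coeff k b" "\<And>i. i < b \<Longrightarrow> p dvd coeff k i" "b \<le> degree k"
    unfolding b_def using LeastI[of "\<lambda>i. \<not> p dvd coeff k i", OF nd(2)] not_less_Least
      Least_le[of "\<lambda>i. \<not> p dvd coeff k i", OF nd(2)] by auto
  have "\<not> p dvd coeff f (a + b)"
  proof
    assume d: "p dvd coeff f (a + b)"
    have "coeff f (a + b) = coeff g a * coeff k b + (\<Sum>i\<in>{..a + b} - {a}. coeff g i * coeff k (a + b - i))"
      unfolding f coeff_mult by (subst sum.remove[of _ a]) auto
    moreover have "p dvd (\<Sum>i\<in>{..a + b} - {a}. coeff g i * coeff k (a + b - i))"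
    proof (rule dvd_sum)
      fix i assume "i \<in> {..a + b} - {a}"
      then have "i < a \<or> a + b - i < b" by auto
      then show "p dvd coeff g i * coeff k (a + b - i)" using a(2) b(2) by auto
    qed
    ultimately have "p dvd coeff g a * coeff k b" using d by (simp add: dvd_add_left_iff)
    then show False using p a(1) b(1) prime_dvd_mult_iff by blast
  qed
  then have "\<not> a + b < degree f" using low by blast
  moreover have "degree f = degree g + degree k" unfolding f by (rule degree_mult_eq) (use deg f in auto)
  ultimately have ab: "a = degree g" "b = degree k" using a(3) b(3) by auto
  have "degree g = 0 \<or> degree k = 0"
  proof (rule ccontr)
    assume "\<not> (degree g = 0 \<or> degree k = 0)"
    then have "p dvd coeff g 0" "p dvd coeff k 0" using a(2) b(2) ab by auto
    then have "p ^ 2 dvd coeff f 0" unfolding f by (simp add: mult_dvd_mono power2_eq_square coeff_mult_0)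
    then show False using const by simp
  qed
  then show "g dvd 1 \<or> k dvd 1"
  proof
    assume "degree g = 0"
    then obtain c where "g = [:c:]" by (metis degree_eq_zeroE)
    moreover have "c dvd 1" using lead \<open>g = [:c:]\<close> by (metis dvd_triv_left lead_coeff_pCons(2))
    ultimately show ?thesis by (simp add: is_unit_const_poly_iff)
  next
    assume "degree k = 0"
    then obtain c where "k = [:c:]" by (metis degree_eq_zeroE)
    moreover have "c dvd 1" using lead \<open>k = [:c:]\<close> by (metis dvd_triv_right lead_coeff_pCons(2))
    ultimately show ?thesis by (simp add: is_unit_const_poly_iff)
  qed
qed

text \<open>The cyclotomic polynomial of prime order, shifted to \<open>((1 + X)\<^sup>p - 1) / X\<close>.\<close>

definition shifted_cyclotomic :: "nat \<Rightarrow> int poly" where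
  "shifted_cyclotomic p = (\<Sum>k<p. monom (int (p choose Suc k)) k)"

lemma coeff_shifted_cyclotomic: "coeff (shifted_cyclotomic p) k = (if k < p then int (p choose Suc k) else 0)"
  by (auto simp: shifted_cyclotomic_def coeff_sum)

lemma X_shifted_cyclotomic: "[:0, 1:] * shifted_cyclotomic p = [:1, 1:] ^ p - 1"
proof (rule poly_eqI)
  fix k
  have "[:0, 1:] + 1 = [:1, 1 :: int:]" by (simp add: one_pCons)
  then have "[:1, 1:] ^ p = (\<Sum>i\<le>p. monom (int (p choose i)) i)"
    using binomial_ring[of "[:0, 1:]" "1 :: int poly" p] by (simp add: monom_altdef of_nat_poly)
  then have "coeff ([:1, 1:] ^ p) k = int (p choose k)" by (simp add: coeff_sum)
  then show "coeff ([:0, 1:] * shifted_cyclotomic p) k = coeff ([:1, 1:] ^ p - 1) k"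
    by (cases k) (auto simp: coeff_shifted_cyclotomic coeff_pCons)
qed

lemma degree_shifted_cyclotomic:
  assumes "p > 0"
  shows "degree (shifted_cyclotomic p) = p - 1"
proof (rule antisym)
  show "degree (shifted_cyclotomic p) \<le> p - 1"
    by (rule degree_le) (auto simp: coeff_shifted_cyclotomic)
  show "p - 1 \<le> degree (shifted_cyclotomic p)"
    by (rule le_degree) (use assms in \<open>auto simp: coeff_shifted_cyclotomic\<close>)
qed

lemma irreducible_shifted_cyclotomic:
  assumes "prime p"
  shows "irreducible (shifted_cyclotomic p)"
proof (rule eisenstein_irreducible)
  have p: "p \<ge> 2" using assms prime_ge_2_nat by blast
  note deg = degree_shifted_cyclotomic[of p]
  show "prime (int p)" using assms by simp
  show "lead_coeff (shifted_cyclotomic p) = 1" "degree (shifted_cyclotomic p) > 0"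
    using p deg by (auto simp: coeff_shifted_cyclotomic)
  show "int p dvd coeff (shifted_cyclotomic p) i" if "i < degree (shifted_cyclotomic p)" for i
    using that p deg dvd_choose_prime[of "Suc i" p] assms by (auto simp: coeff_shifted_cyclotomic)
  have "\<not> int p * int p dvd int p"
    using p by (auto dest: zdvd_imp_le)
  then show "\<not> (int p)\<^sup>2 dvd coeff (shifted_cyclotomic p) 0"
    using p by (simp add: coeff_shifted_cyclotomic power2_eq_square)
qed

definition int_poly_eval :: "int poly \<Rightarrow> complex \<Rightarrow> complex" where
  "int_poly_eval f x = poly (map_poly of_int f) x"

lemma int_poly_eval_add: "int_poly_eval (f + g) x = int_poly_eval f x + int_poly_eval g x"
proof -
  have "map_poly of_int (f + g) = map_poly of_int f + (map_poly of_int g :: complex poly)"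
    by (intro poly_eqI) (simp add: coeff_map_poly)
  then show ?thesis by (simp add: int_poly_eval_def)
qed

lemma int_poly_eval_mult: "int_poly_eval (f * g) x = int_poly_eval f x * int_poly_eval g x"
proof -
  have "map_poly of_int (f * g) = map_poly of_int f * (map_poly of_int g :: complex poly)"
    by (intro poly_eqI) (simp add: coeff_map_poly coeff_mult)
  then show ?thesis by (simp add: int_poly_eval_def)
qed

lemma int_poly_eval_const: "int_poly_eval [:c:] x = of_int c"
  and int_poly_eval_0 [simp]: "int_poly_eval 0 x = 0"
  and int_poly_eval_1 [simp]: "int_poly_eval 1 x = 1"
  and int_poly_eval_X: "int_poly_eval [:a, 1:] x = of_int a + x"
  by (simp_all add: int_poly_eval_def map_poly_pCons one_pCons)

lemma int_poly_eval_smult: "int_poly_eval (smult c f) x = of_int c * int_poly_eval f x"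
  using int_poly_eval_mult[of "[:c:]" f x] by (simp add: int_poly_eval_const)

lemma int_poly_eval_diff: "int_poly_eval (f - g) x = int_poly_eval f x - int_poly_eval g x"
  using int_poly_eval_add[of "f - g" g x] by simp

lemma int_poly_eval_power: "int_poly_eval (f ^ n) x = int_poly_eval f x ^ n"
  by (induction n) (simp_all add: int_poly_eval_mult)

lemma int_poly_eval_sum: "int_poly_eval (sum f I) x = (\<Sum>i\<in>I. int_poly_eval (f i) x)"
  by (induction I rule: infinite_finite_induct) (simp_all add: int_poly_eval_add)

context
  fixes p :: nat and \<omega> :: complex
  assumes p: "prime p" and \<omega>: "\<omega> ^ p = 1" "\<omega> \<noteq> 1"
begin

lemma eval_shifted_cyclotomic: "int_poly_eval (shifted_cyclotomic p) (\<omega> - 1) = 0"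
proof -
  have "int_poly_eval ([:0, 1:] * shifted_cyclotomic p) (\<omega> - 1) = \<omega> ^ p - 1"
    by (simp only: X_shifted_cyclotomic int_poly_eval_diff int_poly_eval_power int_poly_eval_X) simp
  then show ?thesis using \<omega> by (simp only: int_poly_eval_mult int_poly_eval_X) simp
qed

text \<open>Over the integers only pseudo-division is available: a multiple of
  \<open>?\<Psi>\<close> by a constant equals \<open>k * q\<close> for an annihilator
  \<open>k\<close> of least degree. As \<open>?\<Psi>\<close> is a prime element it divides
  \<open>k\<close>, giving the bound, or \<open>q\<close>, in which case \<open>k\<close> is a
  nonzero constant and annihilates nothing.\<close>

lemma shifted_cyclotomic_minimal:
  assumes "g \<noteq> 0" "int_poly_eval g (\<omega> - 1) = 0"
  shows "p - 1 \<le> degree g"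
proof -
  obtain k where k: "k \<noteq> 0 \<and> int_poly_eval k (\<omega> - 1) = 0"
    and min: "\<And>l. l \<noteq> 0 \<and> int_poly_eval l (\<omega> - 1) = 0 \<Longrightarrow> degree k \<le> degree l"
    using ex_has_least_nat[of "\<lambda>k. k \<noteq> 0 \<and> int_poly_eval k (\<omega> - 1) = 0" g degree] assms by blast
  let ?\<Psi> = "shifted_cyclotomic p"
  obtain q r where qr: "pseudo_divmod ?\<Psi> k = (q, r)" by (metis surj_pair)
  define c where "c = lead_coeff k ^ (Suc (degree ?\<Psi>) - degree k)"
  have div: "smult c ?\<Psi> = k * q + r" "r = 0 \<or> degree r < degree k"
    using pseudo_divmod[OF _ qr] k unfolding c_def by auto
  have "int_poly_eval r (\<omega> - 1) = 0"
    using arg_cong[OF div(1), of "\<lambda>f. int_poly_eval f (\<omega> - 1)"] k eval_shifted_cyclotomic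
    by (simp add: int_poly_eval_add int_poly_eval_mult int_poly_eval_smult)
  then have "r = 0" using div(2) min[of r] by (metis not_le)
  then have c: "smult c ?\<Psi> = k * q" "c \<noteq> 0" using div(1) k by (auto simp: c_def)
  have prime: "prime_elem ?\<Psi>"
    using irreducible_shifted_cyclotomic[OF p] by (simp add: prime_elem_iff_irreducible)
  have "?\<Psi> dvd k * q" using c(1) by (metis dvd_refl dvd_smult)
  then consider "?\<Psi> dvd k" | "?\<Psi> dvd q" using prime prime_elem_dvd_mult_iff by blast
  then show ?thesis
  proof cases
    case 1
    then have "degree ?\<Psi> \<le> degree k" using k by (intro dvd_imp_degree_le) auto
    then show ?thesis using min[of g] assms degree_shifted_cyclotomic[of p] p prime_gt_0_nat by fastforce
  next
    case 2
    then obtain l where l: "q = ?\<Psi> * l" by blast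
    have "?\<Psi> * [:c:] = ?\<Psi> * (k * l)" using c(1) l by (simp add: mult_ac)
    moreover have "?\<Psi> \<noteq> 0" using irreducible_shifted_cyclotomic[OF p] by auto
    ultimately have *: "[:c:] = k * l" using mult_left_cancel by blast
    then have "degree k = 0" using c(2)
      by (metis add_is_0 degree_mult_eq degree_pCons_0 mult_zero_left mult_zero_right pCons_eq_0_iff)
    then obtain d where "k = [:d:]" by (metis degree_eq_zeroE)
    then show ?thesis using k by (simp add: int_poly_eval_const)
  qed
qed

text \<open>Written in powers of \<open>1 + X\<close>, the relation becomes an integer polynomial
  \<open>F\<close> vanishing at \<open>\<omega> - 1\<close>. Removing its top coefficient with the
  monic shifted cyclotomic polynomial leaves a degree below \<open>p - 1\<close>, hence zero by
  minimality.\<close>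

lemma vanishing_sum_constant:
  fixes m :: "nat \<Rightarrow> int"
  assumes "(\<Sum>i<p. of_int (m i) * \<omega> ^ i) = 0" "i < p"
  shows "m i = m (p - 1)"
proof -
  have p0: "p > 0" "p - 1 < p" using p prime_gt_0_nat by auto
  define F where "F = (\<Sum>i<p. smult (m i) ([:1, 1:] ^ i))"
  define H where "H = F - smult (m (p - 1)) (shifted_cyclotomic p)"
  have "int_poly_eval F (\<omega> - 1) = 0"
    using assms(1) by (simp add: F_def int_poly_eval_sum int_poly_eval_smult int_poly_eval_power int_poly_eval_X)
  then have "int_poly_eval H (\<omega> - 1) = 0"
    by (simp add: H_def int_poly_eval_diff int_poly_eval_smult eval_shifted_cyclotomic)
  moreover have "coeff H k = 0" if "k \<ge> p - 1" for k
  proof -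
    have "coeff ([:1, 1:] ^ i :: int poly) k = (if i = k then 1 else 0)" if "i < p" for i
    proof (cases "i = k")
      case True
      have "lead_coeff ([:1, 1:] ^ i :: int poly) = 1" by (simp add: lead_coeff_power)
      then show ?thesis using True by (simp add: degree_power_eq)
    next
      case False
      then have "degree ([:1, 1:] ^ i :: int poly) < k" using that \<open>k \<ge> p - 1\<close> by (simp add: degree_power_eq)
      then show ?thesis using False by (simp add: coeff_eq_0)
    qed
    then have "coeff F k = (\<Sum>i<p. m i * (if i = k then 1 else 0))"
      unfolding F_def coeff_sum coeff_smult by (intro sum.cong) auto
    then have "coeff F k = (if k < p then m k else 0)" by (simp add: if_distrib cong: if_cong)
    moreover have "k < p \<Longrightarrow> k = p - 1" using that by simp
    ultimately show ?thesis using p0 by (auto simp: H_def coeff_shifted_cyclotomic)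
  qed
  then have "H = 0 \<or> degree H < p - 1"
    by (metis leading_coeff_0_iff not_le)
  ultimately have "H = 0" using shifted_cyclotomic_minimal[of H] by linarith
  then have F: "F = smult (m (p - 1)) (shifted_cyclotomic p)" by (simp add: H_def)
  \<comment> \<open>This undoes the shift. \<open>D\<close> is evaluated at the integers
    \<open>t \<noteq> 1\<close>, where the factor \<open>t - 1\<close> can be cancelled; infinitely
    many zeros make it the zero polynomial.\<close>
  define D where "D = (\<Sum>i<p. monom (m i - m (p - 1)) i)"
  have "poly D t = 0" if "t \<noteq> 1" for t
  proof -
    have "(t - 1) * poly F (t - 1) = m (p - 1) * poly ([:0, 1:] * shifted_cyclotomic p) (t - 1)"
      by (simp add: F)
    also have "\<dots> = m (p - 1) * (t ^ p - 1)" unfolding X_shifted_cyclotomic by (simp add: poly_power)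
    also have "t ^ p - 1 = (t - 1) * (\<Sum>i<p. t ^ i)" by (rule power_diff_1_eq)
    finally have "poly F (t - 1) = m (p - 1) * (\<Sum>i<p. t ^ i)" using that by simp
    moreover have "poly F (t - 1) = (\<Sum>i<p. m i * t ^ i)" by (simp add: F_def poly_sum poly_power)
    ultimately show ?thesis
      by (simp add: D_def poly_sum poly_monom sum_subtractf sum_distrib_left left_diff_distrib)
  qed
  then have "- {1} \<subseteq> {t. poly D t = 0}" by auto
  moreover have "infinite (- {1 :: int})" by (simp add: infinite_UNIV_int finite_compl)
  ultimately have "D = 0" using poly_roots_finite finite_subset by blast
  then have "coeff D i = 0" by simp
  then show ?thesis using assms(2) by (simp add: D_def coeff_sum)
qed

end

lemma sum_periodic_shift:
  fixes f :: "nat \<Rightarrow> 'a::comm_ring_1"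
  assumes "\<And>i. f (i + p) = f i"
  shows "(\<Sum>i<p. f (i + j)) = (\<Sum>i<p. f i)"
proof (induction j)
  case (Suc j)
  have "(\<Sum>i<Suc p. f (i + j)) = f j + (\<Sum>i<p. f (i + Suc j))"
    by (subst sum.lessThan_Suc_shift) simp
  moreover have "(\<Sum>i<Suc p. f (i + j)) = (\<Sum>i<p. f (i + j)) + f j"
    using assms[of j] by (simp add: add.commute)
  ultimately show ?case using Suc by simp
qed simp

text \<open>A circulant matrix is diagonalized by the discrete Fourier transform; its eigenvalues are
  the sums \<open>\<Sum>i<p. m i * \<zeta> ^ (i * k)\<close>.\<close>

lemma circulant_solvable:
  fixes m :: "nat \<Rightarrow> int" and w :: "nat \<Rightarrow> complex"
  assumes p: "prime p" and per: "\<And>i. m (i + p) = m i"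
    and sum: "(\<Sum>i<p. m i) \<noteq> 0" and nonconst: "i0 < p" "j0 < p" "m i0 \<noteq> m j0"
  shows "\<exists>u. \<forall>j<p. (\<Sum>i<p. u i * of_int (m (i + j))) = w j"
proof -
  have p0: "p > 0" using p prime_gt_0_nat by blast
  define \<zeta> where "\<zeta> = exp (2 * of_real pi * \<i> * of_nat 1 / of_nat p)"
  have \<zeta>1: "\<zeta> ^ k = 1 \<longleftrightarrow> p dvd k" for k
  proof -
    have "\<zeta> ^ k = exp (2 * of_real pi * \<i> * of_nat k / of_nat p)"
      unfolding \<zeta>_def by (simp flip: exp_of_nat_mult add: mult_ac)
    then show ?thesis using complex_root_unity_eq_1[of p k] p0 by simp
  qed
  have \<zeta>: "\<zeta> \<noteq> 0" "\<zeta> ^ p = 1" using \<zeta>1[of p] by (simp_all add: \<zeta>_def)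
  define M where "M k = (\<Sum>i<p. of_int (m i) * \<zeta> ^ (i * k))" for k
  \<comment> \<open>The eigenvalue for \<open>k = 0\<close> is the sum of the entries. For other
    \<open>k\<close>, \<open>\<zeta> ^ k\<close> is again a nontrivial \<open>p\<close>-th root of
    unity, and a vanishing eigenvalue would make the entries constant.\<close>
  have M: "M k \<noteq> 0" if "k < p" for k
  proof (cases "k = 0")
    case True
    then show ?thesis using sum by (simp add: M_def flip: of_int_sum)
  next
    case False
    then have "\<zeta> ^ k \<noteq> 1" using \<zeta>1 that by (auto dest: dvd_imp_le)
    moreover have "(\<zeta> ^ k) ^ p = 1" using \<zeta>(2) by (metis mult.commute power_mult power_one)
    ultimately have "(\<Sum>i<p. of_int (m i) * (\<zeta> ^ k) ^ i) \<noteq> 0"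
      using vanishing_sum_constant[OF p, of "\<zeta> ^ k" m] nonconst by metis
    then show ?thesis by (simp add: M_def mult.commute flip: power_mult)
  qed
  have shift: "(\<Sum>i<p. \<zeta> ^ (i * k) * of_int (m (i + j))) * \<zeta> ^ (j * k) = M k" for j k
  proof -
    have "(\<Sum>i<p. \<zeta> ^ (i * k) * of_int (m (i + j))) * \<zeta> ^ (j * k) =
        (\<Sum>i<p. of_int (m (i + j)) * \<zeta> ^ ((i + j) * k))"
      unfolding sum_distrib_right by (intro sum.cong refl) (simp add: power_add add_mult_distrib)
    also have "\<dots> = M k"
      unfolding M_def
    proof (rule sum_periodic_shift)
      fix i
      have "\<zeta> ^ ((i + p) * k) = \<zeta> ^ (i * k) * (\<zeta> ^ p) ^ k"
        by (simp add: add_mult_distrib power_add power_mult)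
      then show "of_int (m (i + p)) * \<zeta> ^ ((i + p) * k) = of_int (m i) * \<zeta> ^ (i * k)"
        using \<zeta>(2) per by simp
    qed
    finally show ?thesis .
  qed
  have orth: "(\<Sum>k<p. \<zeta> ^ (l * k) / \<zeta> ^ (j * k)) = (if l = j then of_nat p else 0)" if "l < p" "j < p" for l j
  proof -
    have *: "(\<Sum>k<p. \<zeta> ^ (l * k) / \<zeta> ^ (j * k)) = (\<Sum>k<p. (\<zeta> ^ l / \<zeta> ^ j) ^ k)"
      by (simp add: power_mult power_divide)
    show ?thesis
    proof (cases "l = j")
      case True
      then show ?thesis using \<zeta>(1) by simp
    next
      case False
      have "\<zeta> ^ l / \<zeta> ^ j \<noteq> 1"
      proof
        assume "\<zeta> ^ l / \<zeta> ^ j = 1"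
        then have eq: "\<zeta> ^ l = \<zeta> ^ j" using \<zeta>(1) by (simp add: field_simps)
        have "\<zeta> ^ (max l j - min l j) = 1"
          using eq \<zeta>(1) by (auto simp: power_diff max_def min_def)
        then have "p dvd (max l j - min l j)" using \<zeta>1 by blast
        moreover have "0 < max l j - min l j" "max l j - min l j < p" using False that by auto
        ultimately show False by (auto dest: dvd_imp_le)
      qed
      moreover have "(\<zeta> ^ l / \<zeta> ^ j) ^ p = 1"
        by (metis \<zeta>(2) div_by_1 mult.commute power_divide power_mult power_one)
      ultimately show ?thesis using * False by (simp add: geometric_sum)
    qed
  qed
  \<comment> \<open>The Fourier transform of \<open>w\<close>; the solution \<open>u\<close> is
    obtained by dividing it by the eigenvalues and transforming back. The factor
    \<open>of_nat p\<close> comes from \<open>orth\<close>.\<close>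
  define W where "W k = (\<Sum>l<p. w l * \<zeta> ^ (l * k))" for k
  define u where "u i = (\<Sum>k<p. W k / (of_nat p * M k) * \<zeta> ^ (i * k))" for i
  have "(\<Sum>i<p. u i * of_int (m (i + j))) = w j" if j: "j < p" for j
  proof -
    have "(\<Sum>i<p. u i * of_int (m (i + j))) =
        (\<Sum>k<p. \<Sum>i<p. W k / (of_nat p * M k) * (\<zeta> ^ (i * k) * of_int (m (i + j))))"
      unfolding u_def sum_distrib_right by (subst sum.swap) (simp add: mult.assoc)
    also have "\<dots> = (\<Sum>k<p. W k / (of_nat p * M k) * (\<Sum>i<p. \<zeta> ^ (i * k) * of_int (m (i + j))))"
      by (simp add: sum_distrib_left)
    also have "\<dots> = (\<Sum>k<p. W k / (of_nat p * \<zeta> ^ (j * k)))"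
    proof (intro sum.cong refl)
      fix k assume "k \<in> {..<p}"
      then have "M k \<noteq> 0" using M by simp
      moreover have "(\<Sum>i<p. \<zeta> ^ (i * k) * of_int (m (i + j))) = M k / \<zeta> ^ (j * k)"
        using shift[of k j] \<zeta>(1) by (simp add: field_simps)
      ultimately show "W k / (of_nat p * M k) * (\<Sum>i<p. \<zeta> ^ (i * k) * of_int (m (i + j))) =
          W k / (of_nat p * \<zeta> ^ (j * k))" by simp
    qed
    also have "\<dots> = (\<Sum>l<p. \<Sum>k<p. w l / of_nat p * (\<zeta> ^ (l * k) / \<zeta> ^ (j * k)))"
      unfolding W_def sum_divide_distrib by (subst sum.swap) (simp add: field_simps)
    also have "\<dots> = (\<Sum>l<p. w l / of_nat p * (if l = j then of_nat p else 0))"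
      unfolding sum_distrib_left[symmetric] by (intro sum.cong refl) (use orth j in auto)
    also have "\<dots> = w j" using j p0 by (simp add: if_distrib cong: if_cong)
    finally show ?thesis .
  qed
  then show ?thesis by blast
qed

section \<open>Transitive permutation groups on \<open>2p\<close> points\<close>

text \<open>Division with remainder by the period. It serves for orbits of points and, with
  composition by a permutation acting on permutations, for the order of a permutation.\<close>

lemma funpow_fixpoint_iff_dvd:
  assumes "k = (LEAST k. 0 < k \<and> (g ^^ k) a = a)" "\<exists>k>0. (g ^^ k) a = a"
  shows "k > 0" "(g ^^ n) a = a \<longleftrightarrow> k dvd n"
proof -
  have k: "0 < k \<and> (g ^^ k) a = a" unfolding assms(1) by (rule LeastI_ex) (rule assms(2))
  then show "k > 0" by simp
  have mult: "(g ^^ (k * q)) a = a" for q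
    using k by (induction q) (auto simp: funpow_add)
  have "(g ^^ n) a = (g ^^ (n mod k)) ((g ^^ (k * (n div k))) a)"
    by (metis comp_apply funpow_add mod_mult_div_eq)
  then have n: "(g ^^ n) a = (g ^^ (n mod k)) a" using mult by simp
  have "n mod k = 0" if "(g ^^ (n mod k)) a = a"
  proof (rule ccontr)
    assume "n mod k \<noteq> 0"
    then have "k \<le> n mod k" using that unfolding assms(1) by (intro Least_le) simp
    moreover have "n mod k < k" using k by (intro mod_less_divisor) simp
    ultimately show False by simp
  qed
  then show "(g ^^ n) a = a \<longleftrightarrow> k dvd n" unfolding dvd_eq_mod_eq_0 n by (metis funpow_0)
qed

text \<open>Inverses come from finiteness: right composition with a member is injective on
  \<open>G\<close>, hence onto, so it reaches \<open>id\<close>.\<close>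

locale permutation_monoid =
  fixes S :: "'a set" and G :: "('a \<Rightarrow> 'a) set"
  assumes finite_S: "finite S" and id_G: "id \<in> G"
    and comp_G: "\<And>f g. f \<in> G \<Longrightarrow> g \<in> G \<Longrightarrow> f \<circ> g \<in> G"
    and permutes_G: "\<And>g. g \<in> G \<Longrightarrow> g permutes S"
begin

lemma finite_G: "finite G"
  by (rule finite_subset[OF _ finite_permutations[OF finite_S]]) (use permutes_G in auto)

lemma left_inverse_G: "g \<in> G \<Longrightarrow> \<exists>f\<in>G. f \<circ> g = id"
proof -
  assume g: "g \<in> G"
  have "inj_on (\<lambda>f. f \<circ> g) G"
    using surj_fun_eq permutes_surj[OF permutes_G[OF g]] by (intro inj_onI) (metis fun.inj_map_strong fun_eq_iff o_apply surjD)
  then have "(\<lambda>f. f \<circ> g) ` G = G"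
    using finite_G g comp_G by (intro endo_inj_surj) auto
  then show ?thesis using id_G by (metis (mono_tags, lifting) imageE)
qed

definition perm_group :: "('a \<Rightarrow> 'a) monoid" where
  "perm_group = \<lparr>carrier = G, mult = (\<circ>), one = id\<rparr>"

lemma perm_group_simps [simp]:
  "carrier perm_group = G" "f \<otimes>\<^bsub>perm_group\<^esub> g = f \<circ> g" "\<one>\<^bsub>perm_group\<^esub> = id"
  by (simp_all add: perm_group_def)

lemma group_perm_group: "group perm_group"
  by (rule groupI) (use id_G comp_G left_inverse_G in \<open>auto simp: o_assoc\<close>)

lemma funpow_G: "g \<in> G \<Longrightarrow> g ^^ n \<in> G"
  by (induction n) (use id_G comp_G in \<open>auto simp: id_def\<close>)

text \<open>Orbit-stabilizer: the fibres of evaluation at \<open>a\<close> are translates of the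
  stabilizer.\<close>

lemma card_transitive:
  assumes trans: "\<And>s. s \<in> S \<Longrightarrow> \<exists>g\<in>G. g a = s" and a: "a \<in> S"
  shows "card G = card S * card {g\<in>G. g a = a}"
proof -
  have "card {g\<in>G. g a = s} = card {g\<in>G. g a = a}" if "s \<in> S" for s
  proof -
    obtain k where k: "k \<in> G" "k a = s" using trans \<open>s \<in> S\<close> by blast
    obtain l where l: "l \<in> G" "l \<circ> k = id" using left_inverse_G[OF k(1)] by blast
    have kl: "k \<circ> l = id"
      using l(2) permutes_bij[OF permutes_G[OF k(1)]] by (metis bij_is_surj surj_iff left_right_inverse_eq)
    have "bij_betw (\<lambda>g. k \<circ> g) {g\<in>G. g a = a} {g\<in>G. g a = s}"
    proof (rule bij_betw_byWitness[where f' = "\<lambda>g. l \<circ> g"])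
      show "(\<lambda>g. l \<circ> g) ` {g\<in>G. g a = s} \<subseteq> {g\<in>G. g a = a}"
        using k l comp_G by (auto simp: fun_eq_iff)
      show "\<forall>g\<in>{g \<in> G. g a = a}. l \<circ> (k \<circ> g) = g" "\<forall>g\<in>{g \<in> G. g a = s}. k \<circ> (l \<circ> g) = g"
        using l(2) kl by (simp_all add: o_assoc)
      show "(\<lambda>g. k \<circ> g) ` {g\<in>G. g a = a} \<subseteq> {g\<in>G. g a = s}" using k comp_G by auto
    qed
    then show ?thesis by (rule bij_betw_same_card[symmetric])
  qed
  moreover have "card G = (\<Sum>s\<in>S. card {g\<in>G. g a = s})"
  proof -
    have "G = (\<Union>s\<in>S. {g\<in>G. g a = s})" using permutes_in_image[OF permutes_G] a by auto
    moreover have "card (\<Union>s\<in>S. {g\<in>G. g a = s}) = (\<Sum>s\<in>S. card {g\<in>G. g a = s})"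
      by (rule card_UN_disjoint) (use finite_S finite_G in auto)
    ultimately show ?thesis by simp
  qed
  ultimately show ?thesis by simp
qed

text \<open>Lagrange's theorem for the cyclic subgroup \<open>?C\<close> of powers of
  \<open>g\<close> inside \<open>H\<close>.\<close>

lemma funpow_card_subgroup:
  assumes H: "subgroup H perm_group" and g: "g \<in> H"
  shows "g ^^ card H = id"
proof -
  interpret group perm_group by (rule group_perm_group)
  have HG: "H \<subseteq> G" using subgroup.subset[OF H] by simp
  have gG: "g \<in> G" using g HG by blast
  have cancel: "g ^^ m = id" if "g ^^ (m + n) = g ^^ n" for m n
  proof -
    have "bij (g ^^ n)" using permutes_bij[OF permutes_G[OF funpow_G[OF gG]]] .
    moreover have "(g ^^ m) ((g ^^ n) x) = (g ^^ n) x" for x using that by (metis comp_apply funpow_add)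
    ultimately show ?thesis by (metis bij_pointE eq_id_iff)
  qed
  \<comment> \<open>Iterated from \<open>id\<close>, composition with \<open>g\<close> runs through
    the powers of \<open>g\<close>, so the order of \<open>g\<close> is the period of the point
    \<open>id\<close>.\<close>
  let ?F = "\<lambda>f. g \<circ> f"
  have F: "(?F ^^ n) id = g ^^ n" for n by (induction n) simp_all
  have "finite (range (\<lambda>n. g ^^ n))" using funpow_G[OF gG] by (intro finite_subset[OF _ finite_G]) auto
  then have "\<not> inj (\<lambda>n. g ^^ n)" using finite_imageD[of "\<lambda>n. g ^^ n" UNIV] infinite_UNIV_nat by auto
  then obtain i j where "g ^^ i = g ^^ j" "i < j" unfolding inj_def by (metis linorder_neqE_nat)
  then have "g ^^ (j - i) = id" "0 < j - i" using cancel[of "j - i" i] by simp_all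
  then have ex: "\<exists>k>0. (?F ^^ k) id = id" unfolding F by blast
  define k where "k = (LEAST k. 0 < k \<and> (?F ^^ k) id = id)"
  note k = funpow_fixpoint_iff_dvd[OF k_def ex, unfolded F]
  let ?C = "(\<lambda>n. g ^^ n) ` {..<k}"
  have mod: "g ^^ n \<in> ?C" for n
  proof -
    have "g ^^ n = g ^^ (n mod k) \<circ> g ^^ (k * (n div k))" by (simp flip: funpow_add)
    moreover have "g ^^ (k * (n div k)) = id" using k(2) by simp
    ultimately have "g ^^ n = g ^^ (n mod k)" by simp
    then show ?thesis using k(1) by (metis imageI lessThan_iff mod_less_divisor)
  qed
  have "inj_on (\<lambda>n. g ^^ n) {..<k}"
  proof (rule linorder_inj_onI)
    fix x y assume xy: "x < y" "x \<in> {..<k}" "y \<in> {..<k}"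
    show "g ^^ x \<noteq> g ^^ y"
    proof
      assume "g ^^ x = g ^^ y"
      then have "k dvd y - x" using cancel[of "y - x" x] xy k(2) by simp
      then show False using xy by (auto dest: dvd_imp_le)
    qed
  qed auto
  then have card: "card ?C = k" by (simp add: card_image)
  have pow: "g ^^ n \<in> H" for n
  proof (induction n)
    case 0
    show ?case using subgroup.one_closed[OF H] by (simp add: id_def)
  next
    case (Suc n)
    then show ?case using subgroup.m_closed[OF H g Suc] by (simp only: perm_group_simps funpow.simps)
  qed
  have C: "subgroup ?C perm_group"
  proof (rule subgroupI)
    show "?C \<subseteq> carrier perm_group" using funpow_G[OF gG] by auto
    show "?C \<noteq> {}" using k(1) by auto
    show "f \<otimes>\<^bsub>perm_group\<^esub> f' \<in> ?C" if "f \<in> ?C" "f' \<in> ?C" for f f'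
      using that mod by (auto simp flip: funpow_add)
    show "inv\<^bsub>perm_group\<^esub> f \<in> ?C" if "f \<in> ?C" for f
    proof -
      obtain n where n: "f = g ^^ n" using \<open>f \<in> ?C\<close> by blast
      have "k * n = (k - 1) * n + n" using k(1) by (cases k) auto
      moreover have "g ^^ (k * n) = id" using k(2) by simp
      ultimately have "g ^^ ((k - 1) * n) \<circ> g ^^ n = id" by (simp only: funpow_add)
      then have "inv\<^bsub>perm_group\<^esub> f = g ^^ ((k - 1) * n)"
        using funpow_G[OF gG] n by (intro inv_equality) simp_all
      then show ?thesis using mod by simp
    qed
  qed
  have "subgroup ?C (perm_group\<lparr>carrier := H\<rparr>)"
    by (rule subgroup_incl[OF C H]) (use pow in auto)
  then have "card (rcosets\<^bsub>perm_group\<lparr>carrier := H\<rparr>\<^esub> ?C) * k = card H"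
    using group.lagrange[OF subgroup_imp_group[OF H], of ?C] card by (simp add: order_def)
  then have "k dvd card H" by (metis dvd_triv_right)
  then show ?thesis using k(2) by blast
qed

text \<open>A Sylow subgroup inside the stabilizer of \<open>a\<close> would have order
  \<open>p ^ e\<close> dividing that of the stabilizer. The index of the stabilizer is
  \<open>card S\<close>, a multiple of \<open>p\<close>, so \<open>p ^ Suc e\<close> would divide
  \<open>card G\<close>.\<close>

lemma ex_p_element_moving:
  assumes p: "prime p" "p dvd card S" and trans: "\<And>s. s \<in> S \<Longrightarrow> \<exists>g\<in>G. g a = s" and a: "a \<in> S"
  shows "\<exists>g\<in>G. \<exists>e. g a \<noteq> a \<and> (g ^^ (p ^ e)) = id"
proof -
  interpret group perm_group by (rule group_perm_group)
  let ?St = "{g\<in>G. g a = a}"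
  define e where "e = multiplicity p (card G)"
  have G0: "card G \<noteq> 0" using finite_G id_G by auto
  have "p ^ e dvd card G" unfolding e_def by (rule multiplicity_dvd)
  then obtain m where m: "card G = p ^ e * m" by blast
  have "\<exists>H. subgroup H perm_group \<and> card H = p ^ e"
    using sylow_thm[OF p(1) group_perm_group, of e m] m finite_G by (simp add: order_def)
  then obtain H where H: "subgroup H perm_group" "card H = p ^ e" by blast
  have HG: "H \<subseteq> G" using subgroup.subset[OF H(1)] by simp
  have "\<not> H \<subseteq> ?St"
  proof
    assume sub: "H \<subseteq> ?St"
    have St: "subgroup ?St perm_group"
    proof (rule subgroupI)
      fix g assume "g \<in> ?St"
      then have g: "g \<in> G" "g a = a" by auto
      have i: "inv\<^bsub>perm_group\<^esub> g \<in> G" "inv\<^bsub>perm_group\<^esub> g \<circ> g = id"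
        using inv_closed[of g] l_inv[of g] g by simp_all
      then have "(inv\<^bsub>perm_group\<^esub> g) a = a" using g(2) by (metis comp_apply id_apply)
      then show "inv\<^bsub>perm_group\<^esub> g \<in> ?St" using i by simp
    qed (use id_G comp_G in auto)
    have "subgroup H (perm_group\<lparr>carrier := ?St\<rparr>)"
      by (rule subgroup_incl[OF H(1) St sub])
    then have "card (rcosets\<^bsub>perm_group\<lparr>carrier := ?St\<rparr>\<^esub> H) * card H = card ?St"
      using group.lagrange[OF subgroup_imp_group[OF St], of H] by (simp add: order_def)
    then have "card H dvd card ?St" by (metis (no_types, lifting) dvd_triv_right)
    then have "p * p ^ e dvd card S * card ?St" unfolding H(2) by (rule mult_dvd_mono[OF p(2)])
    then have "p ^ Suc e dvd card G" using card_transitive[OF trans a] by simp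
    moreover have "\<not> is_unit p" using p(1) not_prime_unit by blast
    ultimately have "Suc e \<le> multiplicity p (card G)"
      using G0 by (intro multiplicity_geI)
    then show False unfolding e_def by simp
  qed
  then obtain g where g: "g \<in> H" "g a \<noteq> a" using HG by blast
  have "g ^^ (p ^ e) = id" using funpow_card_subgroup[OF H(1) g(1)] H(2) by simp
  then show ?thesis using g HG by blast
qed

end

text \<open>The orbit of \<open>a\<close> under a \<open>p\<close>-element moving it has length a
  power of \<open>p\<close>, greater than 1, and at most \<open>card S < p ^ 2\<close>.\<close>

lemma (in permutation_monoid) ex_p_cycle:
  assumes p: "prime p" "p dvd card S" "card S < p ^ 2"
    and trans: "\<And>s. s \<in> S \<Longrightarrow> \<exists>g\<in>G. g a = s" and a: "a \<in> S"
  shows "\<exists>g\<in>G. \<forall>n. (g ^^ n) a = a \<longleftrightarrow> p dvd n"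
proof -
  obtain g e where g: "g \<in> G" "g a \<noteq> a" "g ^^ (p ^ e) = id"
    using ex_p_element_moving[OF p(1,2) trans a] by blast
  define k where "k = (LEAST k. 0 < k \<and> (g ^^ k) a = a)"
  have "\<exists>k>0. (g ^^ k) a = a" using g(3) p(1) by (intro exI[of _ "p ^ e"]) (auto simp: prime_gt_0_nat)
  note k = funpow_fixpoint_iff_dvd[OF k_def this]
  have "k dvd p ^ e" using g(3) k(2)[of "p ^ e"] by simp
  then obtain i where i: "k = p ^ i" using p(1) by (metis divides_primepow_nat)
  have "i \<noteq> 0"
  proof
    assume "i = 0"
    then have "(g ^^ 1) a = a" using k(2)[of 1] i by simp
    then show False using g(2) by simp
  qed
  have inj: "inj_on (\<lambda>n. (g ^^ n) a) {..<k}"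
  proof (rule linorder_inj_onI)
    fix x y assume xy: "x < y" "x \<in> {..<k}" "y \<in> {..<k}"
    show "(g ^^ x) a \<noteq> (g ^^ y) a"
    proof
      assume "(g ^^ x) a = (g ^^ y) a"
      then have "(g ^^ x) a = (g ^^ x) ((g ^^ (y - x)) a)"
        using xy by (metis add_diff_inverse_nat comp_apply funpow_add not_less_iff_gr_or_eq)
      then have "(g ^^ (y - x)) a = a"
        using permutes_inj[OF permutes_G[OF funpow_G[OF g(1)]]] by (metis injD)
      then have "k dvd y - x" using k(2) by simp
      then show False using xy by (auto dest: dvd_imp_le)
    qed
  qed auto
  have "(\<lambda>n. (g ^^ n) a) ` {..<k} \<subseteq> S"
    using permutes_in_image[OF permutes_G[OF funpow_G[OF g(1)]]] a by blast
  then have "k \<le> card S" using card_inj_on_le[OF inj _ finite_S] by simp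
  then have "p ^ i < p ^ 2" using p(3) i by simp
  then have "i < 2" using p(1) prime_gt_1_nat by (metis power_less_imp_less_exp)
  then have "k = p" using i \<open>i \<noteq> 0\<close> by (cases i) auto
  then show ?thesis using k(2) g(1) by blast
qed

text \<open>The \<open>a j\<close> run through one \<open>p\<close>-cycle of \<open>g\<close>. As
  \<iota> commutes with \<open>g\<close>, meeting the cycle again would make it a shift by some
  \<open>d\<close> with \<open>p\<close> dividing \<open>2 * d\<close>, so it would fix a point,
  against \<open>h (\<iota> s) = - h s\<close> being odd. By counting, the cycle and its image under
  \<iota> fill \<open>S\<close>. The elements \<open>\<rho> i\<close> are
  \<open>\<tau> \<circ> (g ^^ i)\<close>, so \<open>h\<close> evaluated on
  \<open>\<rho> i (a j)\<close> depends only on \<open>i + j\<close>.\<close>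

lemma (in permutation_monoid) translates_of_weight_span:
  fixes h :: "'a \<Rightarrow> int" and \<iota> :: "'a \<Rightarrow> 'a"
  assumes p: "prime p" "p > 2" "card S = 2 * p"
    and trans: "\<And>s t. s \<in> S \<Longrightarrow> t \<in> S \<Longrightarrow> \<exists>g\<in>G. g s = t"
    and \<iota>: "\<And>s. s \<in> S \<Longrightarrow> \<iota> s \<in> S" "\<And>s. s \<in> S \<Longrightarrow> \<iota> (\<iota> s) = s"
      "\<And>g s. g \<in> G \<Longrightarrow> s \<in> S \<Longrightarrow> \<iota> (g s) = g (\<iota> s)"
    and h: "\<And>s. s \<in> S \<Longrightarrow> odd (h s)" "\<And>s. s \<in> S \<Longrightarrow> h (\<iota> s) = - h s"
    and sep: "\<And>s t. s \<in> S \<Longrightarrow> t \<in> S \<Longrightarrow> s \<noteq> t \<Longrightarrow> \<exists>g\<in>G. h (g s) \<noteq> h (g t)"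
  obtains \<rho> a where "\<And>i. \<rho> i \<in> G" "\<And>j. a j \<in> S" "inj_on a {..<p}"
    "S = a ` {..<p} \<union> \<iota> ` a ` {..<p}" "a ` {..<p} \<inter> \<iota> ` a ` {..<p} = {}"
    "\<And>w. \<exists>u. \<forall>j<p. (\<Sum>i<p. u i * of_int (h (\<rho> i (a j)))) = (w j :: complex)"
proof -
  have "S \<noteq> {}" using p finite_S by auto
  then obtain s where s: "s \<in> S" by blast
  have "card S < p ^ 2" using p by (simp add: power2_eq_square)
  then obtain g where g: "g \<in> G" "\<And>n. (g ^^ n) s = s \<longleftrightarrow> p dvd n"
    using ex_p_cycle[OF p(1), of s] trans[OF s] s p(3) by auto
  define a where "a n = (g ^^ n) s" for n
  have gn: "g ^^ n \<in> G" for n using funpow_G g(1) by blast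
  have aS: "a n \<in> S" for n unfolding a_def using permutes_in_image[OF permutes_G[OF gn]] s by blast
  have a_add: "a (m + n) = (g ^^ m) (a n)" for m n by (simp add: a_def funpow_add)
  have a_eq: "a (m + n) = a n \<longleftrightarrow> p dvd m" for m n
  proof -
    have "a (m + n) = (g ^^ n) (a m)" by (metis a_add add.commute)
    moreover have "a n = (g ^^ n) s" by (simp add: a_def)
    ultimately have "a (m + n) = a n \<longleftrightarrow> a m = s"
      using permutes_inj[OF permutes_G[OF gn]] by (metis injD)
    then show ?thesis using g(2) by (simp add: a_def)
  qed
  have inj: "inj_on a {..<p}"
  proof (rule linorder_inj_onI)
    fix x y assume xy: "x < y" "x \<in> {..<p}" "y \<in> {..<p}"
    then show "a x \<noteq> a y" using a_eq[of "y - x" x] by (auto dest: dvd_imp_le)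
  qed auto
  have disj: "\<iota> (a i) \<noteq> a j" if "i < p" "j < p" for i j
  proof
    assume eq: "\<iota> (a i) = a j"
    \<comment> \<open>The shift from \<open>a i\<close> to \<open>a j\<close>; the summand
      \<open>p\<close>, a period of \<open>a\<close>, keeps the subtraction of naturals
      exact.\<close>
    define d where "d = j + p - i"
    have "a j = a (d + i)" using a_eq[of p j] that by (simp add: d_def add.commute)
    then have eq': "\<iota> (a i) = a (d + i)" using eq by simp
    have "a i = \<iota> (a (d + i))" using \<iota>(2)[OF aS] eq' by metis
    also have "\<dots> = (g ^^ d) (\<iota> (a i))" unfolding a_add[of d i] using \<iota>(3)[OF gn aS] by simp
    also have "\<dots> = a ((d + d) + i)" using eq' a_add[of d "d + i"] by (simp add: add.assoc)
    finally have "p dvd d + d" using a_eq by metis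
    then have "p dvd 2 * d" by (simp add: mult_2)
    then have "p dvd d" using p(1,2) by (metis nat_dvd_not_less prime_dvd_mult_iff zero_less_numeral)
    then have "\<iota> (a i) = a i" using eq' a_eq by metis
    then show False using h[OF aS[of i]] by auto
  qed
  have inj\<iota>: "inj_on \<iota> S" using \<iota>(2) by (metis inj_onI)
  have D: "a ` {..<p} \<inter> \<iota> ` a ` {..<p} = {}" using disj by fastforce
  have "S = a ` {..<p} \<union> \<iota> ` a ` {..<p}"
  proof (rule card_subset_eq[OF finite_S, symmetric])
    show "a ` {..<p} \<union> \<iota> ` a ` {..<p} \<subseteq> S" using aS \<iota>(1) by blast
    have "card (a ` {..<p} \<union> \<iota> ` a ` {..<p}) = card (a ` {..<p}) + card (\<iota> ` a ` {..<p})"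
      using D by (intro card_Un_disjoint) auto
    also have "card (\<iota> ` a ` {..<p}) = card (a ` {..<p})"
      by (rule card_image) (rule inj_on_subset[OF inj\<iota>], use aS in auto)
    finally show "card (a ` {..<p} \<union> \<iota> ` a ` {..<p}) = card S" using card_image[OF inj] p(3) by simp
  qed
  have "a 0 \<noteq> a 1" using inj_onD[OF inj, of 0 1] p(2) by auto
  \<comment> \<open>\<open>h\<close> may be constant on the cycle; separation supplies a translate
    that takes different values at \<open>a 0\<close> and \<open>a 1\<close>.\<close>
  then obtain \<tau> where \<tau>: "\<tau> \<in> G" "h (\<tau> (a 0)) \<noteq> h (\<tau> (a 1))" using sep aS by blast
  define m where "m i = h (\<tau> (a i))" for i
  have "m (i + p) = m i" for i using a_eq[of p i] by (simp add: m_def add.commute)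
  moreover have "odd (\<Sum>i<q. m i) \<longleftrightarrow> odd q" for q
  proof (induction q)
    case (Suc q)
    have "odd (m q)" unfolding m_def using h(1) permutes_in_image[OF permutes_G[OF \<tau>(1)]] aS by blast
    then show ?case using Suc by simp
  qed simp
  then have "(\<Sum>i<p. m i) \<noteq> 0" using p(1,2) prime_odd_nat by (metis even_zero)
  moreover have "0 < p" "1 < p" "m 0 \<noteq> m 1" using p(2) \<tau>(2) by (auto simp: m_def)
  ultimately have "\<exists>u. \<forall>j<p. (\<Sum>i<p. u i * of_int (m (i + j))) = w j" for w :: "nat \<Rightarrow> complex"
    using circulant_solvable[OF p(1), of m 0 1 w] by blast
  moreover have "m (i + j) = h ((\<tau> \<circ> (g ^^ i)) (a j))" for i j by (simp add: m_def a_add)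
  ultimately have "\<exists>u. \<forall>j<p. (\<Sum>i<p. u i * of_int (h ((\<tau> \<circ> (g ^^ i)) (a j)))) = (w j :: complex)" for w
    by simp
  then show thesis
    using that[of "\<lambda>i. \<tau> \<circ> (g ^^ i)" a] comp_G[OF \<tau>(1) gn] aS inj \<open>S = _\<close> D by blast
qed

section \<open>Krull dimension of a torus\<close>

text \<open>Gaussian elimination: each equation is used to eliminate one unknown \<open>i0\<close>,
  so one unknown and one equation disappear together.\<close>

lemma homogeneous_system_nontrivial:
  fixes a :: "'i \<Rightarrow> 'j \<Rightarrow> 'a::field"
  assumes "finite J" "finite I" "card J < card I"
  shows "\<exists>c. (\<exists>i\<in>I. c i \<noteq> 0) \<and> (\<forall>j\<in>J. (\<Sum>i\<in>I. c i * a i j) = 0)"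
  using assms
proof (induction J arbitrary: I a rule: finite_induct)
  case empty
  then have "I \<noteq> {}" by auto
  then show ?case by (intro exI[of _ "\<lambda>_. 1"]) auto
next
  case (insert j J)
  show ?case
  proof (cases "\<forall>i\<in>I. a i j = 0")
    case True
    have "card J < card I" using insert by simp
    then obtain c where c: "\<exists>i\<in>I. c i \<noteq> 0" "\<forall>j\<in>J. (\<Sum>i\<in>I. c i * a i j) = 0"
      using insert.IH[OF insert.prems(1), of a] by blast
    have "(\<Sum>i\<in>I. c i * a i j) = 0" using True by (intro sum.neutral) simp
    with c show ?thesis by blast
  next
    case False
    then obtain i0 where i0: "i0 \<in> I" "a i0 j \<noteq> 0" by blast
    let ?I = "I - {i0}"
    let ?a = "\<lambda>i k. a i k - a i j / a i0 j * a i0 k"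
    have "card J < card ?I" using insert i0 by simp
    then obtain c where c: "\<exists>i\<in>?I. c i \<noteq> 0" "\<forall>k\<in>J. (\<Sum>i\<in>?I. c i * ?a i k) = 0"
      using insert.IH[of ?I ?a] insert.prems by blast
    define d where "d = c(i0 := - (\<Sum>i\<in>?I. c i * (a i j / a i0 j)))"
    have split: "(\<Sum>i\<in>I. d i * a i k) = (\<Sum>i\<in>?I. c i * ?a i k)" for k
    proof -
      have "(\<Sum>i\<in>I. d i * a i k) = d i0 * a i0 k + (\<Sum>i\<in>?I. d i * a i k)"
        using i0 insert.prems by (simp add: sum.remove)
      also have "(\<Sum>i\<in>?I. d i * a i k) = (\<Sum>i\<in>?I. c i * a i k)"
        by (intro sum.cong) (auto simp: d_def)
      also have "d i0 * a i0 k = (\<Sum>i\<in>?I. - (c i * (a i j / a i0 j) * a i0 k))"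
        by (simp add: d_def sum_distrib_right sum_negf)
      finally show ?thesis
        by (simp add: sum.distrib[symmetric] algebra_simps)
    qed
    have "\<forall>k\<in>insert j J. (\<Sum>i\<in>I. d i * a i k) = 0"
      using c(2) i0(2) by (auto simp: split)
    moreover have "\<exists>i\<in>I. d i \<noteq> 0" using c(1) by (auto simp: d_def)
    ultimately show ?thesis by blast
  qed
qed

subsection \<open>Laurent polynomials\<close>

definition torus_points :: "nat \<Rightarrow> (nat \<Rightarrow> complex) set" where
  "torus_points p = {y. \<forall>j<p. y j \<noteq> 0}"

definition laurent_monomial :: "nat \<Rightarrow> (nat \<Rightarrow> int) \<Rightarrow> (nat \<Rightarrow> complex) \<Rightarrow> complex" where
  "laurent_monomial p \<alpha> y = (\<Prod>j<p. y j powi \<alpha> j)"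

definition exponent_box :: "nat \<Rightarrow> nat \<Rightarrow> (nat \<Rightarrow> int) set" where
  "exponent_box p R = (\<Pi>\<^sub>E j\<in>{..<p}. {- int R..int R})"

text \<open>Agreement is demanded only on the torus, where powers with negative exponents behave.
  The functions are there combinations of \<open>(2 * R + 1) ^ p\<close> monomials, a count that
  bounds the dimension of the space they span.\<close>

definition laurent :: "nat \<Rightarrow> nat \<Rightarrow> ((nat \<Rightarrow> complex) \<Rightarrow> complex) set" where
  "laurent p R = {F. \<exists>c. \<forall>y\<in>torus_points p.
     F y = (\<Sum>\<alpha>\<in>exponent_box p R. c \<alpha> * laurent_monomial p \<alpha> y)}"

lemma finite_exponent_box [simp]: "finite (exponent_box p R)"
  unfolding exponent_box_def by (intro finite_PiE) auto

lemma card_exponent_box: "card (exponent_box p R) = (2 * R + 1) ^ p"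
proof -
  have "nat (int R + 1 + int R) = 2 * R + 1" by linarith
  then show ?thesis by (simp add: exponent_box_def card_PiE)
qed

text \<open>Restricting the exponents to \<open>{..<p}\<close> puts them into the box; monomials
  that become equal are collected by adding their coefficients.\<close>

lemma laurentI:
  assumes "finite K" "\<And>k j. k \<in> K \<Longrightarrow> j < p \<Longrightarrow> \<bar>\<alpha> k j\<bar> \<le> int R"
    and "\<And>y. y \<in> torus_points p \<Longrightarrow> F y = (\<Sum>k\<in>K. c k * laurent_monomial p (\<alpha> k) y)"
  shows "F \<in> laurent p R"
proof -
  let ?r = "\<lambda>k. restrict (\<alpha> k) {..<p}"
  have r: "?r ` K \<subseteq> exponent_box p R"
    using assms(2) by (force simp: exponent_box_def abs_le_iff)
  have "F y = (\<Sum>\<beta>\<in>exponent_box p R. (\<Sum>k\<in>{k\<in>K. ?r k = \<beta>}. c k) * laurent_monomial p \<beta> y)"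
    if y: "y \<in> torus_points p" for y
  proof -
    have "F y = (\<Sum>k\<in>K. c k * laurent_monomial p (?r k) y)"
      unfolding assms(3)[OF y] by (simp add: laurent_monomial_def)
    also have "\<dots> = (\<Sum>\<beta>\<in>exponent_box p R. \<Sum>k\<in>{k\<in>K. ?r k = \<beta>}. c k * laurent_monomial p (?r k) y)"
      by (rule sum.group[symmetric]) (use assms(1) r in auto)
    also have "\<dots> = (\<Sum>\<beta>\<in>exponent_box p R. (\<Sum>k\<in>{k\<in>K. ?r k = \<beta>}. c k) * laurent_monomial p \<beta> y)"
      unfolding sum_distrib_right by (intro sum.cong refl) auto
    finally show ?thesis .
  qed
  then show ?thesis
    unfolding laurent_def by (intro CollectI exI[of _ "\<lambda>\<beta>. \<Sum>k\<in>{k\<in>K. ?r k = \<beta>}. c k"]) blast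
qed

lemma laurentE:
  assumes "F \<in> laurent p R"
  obtains c where "\<And>y. y \<in> torus_points p \<Longrightarrow>
    F y = (\<Sum>\<alpha>\<in>exponent_box p R. c \<alpha> * laurent_monomial p \<alpha> y)"
  using assms unfolding laurent_def by blast

lemma exponent_box_abs_le: "\<alpha> \<in> exponent_box p R \<Longrightarrow> j < p \<Longrightarrow> \<bar>\<alpha> j\<bar> \<le> int R"
  by (force simp: exponent_box_def abs_le_iff PiE_iff)

lemma laurent_mono: "F \<in> laurent p R \<Longrightarrow> R \<le> S \<Longrightarrow> F \<in> laurent p S"
  by (erule laurentE, rule laurentI[of "exponent_box p R" p "\<lambda>\<alpha>. \<alpha>" S])
    (auto dest: exponent_box_abs_le)

lemma laurent_const: "(\<lambda>_. c) \<in> laurent p R"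
  by (rule laurentI[of "{()}" p "\<lambda>_ _. 0" R _ "\<lambda>_. c"]) (auto simp: laurent_monomial_def)

lemma laurent_mult:
  assumes "F \<in> laurent p R" "G \<in> laurent p S"
  shows "(\<lambda>y. F y * G y) \<in> laurent p (R + S)"
proof -
  obtain c where c: "\<And>y. y \<in> torus_points p \<Longrightarrow>
    F y = (\<Sum>\<alpha>\<in>exponent_box p R. c \<alpha> * laurent_monomial p \<alpha> y)" using laurentE[OF assms(1)] by blast
  obtain d where d: "\<And>y. y \<in> torus_points p \<Longrightarrow>
    G y = (\<Sum>\<alpha>\<in>exponent_box p S. d \<alpha> * laurent_monomial p \<alpha> y)" using laurentE[OF assms(2)] by blast
  show ?thesis
  proof (rule laurentI[of "exponent_box p R \<times> exponent_box p S" p "\<lambda>(\<alpha>, \<beta>) j. \<alpha> j + \<beta> j" _ _ "\<lambda>(\<alpha>, \<beta>). c \<alpha> * d \<beta>"])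
    show "\<bar>(case k of (\<alpha>, \<beta>) \<Rightarrow> \<lambda>j. \<alpha> j + \<beta> j) j\<bar> \<le> int (R + S)"
      if "k \<in> exponent_box p R \<times> exponent_box p S" "j < p" for k j
    proof -
      have "\<bar>fst k j\<bar> \<le> int R" "\<bar>snd k j\<bar> \<le> int S" using that exponent_box_abs_le by auto
      then show ?thesis by (auto simp: case_prod_beta)
    qed
  next
    fix y assume y: "y \<in> torus_points p"
    have "laurent_monomial p (\<lambda>j. \<alpha> j + \<beta> j) y = laurent_monomial p \<alpha> y * laurent_monomial p \<beta> y" for \<alpha> \<beta>
      using y by (simp add: laurent_monomial_def torus_points_def power_int_add prod.distrib)
    then show "F y * G y = (\<Sum>k\<in>exponent_box p R \<times> exponent_box p S.
        (case k of (\<alpha>, \<beta>) \<Rightarrow> c \<alpha> * d \<beta>) * laurent_monomial p (case k of (\<alpha>, \<beta>) \<Rightarrow> \<lambda>j. \<alpha> j + \<beta> j) y)"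
      unfolding c[OF y] d[OF y] sum_product sum.cartesian_product
      by (intro sum.cong) (auto simp: algebra_simps)
  qed simp
qed

lemma laurent_add:
  assumes "F \<in> laurent p R" "G \<in> laurent p R"
  shows "(\<lambda>y. F y + G y) \<in> laurent p R"
proof -
  obtain c where c: "\<And>y. y \<in> torus_points p \<Longrightarrow>
    F y = (\<Sum>\<alpha>\<in>exponent_box p R. c \<alpha> * laurent_monomial p \<alpha> y)" using laurentE[OF assms(1)] by blast
  obtain d where d: "\<And>y. y \<in> torus_points p \<Longrightarrow>
    G y = (\<Sum>\<alpha>\<in>exponent_box p R. d \<alpha> * laurent_monomial p \<alpha> y)" using laurentE[OF assms(2)] by blast
  show ?thesis
    unfolding laurent_def
    by (intro CollectI exI[of _ "\<lambda>\<alpha>. c \<alpha> + d \<alpha>"]) (auto simp: c d sum.distrib algebra_simps)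
qed

lemma laurent_sum:
  assumes "\<And>i. i \<in> I \<Longrightarrow> F i \<in> laurent p R"
  shows "(\<lambda>y. \<Sum>i\<in>I. F i y) \<in> laurent p R"
  using assms
proof (induction I rule: infinite_finite_induct)
  case (insert i I)
  then show ?case using laurent_add[of "F i" p R "\<lambda>y. \<Sum>i\<in>I. F i y"] by simp
qed (auto simp: laurent_const)

lemma laurent_power: "F \<in> laurent p R \<Longrightarrow> (\<lambda>y. F y ^ e) \<in> laurent p (e * R)"
proof (induction e)
  case (Suc e)
  then show ?case using laurent_mult[of F p R "\<lambda>y. F y ^ e" "e * R"] by simp
qed (simp add: laurent_const)

lemma laurent_powi:
  assumes "j < p" "\<bar>k\<bar> \<le> int R"
  shows "(\<lambda>y. y j powi k) \<in> laurent p R"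
proof (rule laurentI[of "{()}" p "\<lambda>_ i. if i = j then k else 0" R _ "\<lambda>_. 1"])
  fix y
  have "laurent_monomial p (\<lambda>i. if i = j then k else 0) y = (\<Prod>i<p. if i = j then y j powi k else 1)"
    unfolding laurent_monomial_def by (intro prod.cong) auto
  then show "y j powi k = (\<Sum>u\<in>{()}. 1 * laurent_monomial p (\<lambda>i. if i = j then k else 0) y)"
    using assms by simp
qed (use assms in auto)

subsection \<open>Algebraic independence\<close>

definition power_product :: "('a \<Rightarrow> complex) list \<Rightarrow> nat list \<Rightarrow> 'a \<Rightarrow> complex" where
  "power_product fs es x = prod_list (map2 (\<lambda>f e. f x ^ e) fs es)"

lemma power_product_Nil [simp]: "power_product [] es x = 1"
  and power_product_Cons [simp]: "power_product (f # fs) (e # es) x = f x ^ e * power_product fs es x"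
  by (simp_all add: power_product_def)

text \<open>A polynomial relation is given by its finite support \<Lambda>, a set of exponent lists
  with nonzero coefficients; no such relation may hold identically on \<open>Z\<close>. For the
  empty list of functions this says that \<open>Z\<close> is nonempty.\<close>

definition alg_independent_on :: "'a set \<Rightarrow> ('a \<Rightarrow> complex) list \<Rightarrow> bool" where
  "alg_independent_on Z fs \<longleftrightarrow> (\<forall>\<Lambda> c. finite \<Lambda> \<longrightarrow> \<Lambda> \<noteq> {} \<longrightarrow>
     (\<forall>es\<in>\<Lambda>. length es = length fs \<and> c es \<noteq> 0) \<longrightarrow>
     (\<exists>x\<in>Z. (\<Sum>es\<in>\<Lambda>. c es * power_product fs es x) \<noteq> 0))"

lemma polynomial_functions_sum:
  assumes "0 \<in> K" "\<And>i. i \<in> I \<Longrightarrow> f i \<in> polynomial_functions K"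
  shows "(\<lambda>A. \<Sum>i\<in>I. f i A) \<in> polynomial_functions K"
  using assms(2)
proof (induction I rule: infinite_finite_induct)
  case (insert i I)
  then show ?case using polynomial_functions.add[of "f i" K "\<lambda>A. \<Sum>i\<in>I. f i A"] by simp
qed (auto intro: polynomial_functions.const assms(1))

lemma polynomial_functions_power:
  assumes "1 \<in> K" "f \<in> polynomial_functions K"
  shows "(\<lambda>A. f A ^ e) \<in> polynomial_functions K"
  using polynomial_functions.mult[OF assms(2)]
  by (induction e) (auto intro: polynomial_functions.const assms(1))

lemma polynomial_functions_power_product:
  assumes "1 \<in> K" "set fs \<subseteq> polynomial_functions K" "length es = length fs"
  shows "power_product fs es \<in> polynomial_functions K"
  using assms(2,3)
proof (induction fs arbitrary: es)
  case Nil
  then show ?case using polynomial_functions.const[OF assms(1)] by (simp add: power_product_def)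
next
  case (Cons f fs)
  then obtain e es' where es: "es = e # es'" "length es' = length fs" by (cases es) auto
  have "power_product (f # fs) es = (\<lambda>A. f A ^ e * power_product fs es' A)" by (simp add: es(1) fun_eq_iff)
  then show ?case using Cons es
    by (simp add: polynomial_functions.mult polynomial_functions_power assms(1))
qed

lemma alg_independent_on_Cons:
  fixes g :: "complex^'n^'n \<Rightarrow> complex"
  assumes fs: "set fs \<subseteq> polynomial_functions UNIV" "alg_independent_on Z fs"
    and g: "g \<in> polynomial_functions UNIV" "\<forall>x\<in>Z. g x = 0" "\<exists>x\<in>Z'. g x \<noteq> 0"
    and Z': "Z \<subseteq> Z'" "\<And>f h. f \<in> polynomial_functions UNIV \<Longrightarrow> h \<in> polynomial_functions UNIV \<Longrightarrow>
      (\<forall>x\<in>Z'. f x * h x = 0) \<Longrightarrow> (\<forall>x\<in>Z'. f x = 0) \<or> (\<forall>x\<in>Z'. h x = 0)"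
  shows "alg_independent_on Z' (g # fs)"
  unfolding alg_independent_on_def
proof (intro allI impI, rule ccontr)
  fix \<Lambda> c assume \<Lambda>: "finite \<Lambda>" "\<Lambda> \<noteq> {}" "\<forall>es\<in>\<Lambda>. length es = length (g # fs) \<and> c es \<noteq> (0::complex)"
    and "\<not> (\<exists>x\<in>Z'. (\<Sum>es\<in>\<Lambda>. c es * power_product (g # fs) es x) \<noteq> 0)"
  then have zero: "\<forall>x\<in>Z'. (\<Sum>es\<in>\<Lambda>. c es * power_product (g # fs) es x) = 0" by blast
  have es: "es = hd es # tl es" "length (tl es) = length fs" if "es \<in> \<Lambda>" for es
    using \<Lambda>(3) that by (cases es; fastforce)+
  define k where "k = Min (hd ` \<Lambda>)"
  have k: "k \<le> hd es" if "es \<in> \<Lambda>" for es using \<Lambda>(1) that by (simp add: k_def)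
  \<comment> \<open>Dividing the relation by the largest power of \<open>g\<close> and setting \<open>g = 0\<close> leaves a relation on \<open>Z\<close>.\<close>
  define P where "P x = (\<Sum>es\<in>\<Lambda>. c es * (g x ^ (hd es - k) * power_product fs (tl es) x))" for x
  have "P \<in> polynomial_functions UNIV"
    unfolding P_def using es(2) g(1) fs(1)
    by (auto intro!: polynomial_functions_sum polynomial_functions.mult polynomial_functions.const
        polynomial_functions_power polynomial_functions_power_product)
  moreover have "(\<Sum>es\<in>\<Lambda>. c es * power_product (g # fs) es x) = g x ^ k * P x" for x
    unfolding P_def sum_distrib_left
  proof (intro sum.cong refl)
    fix e assume e: "e \<in> \<Lambda>"
    have "power_product (g # fs) e x = g x ^ hd e * power_product fs (tl e) x"
      by (subst es(1)[OF e]) simp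
    also have "g x ^ hd e = g x ^ k * g x ^ (hd e - k)" using k[OF e] by (simp flip: power_add)
    finally show "c e * power_product (g # fs) e x =
      g x ^ k * (c e * (g x ^ (hd e - k) * power_product fs (tl e) x))" by simp
  qed
  \<comment> \<open>\<open>Z'\<close> admits no zero divisors and \<open>g\<close> is not
    identically zero on it, so the factor \<open>g ^ k\<close> can be cancelled.\<close>
  ultimately have "(\<forall>x\<in>Z'. g x ^ k = 0) \<or> (\<forall>x\<in>Z'. P x = 0)"
    using zero Z'(2)[of "\<lambda>x. g x ^ k" P] g(1) by (auto simp: polynomial_functions_power)
  then have P: "P x = 0" if "x \<in> Z" for x using g(3) Z'(1) that by auto
  let ?\<Lambda> = "{es. k # es \<in> \<Lambda>}"
  have fin: "finite ?\<Lambda>" using finite_vimageI[OF \<Lambda>(1), of "(#) k"] by (simp add: vimage_def)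
  have "k \<in> hd ` \<Lambda>" unfolding k_def using \<Lambda> by (intro Min_in) auto
  then obtain e0 where "e0 \<in> \<Lambda>" "hd e0 = k" by blast
  then have "tl e0 \<in> ?\<Lambda>" using es(1) by force
  then have "?\<Lambda> \<noteq> {}" by blast
  moreover have "\<forall>es\<in>?\<Lambda>. length es = length fs \<and> c (k # es) \<noteq> 0" using \<Lambda>(3) by auto
  ultimately obtain x where x: "x \<in> Z" "(\<Sum>es\<in>?\<Lambda>. c (k # es) * power_product fs es x) \<noteq> 0"
    using fs(2)[unfolded alg_independent_on_def, rule_format, of ?\<Lambda> "\<lambda>es. c (k # es)"] fin by auto
  have "P x = (\<Sum>es\<in>{es\<in>\<Lambda>. hd es = k}. c es * power_product fs (tl es) x)"
    unfolding P_def
  proof (rule sum.mono_neutral_cong_right)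
    show "\<forall>i\<in>\<Lambda> - {es \<in> \<Lambda>. hd es = k}. c i * (g x ^ (hd i - k) * power_product fs (tl i) x) = 0"
    proof
      fix i assume i: "i \<in> \<Lambda> - {es \<in> \<Lambda>. hd es = k}"
      then have "hd i - k \<noteq> 0" using k[of i] by auto
      then show "c i * (g x ^ (hd i - k) * power_product fs (tl i) x) = 0"
        using g(2) x(1) by (simp add: power_0_left)
    qed
  qed (use \<Lambda>(1) in auto)
  also have "{es\<in>\<Lambda>. hd es = k} = (#) k ` ?\<Lambda>" using es(1) by (auto simp: image_iff) (metis es(1))
  also have "(\<Sum>es\<in>(#) k ` ?\<Lambda>. c es * power_product fs (tl es) x) =
      (\<Sum>es\<in>?\<Lambda>. c (k # es) * power_product fs es x)"
    by (subst sum.reindex) auto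
  finally show False using x P by simp
qed

lemma alg_independent_laurent_bound:
  fixes m :: "(nat \<Rightarrow> complex) \<Rightarrow> 'a"
  assumes len: "length fs = Suc p"
    and Z: "Z \<subseteq> m ` torus_points p"
    and fs: "\<And>f. f \<in> set fs \<Longrightarrow> \<exists>R. (\<lambda>y. f (m y)) \<in> laurent p R"
  shows "\<not> alg_independent_on Z fs"
proof
  assume indep: "alg_independent_on Z fs"
  obtain r where r: "\<And>f. f \<in> set fs \<Longrightarrow> (\<lambda>y. f (m y)) \<in> laurent p (r f)"
    using fs by metis
  define D where "D = Max (insert 0 (r ` set fs))"
  have D: "(\<lambda>y. f (m y)) \<in> laurent p D" if "f \<in> set fs" for f
    by (rule laurent_mono[OF r[OF that]]) (use that in \<open>auto simp: D_def\<close>)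
  \<comment> \<open>The \<open>(N + 1) ^ Suc p\<close> power products lie in a space of dimension \<open>O(N ^ p)\<close>.\<close>
  define N where "N = (2 * (Suc p * D) + 1) ^ p"
  have pp: "(\<lambda>y. power_product gs es (m y)) \<in> laurent p (length gs * (N * D))"
    if "set gs \<subseteq> set fs" "length es = length gs" "set es \<subseteq> {..N}" for gs es
    using that
  proof (induction gs arbitrary: es)
    case Nil
    then show ?case by (simp add: laurent_const)
  next
    case (Cons g gs)
    then obtain e es' where es: "es = e # es'" "length es' = length gs" by (cases es) auto
    have "(\<lambda>y. g (m y) ^ e) \<in> laurent p (N * D)"
      by (rule laurent_mono[OF laurent_power[OF D]]) (use Cons.prems es in auto)
    moreover have "(\<lambda>y. power_product gs es' (m y)) \<in> laurent p (length gs * (N * D))"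
      using Cons es by auto
    ultimately show ?case using laurent_mult by (fastforce simp: es(1))
  qed
  define R where "R = Suc p * (N * D)"
  let ?E = "{es. set es \<subseteq> {..N} \<and> length es = Suc p}"
  have "\<exists>c. \<forall>y\<in>torus_points p. power_product fs es (m y) =
      (\<Sum>\<alpha>\<in>exponent_box p R. c \<alpha> * laurent_monomial p \<alpha> y)" if "es \<in> ?E" for es
    using pp[of fs es] that len unfolding R_def laurent_def by auto
  then have "\<exists>a. \<forall>es\<in>?E. \<forall>y\<in>torus_points p. power_product fs es (m y) =
      (\<Sum>\<alpha>\<in>exponent_box p R. a es \<alpha> * laurent_monomial p \<alpha> y)" by (intro bchoice ballI)
  then obtain a where a: "\<And>es y. es \<in> ?E \<Longrightarrow> y \<in> torus_points p \<Longrightarrow> power_product fs es (m y) =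
      (\<Sum>\<alpha>\<in>exponent_box p R. a es \<alpha> * laurent_monomial p \<alpha> y)" by blast
  have finE: "finite ?E" using finite_lists_length_eq[of "{..N}" "Suc p"] by simp
  \<comment> \<open>With this choice of \<open>N\<close> there are at most
    \<open>N * (N + 1) ^ p\<close> monomials, strictly fewer than the \<open>(N + 1) ^ Suc p\<close>
    power products, so some nontrivial combination of the latter vanishes.\<close>
  have "2 * R + 1 \<le> (2 * (Suc p * D) + 1) * (N + 1)" by (simp add: R_def algebra_simps)
  then have "(2 * R + 1) ^ p \<le> N * (N + 1) ^ p" using power_mono[of "2 * R + 1" _ p]
    by (metis N_def le0 power_mult_distrib)
  also have "\<dots> < (N + 1) ^ Suc p" by simp
  finally have "card (exponent_box p R) < card ?E"
    using card_lists_length_eq[of "{..N}" "Suc p"] by (simp add: card_exponent_box)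
  then obtain c where c: "\<exists>es\<in>?E. c es \<noteq> 0"
      "\<forall>\<alpha>\<in>exponent_box p R. (\<Sum>es\<in>?E. c es * a es \<alpha>) = 0"
    using homogeneous_system_nontrivial[OF finite_exponent_box finE, of p R a] by blast
  let ?\<Lambda> = "{es\<in>?E. c es \<noteq> 0}"
  have "finite ?\<Lambda>" using finE by (rule rev_finite_subset) blast
  moreover have "?\<Lambda> \<noteq> {}" "\<forall>es\<in>?\<Lambda>. length es = length fs \<and> c es \<noteq> 0"
    using c(1) len by auto
  ultimately obtain x where x: "x \<in> Z" "(\<Sum>es\<in>?\<Lambda>. c es * power_product fs es x) \<noteq> 0"
    using indep unfolding alg_independent_on_def by blast
  obtain y where y: "y \<in> torus_points p" "x = m y" using x(1) Z by blast
  have "(\<Sum>es\<in>?\<Lambda>. c es * power_product fs es x) = (\<Sum>es\<in>?E. c es * power_product fs es x)"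
    by (rule sum.mono_neutral_left) (use finE in auto)
  also have "\<dots> = (\<Sum>es\<in>?E. \<Sum>\<alpha>\<in>exponent_box p R. (c es * a es \<alpha>) * laurent_monomial p \<alpha> y)"
    unfolding y(2) by (intro sum.cong refl) (auto simp: a y(1) sum_distrib_left mult.assoc)
  also have "\<dots> = (\<Sum>\<alpha>\<in>exponent_box p R. (\<Sum>es\<in>?E. c es * a es \<alpha>) * laurent_monomial p \<alpha> y)"
    unfolding sum_distrib_right by (rule sum.swap)
  also have "\<dots> = 0" using c(2) by (intro sum.neutral) auto
  finally show False using x(2) by simp
qed

section \<open>Chains of irreducible closed sets\<close>

lemma closedin_zariski_subtopology:
  fixes M :: "(complex^'n^'n) set"
  shows "closedin (subtopology (zariski_topology UNIV) M) Z \<longleftrightarrow>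
    (\<exists>F\<subseteq>polynomial_functions UNIV. Z = {x\<in>M. \<forall>f\<in>F. f x = 0})"
  unfolding closedin_subtopology by (auto simp: closedin_zariski)

lemma irreducible_closedin_zeros:
  fixes M :: "(complex^'n^'n) set"
  assumes "irreducible_closedin (subtopology (zariski_topology UNIV) M) Z"
    and fh: "f \<in> polynomial_functions UNIV" "h \<in> polynomial_functions UNIV" "\<forall>x\<in>Z. f x * h x = 0"
  shows "(\<forall>x\<in>Z. f x = 0) \<or> (\<forall>x\<in>Z. h x = 0)"
proof -
  have cl: "closedin (subtopology (zariski_topology UNIV) M) {x\<in>M. f x = 0}"
    if "f \<in> polynomial_functions UNIV" for f
    unfolding closedin_zariski_subtopology by (rule exI[of _ "{f}"]) (use that in auto)
  have "Z \<subseteq> M" using assms(1) unfolding irreducible_closedin_def closedin_zariski_subtopology by blast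
  then have "Z \<subseteq> {x\<in>M. f x = 0} \<union> {x\<in>M. h x = 0}" using fh(3) by auto
  then have "Z \<subseteq> {x\<in>M. f x = 0} \<or> Z \<subseteq> {x\<in>M. h x = 0}"
    using assms(1) cl[OF fh(1)] cl[OF fh(2)] unfolding irreducible_closedin_def by blast
  then show ?thesis by blast
qed

text \<open>Irreducibility of \<open>Z (Suc i)\<close> supplies the absence of zero divisors
  required to adjoin a function; nonemptiness of \<open>Z 0\<close> starts the induction with the
  empty list.\<close>

lemma chain_alg_independent:
  fixes M :: "(complex^'n^'n) set"
  assumes irr: "\<And>i. i \<le> d \<Longrightarrow> irreducible_closedin (subtopology (zariski_topology UNIV) M) (Z i)"
    and str: "\<And>i. i < d \<Longrightarrow> Z i \<subset> Z (Suc i)"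
  shows "i \<le> d \<Longrightarrow> \<exists>fs. length fs = i \<and> set fs \<subseteq> polynomial_functions UNIV \<and> alg_independent_on (Z i) fs"
proof (induction i)
  case 0
  have "Z 0 \<noteq> {}" using irr[of 0] by (simp add: irreducible_closedin_def)
  then obtain x where x: "x \<in> Z 0" by blast
  have "alg_independent_on (Z 0) []"
    unfolding alg_independent_on_def
  proof (intro allI impI)
    fix \<Lambda> :: "nat list set" and c assume "finite \<Lambda>" "\<Lambda> \<noteq> {}"
      "\<forall>es\<in>\<Lambda>. length es = length ([] :: (complex^'n^'n \<Rightarrow> complex) list) \<and> c es \<noteq> (0::complex)"
    then have "\<Lambda> = {[]}" "c [] \<noteq> 0" by auto
    then show "\<exists>x\<in>Z 0. (\<Sum>es\<in>\<Lambda>. c es * power_product [] es x) \<noteq> 0" using x by auto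
  qed
  then show ?case by (intro exI[of _ "[]"]) auto
next
  case (Suc i)
  then obtain fs where fs: "length fs = i" "set fs \<subseteq> polynomial_functions UNIV" "alg_independent_on (Z i) fs"
    by auto
  have "Z i \<subset> Z (Suc i)" using str Suc by simp
  then obtain x where x: "x \<in> Z (Suc i)" "x \<notin> Z i" by blast
  obtain F where F: "F \<subseteq> polynomial_functions UNIV" "Z i = {x\<in>M. \<forall>f\<in>F. f x = 0}"
    using irr[of i] Suc.prems unfolding irreducible_closedin_def closedin_zariski_subtopology by auto
  have "x \<in> M" using irr[OF Suc.prems] x(1) unfolding irreducible_closedin_def closedin_zariski_subtopology by blast
  then obtain g where g: "g \<in> F" "g x \<noteq> 0" using x(2) F(2) by blast
  have "alg_independent_on (Z (Suc i)) (g # fs)"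
  proof (rule alg_independent_on_Cons[OF fs(2,3)])
    show "Z i \<subseteq> Z (Suc i)" using \<open>Z i \<subset> Z (Suc i)\<close> by blast
    show "(\<forall>x\<in>Z (Suc i). f x = 0) \<or> (\<forall>x\<in>Z (Suc i). h x = 0)"
      if "f \<in> polynomial_functions UNIV" "h \<in> polynomial_functions UNIV" "\<forall>x\<in>Z (Suc i). f x * h x = 0" for f h
      using irreducible_closedin_zeros[OF irr[OF Suc.prems] that] .
  qed (use g F x in auto)
  then show ?case using fs g F by (intro exI[of _ "g # fs"]) auto
qed

subsection \<open>Exponential parametrizations\<close>

lemma polynomial_function_compose_holomorphic:
  fixes e :: "complex \<Rightarrow> complex^'n^'n"
  assumes "f \<in> polynomial_functions K" "\<And>i j. (\<lambda>u. e u $ i $ j) holomorphic_on UNIV"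
  shows "(\<lambda>u. f (e u)) holomorphic_on UNIV"
  using assms(1) by induction (auto intro: holomorphic_intros assms(2))

lemma holomorphic_mult_eq_0:
  fixes f g :: "complex \<Rightarrow> complex"
  assumes f: "f holomorphic_on UNIV" and g: "g holomorphic_on UNIV"
    and "\<And>u. f u * g u = 0" "f a \<noteq> 0"
  shows "g b = 0"
proof -
  have "continuous_on UNIV f" using f holomorphic_on_imp_continuous_on by blast
  then have "open {u. f u \<noteq> 0}"
    using open_vimage[of "- {0}" f] by (simp add: vimage_def open_Compl)
  moreover have "g u = 0" if "u \<in> {u. f u \<noteq> 0}" for u using that assms(3)[of u] by simp
  ultimately show ?thesis
    using analytic_continuation_open[of "{u. f u \<noteq> 0}" UNIV g "\<lambda>_. 0" b] g assms(4) by auto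
qed

text \<open>Any two points of the image are joined by an entire curve inside it. If two closed sets
  covered the image and neither contained it, polynomials witnessing this would restrict to two
  nonzero entire functions on such a curve with product zero.\<close>

lemma irreducible_closedin_exp_image:
  fixes e :: "'w \<Rightarrow> complex^'n^'n" and line :: "'w \<Rightarrow> 'w \<Rightarrow> complex \<Rightarrow> 'w"
  assumes cl: "closedin (subtopology (zariski_topology UNIV) M) (e ` W)" and "W \<noteq> {}"
    and line: "\<And>v w. v \<in> W \<Longrightarrow> w \<in> W \<Longrightarrow> line v w 0 = v \<and> line v w 1 = w \<and> (\<forall>u. line v w u \<in> W)"
    and hol: "\<And>v w i j. v \<in> W \<Longrightarrow> w \<in> W \<Longrightarrow> (\<lambda>u. e (line v w u) $ i $ j) holomorphic_on UNIV"
  shows "irreducible_closedin (subtopology (zariski_topology UNIV) M) (e ` W)"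
  unfolding irreducible_closedin_def
proof (intro conjI allI impI, rule cl)
  show "e ` W \<noteq> {}" using assms(2) by simp
next
  fix A B assume "closedin (subtopology (zariski_topology UNIV) M) A"
    "closedin (subtopology (zariski_topology UNIV) M) B" and sub: "e ` W \<subseteq> A \<union> B"
  then obtain F G where F: "F \<subseteq> polynomial_functions UNIV" "A = {x\<in>M. \<forall>f\<in>F. f x = 0}"
    and G: "G \<subseteq> polynomial_functions UNIV" "B = {x\<in>M. \<forall>f\<in>G. f x = 0}"
    unfolding closedin_zariski_subtopology by auto
  show "e ` W \<subseteq> A \<or> e ` W \<subseteq> B"
  proof (rule ccontr)
    assume "\<not> (e ` W \<subseteq> A \<or> e ` W \<subseteq> B)"
    then obtain v w where v: "v \<in> W" "e v \<notin> A" and w: "w \<in> W" "e w \<notin> B" by blast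
    have "e ` W \<subseteq> M" using cl unfolding closedin_zariski_subtopology by blast
    then obtain f g where f: "f \<in> F" "f (e v) \<noteq> 0" and g: "g \<in> G" "g (e w) \<noteq> 0"
      using v w F(2) G(2) by blast
    have h: "(\<lambda>u. k (e (line v w u))) holomorphic_on UNIV" if "k \<in> polynomial_functions UNIV" for k
      by (rule polynomial_function_compose_holomorphic[OF that hol[OF v(1) w(1)]])
    have "f (e (line v w u)) * g (e (line v w u)) = 0" for u
    proof -
      have "e (line v w u) \<in> A \<union> B" using line[OF v(1) w(1)] sub by blast
      then show ?thesis using F(2) G(2) f(1) g(1) by auto
    qed
    then have "g (e (line v w 1)) = 0"
      using holomorphic_mult_eq_0[OF h h, of f g 0 1] F(1) G(1) f g line[OF v(1) w(1)] by auto
    then show False using g(2) line[OF v(1) w(1)] by simp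
  qed
qed

text \<open>The polynomial functions \<open>x j\<close> recover the parameters \<open>y j\<close>.
  Above, functions on the image pull back to Laurent polynomials in \<open>p\<close> variables, and
  a chain with more than \<open>p\<close> steps would provide \<open>Suc p\<close> independent ones.
  Below, the subtori \<open>y j = 1\<close> for \<open>j \<ge> d\<close> form a chain with
  \<open>p\<close> steps.\<close>

lemma krull_dim_torus:
  fixes A B :: "nat \<Rightarrow> complex^'n^'n" and x :: "nat \<Rightarrow> complex^'n^'n \<Rightarrow> complex" and p :: nat
  defines "m \<equiv> \<lambda>y. \<chi> i k. \<Sum>j<p. A j $ i $ k * y j + B j $ i $ k * inverse (y j)"
  assumes x: "\<And>j. j < p \<Longrightarrow> x j \<in> polynomial_functions UNIV"
    "\<And>j y. j < p \<Longrightarrow> y \<in> torus_points p \<Longrightarrow> x j (m y) = y j"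
  shows "krull_dim (subtopology (zariski_topology UNIV) (m ` torus_points p)) = enat p"
proof (rule antisym)
  let ?X = "subtopology (zariski_topology UNIV) (m ` torus_points p)"
  have entry: "(\<lambda>y. m y $ i $ k) \<in> laurent p 1" for i k
  proof -
    have "(\<lambda>y. A j $ i $ k * y j powi 1 + B j $ i $ k * y j powi (-1)) \<in> laurent p (0 + 1)" if "j < p" for j
      by (intro laurent_add laurent_mult laurent_const laurent_powi) (use that in auto)
    then show ?thesis
      unfolding m_def by (auto simp: power_int_minus intro!: laurent_sum)
  qed
  have poly: "\<exists>R. (\<lambda>y. f (m y)) \<in> laurent p R" if "f \<in> polynomial_functions UNIV" for f
    using that
  proof (induction rule: polynomial_functions.induct)
    case (add f g)
    then obtain R S where "(\<lambda>y. f (m y)) \<in> laurent p R" "(\<lambda>y. g (m y)) \<in> laurent p S" by blast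
    then have "(\<lambda>y. f (m y)) \<in> laurent p (R + S)" "(\<lambda>y. g (m y)) \<in> laurent p (R + S)"
      using laurent_mono le_add1 le_add2 by blast+
    then show ?case using laurent_add by blast
  next
    case (mult f g)
    then show ?case using laurent_mult by blast
  qed (use entry laurent_const in blast)+
  show "krull_dim ?X \<le> enat p"
    unfolding krull_dim_def
  proof (rule Sup_least, clarify)
    fix d Z assume Z: "\<forall>i\<le>d. irreducible_closedin ?X (Z i)" "\<forall>i<d. Z i \<subset> Z (Suc i)"
    have "d \<le> p"
    proof (rule ccontr)
      assume "\<not> d \<le> p"
      then obtain fs where fs: "length fs = Suc p" "set fs \<subseteq> polynomial_functions UNIV"
          "alg_independent_on (Z (Suc p)) fs"
        using chain_alg_independent[of d "m ` torus_points p" Z "Suc p"] Z by auto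
      moreover have "Z (Suc p) \<subseteq> m ` torus_points p"
      proof -
        have "irreducible_closedin ?X (Z (Suc p))" using Z(1) \<open>\<not> d \<le> p\<close> by simp
        then show ?thesis unfolding irreducible_closedin_def closedin_zariski_subtopology by blast
      qed
      ultimately show False using alg_independent_laurent_bound[OF fs(1), of "Z (Suc p)" m] poly by blast
    qed
    then show "enat d \<le> enat p" by simp
  qed
  \<comment> \<open>Logarithmic coordinates of the subtorus whose coordinates from \<open>d\<close>
    on equal 1. They form a vector space, so complex lines through two points stay inside.\<close>
  define W where "W d = {w :: nat \<Rightarrow> complex. \<forall>j. d \<le> j \<longrightarrow> w j = 0}" for d :: nat
  define e where "e w = m (\<lambda>j. exp (w j))" for w
  have eW: "e ` W d = {X \<in> m ` torus_points p. \<forall>j\<in>{d..<p}. x j X - 1 = 0}" if "d \<le> p" for d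
  proof (intro equalityI subsetI)
    fix X assume "X \<in> e ` W d"
    then obtain w where w: "\<forall>j\<ge>d. w j = 0" "X = m (\<lambda>j. exp (w j))" unfolding W_def e_def by blast
    have "(\<lambda>j. exp (w j)) \<in> torus_points p" by (simp add: torus_points_def)
    then show "X \<in> {X \<in> m ` torus_points p. \<forall>j\<in>{d..<p}. x j X - 1 = 0}"
      using w x(2) by auto
  next
    fix X assume "X \<in> {X \<in> m ` torus_points p. \<forall>j\<in>{d..<p}. x j X - 1 = 0}"
    then obtain y where y: "y \<in> torus_points p" "X = m y" "\<forall>j\<in>{d..<p}. y j = 1" using x(2) by auto
    let ?w = "\<lambda>j. if j < d then Ln (y j) else 0"
    have "exp (?w j) = y j" if "j < p" for j using y that by (auto simp: torus_points_def)
    then have "X = e ?w" unfolding y(2) e_def m_def by (simp add: vec_eq_iff)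
    moreover have "?w \<in> W d" by (simp add: W_def)
    ultimately show "X \<in> e ` W d" by blast
  qed
  have irr: "irreducible_closedin ?X (e ` W d)" if d: "d \<le> p" for d
  proof (rule irreducible_closedin_exp_image[where line = "\<lambda>v w u j. v j + u * (w j - v j)"])
    have "(\<lambda>X. x j X - 1) \<in> polynomial_functions UNIV" if "j < p" for j
      using polynomial_functions.add[OF x(1)[OF that] polynomial_functions.const[of "-1"]] by simp
    then show "closedin ?X (e ` W d)"
      unfolding closedin_zariski_subtopology eW[OF d]
      by (intro exI[of _ "(\<lambda>j X. x j X - 1) ` {d..<p}"]) auto
    show "W d \<noteq> {}" unfolding W_def by auto
    show "(\<lambda>u. e (\<lambda>j. v j + u * (w j - v j)) $ i $ k) holomorphic_on UNIV" for v w i k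
      unfolding e_def m_def by (auto intro!: holomorphic_intros)
  qed (auto simp: W_def)
  have "e ` W d \<subset> e ` W (Suc d)" if d: "d < p" for d
  proof
    show "e ` W d \<subseteq> e ` W (Suc d)" unfolding W_def by (intro image_mono) auto
    \<comment> \<open>A point of the larger subtorus whose coordinate \<open>d\<close> is 2, whereas
      it is 1 throughout the smaller one.\<close>
    let ?w = "\<lambda>j. if j = d then Ln 2 else 0"
    have "(\<lambda>j. exp (?w j)) \<in> torus_points p" by (simp add: torus_points_def)
    then have "x d (e ?w) = 2" unfolding e_def using x(2)[OF d] by simp
    moreover have "x d X = 1" if "X \<in> e ` W d" for X
      using that eW[of d] d by auto
    ultimately have "e ?w \<notin> e ` W d" by fastforce
    moreover have "e ?w \<in> e ` W (Suc d)" by (rule imageI) (simp add: W_def)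
    ultimately show "e ` W d \<noteq> e ` W (Suc d)" by blast
  qed
  then show "enat p \<le> krull_dim ?X"
    unfolding krull_dim_def using irr by (intro Sup_upper CollectI exI[of _ p] conjI refl exI[of _ "\<lambda>d. e ` W d"]) auto
qed

section \<open>The isometry group of the polarization\<close>

lemma ex_unit_non_root_of_unity: "\<exists>z::complex. norm z = 1 \<and> (\<forall>k::int. z powi k = 1 \<longrightarrow> k = 0)"
proof -
  have "\<exists>x::real. x \<notin> \<rat>" using countable_rat uncountable_UNIV_real by (metis UNIV_eq_I)
  then obtain x :: real where x: "x \<notin> \<rat>" by blast
  let ?z = "exp (\<i> * of_real (2 * pi * x))"
  have "k = 0" if "?z powi k = 1" for k :: int
  proof (rule ccontr)
    assume "k \<noteq> 0"
    have "exp (of_int k * (\<i> * of_real (2 * pi * x))) = 1" using that by (simp only: exp_power_int)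
    then obtain m :: int where "of_int k * (2 * pi * x) = of_int (2 * m) * pi"
      by (auto simp: exp_eq_1)
    then have "of_int k * x = of_int m" by simp
    then have "x = of_int m / of_int k" using \<open>k \<noteq> 0\<close> by (simp add: field_simps)
    then show False using x by simp
  qed
  moreover have "norm ?z = 1" by (simp add: norm_exp_i_times)
  ultimately show ?thesis by blast
qed

lemma complexify_form_add_left: "complexify_form Q (u + u') v = complexify_form Q u v + complexify_form Q u' v"
  and complexify_form_add_right: "complexify_form Q u (v + v') = complexify_form Q u v + complexify_form Q u v'"
  and complexify_form_scale_left: "complexify_form Q (c *s u) v = c * complexify_form Q u v"
  and complexify_form_scale_right: "complexify_form Q u (c *s v) = c * complexify_form Q u v"
  by (simp_all add: complexify_form_def algebra_simps sum.distrib sum_distrib_left)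

lemma complexify_form_sum_left: "complexify_form Q (sum f I) v = (\<Sum>i\<in>I. complexify_form Q (f i) v)"
proof (induction I rule: infinite_finite_induct)
  case (insert i I)
  then show ?case by (simp add: complexify_form_add_left)
qed (simp_all add: complexify_form_def)

lemma complexify_form_sum_right: "complexify_form Q u (sum f I) = (\<Sum>i\<in>I. complexify_form Q u (f i))"
proof (induction I rule: infinite_finite_induct)
  case (insert i I)
  then show ?case by (simp add: complexify_form_add_right)
qed (simp_all add: complexify_form_def)

lemma complexify_form_automorphism:
  assumes "field_aut \<sigma>"
  shows "complexify_form Q (map_vec \<sigma> u) (map_vec \<sigma> v) = \<sigma> (complexify_form Q u v)"
  by (simp add: complexify_form_def field_aut_sum[OF assms] field_aut_mult[OF assms]
      field_aut_of_rat[OF assms])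

definition isometry_group :: "(rat^'n \<Rightarrow> rat^'n \<Rightarrow> rat) \<Rightarrow> (complex^'n^'n) set" where
  "isometry_group Q = {A \<in> general_linear. \<forall>u v. complexify_form Q (A *v u) (A *v v) = complexify_form Q u v}"

lemma general_linear_matrix_inv:
  assumes "A \<in> general_linear"
  shows "A ** matrix_inv A = mat 1" "matrix_inv A ** A = mat 1"
proof -
  have "\<exists>B. A ** B = mat 1 \<and> B ** A = mat 1"
    using assms by (simp add: general_linear_def invertible_def)
  then have "A ** matrix_inv A = mat 1 \<and> matrix_inv A ** A = mat 1"
    unfolding matrix_inv_def by (rule someI_ex)
  then show "A ** matrix_inv A = mat 1" "matrix_inv A ** A = mat 1" by auto
qed

text \<open>By bilinearity it suffices to preserve the form on pairs of coordinate vectors. Each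
  pair gives a quadratic polynomial in the entries, with coefficients from the rational Gram matrix
  of \<open>Q\<close>.\<close>

lemma rational_algebraic_group_isometry_group: "rational_algebraic_group (isometry_group Q :: (complex^'n^'n) set)"
  unfolding rational_algebraic_group_def
proof (intro conjI ballI)
  define f where "f i j A = complexify_form Q (A *v axis i 1) (A *v axis j 1) - complexify_form Q (axis i 1) (axis j 1)"
    for i j and A :: "complex^'n^'n"
  have nth: "axis i (1::complex) $ k = (if k = i then 1 else 0)" for i k :: 'n by (simp add: axis_def)
  have axis: "complexify_form Q (axis i 1) (axis j 1) = of_rat (Q (axis i 1) (axis j 1))" for i j
  proof -
    have "complexify_form Q (axis i 1) (axis j 1) =
        (\<Sum>k\<in>UNIV. if k = i then (\<Sum>l\<in>UNIV. if l = j then of_rat (Q (axis k 1) (axis l 1)) else 0) else 0)"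
      unfolding complexify_form_def by (intro sum.cong refl)
        (auto simp: nth if_distrib[of "\<lambda>x. x * _"] cong: if_cong)
    then show ?thesis by simp
  qed
  have "f i j \<in> polynomial_functions \<rat>" for i j
  proof -
    have "f i j = (\<lambda>A. (\<Sum>k\<in>UNIV. \<Sum>l\<in>UNIV. A $ k $ i * A $ l $ j * of_rat (Q (axis k 1) (axis l 1))) +
        of_rat (- Q (axis i 1) (axis j 1)))"
    proof -
      have "(A *v axis i 1) $ k = A $ k $ i" for A :: "complex^'n^'n" and i k
        by (simp add: matrix_vector_mult_def nth if_distrib cong: if_cong)
      then show ?thesis unfolding f_def axis by (simp add: complexify_form_def fun_eq_iff of_rat_minus)
    qed
    moreover have "\<dots> \<in> polynomial_functions \<rat>"
      by (intro polynomial_functions.add polynomial_functions_sum polynomial_functions.mult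
          polynomial_functions.entry polynomial_functions.const) auto
    ultimately show ?thesis by simp
  qed
  moreover have "isometry_group Q = {A. \<forall>g\<in>{f i j | i j. True}. g A = 0} \<inter> general_linear"
  proof (intro equalityI subsetI)
    fix A assume "A \<in> isometry_group Q"
    then show "A \<in> {A. \<forall>g\<in>{f i j | i j. True}. g A = 0} \<inter> general_linear"
      by (auto simp: isometry_group_def f_def)
  next
    fix A assume A: "A \<in> {A. \<forall>g\<in>{f i j | i j. True}. g A = 0} \<inter> general_linear"
    then have eq: "complexify_form Q (A *v axis i 1) (A *v axis j 1) = complexify_form Q (axis i 1) (axis j 1)" for i j
      by (force simp: f_def)
    have "complexify_form Q (A *v u) (A *v v) = complexify_form Q u v" for u v
    proof -
      have "complexify_form Q (B *v u) (B *v v) = (\<Sum>i\<in>UNIV. \<Sum>j\<in>UNIV. u $ i * (v $ j *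
          complexify_form Q (B *v axis i 1) (B *v axis j 1)))" for B :: "complex^'n^'n"
      proof -
        have B: "B *v u = (\<Sum>i\<in>UNIV. u $ i *s (B *v axis i 1))" for u
          by (subst basis_expansion[symmetric])
            (simp only: mat_sum mat_scale)
        show ?thesis
          unfolding B[of u] B[of v] complexify_form_sum_left complexify_form_scale_left
          unfolding complexify_form_sum_right complexify_form_scale_right sum_distrib_left ..
      qed
      from this[of A] this[of "mat 1"] show ?thesis by (simp add: eq matrix_vector_mul_lid)
    qed
    then show "A \<in> isometry_group Q" using A by (simp add: isometry_group_def)
  qed
  ultimately show "closedin (subtopology (zariski_topology \<rat>) general_linear) (isometry_group Q :: (complex^'n^'n) set)"
  proof -
    assume f: "\<And>i j. f i j \<in> polynomial_functions \<rat>"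
      and eq: "isometry_group Q = {A. \<forall>g\<in>{f i j | i j. True}. g A = 0} \<inter> general_linear"
    have "{f i j | i j. True} \<subseteq> polynomial_functions \<rat>" using f by blast
    then have "\<exists>F\<subseteq>polynomial_functions \<rat>.
        {A. \<forall>g\<in>{f i j | i j. True}. g A = 0} = {A. \<forall>g\<in>F. g A = 0}"
      by (intro exI[of _ "{f i j | i j. True}"] conjI) (assumption | rule refl)+
    then have "closedin (zariski_topology \<rat>) {A. \<forall>g\<in>{f i j | i j. True}. g A = 0}"
      by (simp only: closedin_zariski[OF Rats_1])
    then show ?thesis unfolding closedin_subtopology eq by blast
  qed
next
  show "mat 1 \<in> isometry_group Q"
    using rational_algebraic_group_general_linear[where 'n = 'n]
    by (simp add: isometry_group_def rational_algebraic_group_def matrix_vector_mul_lid)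
next
  fix A B :: "complex^'n^'n" assume "A \<in> isometry_group Q" "B \<in> isometry_group Q"
  then show "A ** B \<in> isometry_group Q"
    using rational_algebraic_group_general_linear[where 'n = 'n]
    by (simp add: isometry_group_def rational_algebraic_group_def flip: matrix_vector_mul_assoc)
next
  fix A :: "complex^'n^'n" assume A: "A \<in> isometry_group Q"
  then have gl: "A \<in> general_linear" by (simp add: isometry_group_def)
  have "complexify_form Q (matrix_inv A *v u) (matrix_inv A *v v) = complexify_form Q u v" for u v
  proof -
    have "complexify_form Q (matrix_inv A *v u) (matrix_inv A *v v) =
        complexify_form Q (A *v (matrix_inv A *v u)) (A *v (matrix_inv A *v v))"
      using A by (simp add: isometry_group_def)
    then show ?thesis using general_linear_matrix_inv[OF gl] by (simp add: matrix_vector_mul_assoc matrix_vector_mul_lid)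
  qed
  then show "matrix_inv A \<in> isometry_group Q"
    using matrix_inv_general_linear[OF gl] by (simp add: isometry_group_def)
qed

lemma hodge_component_subspace: "vec.subspace (hodge_component \<phi> k l)"
  by (rule vec.subspaceI) (simp_all add: hodge_component_def matrix_vector_right_distrib vec.scale_right_distrib
        mat_scale vec.scale_left_commute matrix_vector_mult_0_right)

text \<open>On the unit circle \<open>cnj z\<close> is the inverse of \<open>z\<close>, so the two
  exponents \<open>k\<close> and \<open>n - k\<close> merge into their difference.\<close>

lemma hodge_component_circle:
  assumes "v \<in> hodge_component \<phi> k (n - k)" "norm z = 1"
  shows "map_matrix complex_of_real (\<phi> z) *v v = (z powi (2 * k - n)) *s v"
proof -
  have z: "z \<noteq> 0" using assms(2) by auto
  have "cnj z = inverse z"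
    using assms(2) complex_norm_square[of z] z by (simp add: field_simps inverse_eq_divide)
  then have "z powi k * cnj z powi (n - k) = z powi k * z powi (- (n - k))"
    using power_int_minus[of z "n - k"] by (simp add: power_int_inverse)
  also have "\<dots> = z powi (2 * k - n)" using z by (simp flip: power_int_add add: algebra_simps)
  finally show ?thesis using assms(1) z by (simp add: hodge_component_def)
qed

text \<open>The first bilinear relation lets Hodge components pair nontrivially only for
  \<open>k + l = n\<close>, and then the exponents \<open>2 * k - n\<close> and
  \<open>2 * l - n\<close> of the circle cancel. The isometry group is thus one of the groups being
  intersected.\<close>

lemma mumford_tate_group_isometries:
  assumes "polarized_hodge_structure n Q \<phi>"
  shows "mumford_tate_group \<phi> \<subseteq> isometry_group Q"
proof -
  have hs: "hodge_structure n \<phi>" and pol: "polarization n Q \<phi>"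
    using assms by (auto simp: polarized_hodge_structure_def)
  have "map_matrix complex_of_real (\<phi> z) \<in> isometry_group Q" if z: "norm z = 1" for z
  proof -
    let ?A = "map_matrix complex_of_real (\<phi> z)"
    have z0: "z \<noteq> 0" using z by auto
    have "complexify_form Q (?A *v u) (?A *v v) = complexify_form Q u v" for u v
    proof -
      have dec: "\<exists>X f. finite X \<and> (\<forall>k. f k \<in> hodge_component \<phi> k (n - k)) \<and> u = (\<Sum>k\<in>X. f k)" for u
        by (rule span_Union_decomposition[OF hodge_component_subspace])
          (use hs in \<open>simp add: hodge_structure_def\<close>)
      obtain X f where f: "finite X" "\<And>k. f k \<in> hodge_component \<phi> k (n - k)" "u = (\<Sum>k\<in>X. f k)"
        using dec[of u] by blast
      obtain Y g where g: "finite Y" "\<And>k. g k \<in> hodge_component \<phi> k (n - k)" "v = (\<Sum>k\<in>Y. g k)"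
        using dec[of v] by blast
      have A: "?A *v (\<Sum>k\<in>X. f k) = (\<Sum>k\<in>X. (z powi (2 * k - n)) *s f k)"
        if "\<And>k. f k \<in> hodge_component \<phi> k (n - k)" for f X
        using hodge_component_circle[OF that z] by (simp add: mat_sum)
      have "z powi (2 * k - n) * (z powi (2 * l - n) * complexify_form Q (f k) (g l)) = complexify_form Q (f k) (g l)" for k l
      proof (cases "k + l = n")
        case True
        then have "(2 * k - n) + (2 * l - n) = 0" by simp
        then have "z powi (2 * k - n) * z powi (2 * l - n) = 1"
          using z0 by (metis power_int_0_right power_int_add)
        then show ?thesis by (simp flip: mult.assoc)
      next
        case False
        then have "complexify_form Q (f k) (g l) = 0"
          using pol f(2) g(2) by (auto simp: polarization_def)
        then show ?thesis by simp
      qed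
      note summand = this
      show ?thesis
        unfolding f(3) g(3) A[OF f(2)] A[OF g(2)] complexify_form_sum_left
        unfolding complexify_form_sum_right
      proof (intro sum.cong refl)
        fix k l
        show "complexify_form Q (z powi (2 * k - n) *s f k) (z powi (2 * l - n) *s g l) = complexify_form Q (f k) (g l)"
          by (subst complexify_form_scale_left, subst complexify_form_scale_right) (rule summand)
      qed
    qed
    moreover have "?A \<in> general_linear"
      using hodge_structure_general_linear[OF hs z0] by (simp add: real_points_def)
    ultimately show ?thesis by (simp add: isometry_group_def)
  qed
  then have "\<phi> ` sphere 0 1 \<subseteq> real_points (isometry_group Q)" by (auto simp: real_points_def)
  then show ?thesis
    using mumford_tate_group_smallest(3)[OF hs rational_algebraic_group_isometry_group] by blast
qed

section \<open>The eigenbasis of a CM Hodge structure\<close>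

definition automorphisms :: "(complex \<Rightarrow> complex) set" where
  "automorphisms = {\<sigma>. field_aut \<sigma>}"

text \<open>As \<open>z0\<close> is not a root of unity, the eigenspaces of the single operator \<open>\<phi> z0\<close> are already the
  Hodge components.\<close>

locale cm_structure =
  fixes Q :: "rat^'n \<Rightarrow> rat^'n \<Rightarrow> rat" and \<phi> :: "complex \<Rightarrow> real^'n^'n" and n :: int and z0 :: complex
  assumes polarized: "polarized_hodge_structure n Q \<phi>" and odd_weight: "odd n"
    and irreducible: "irreducible_hodge_structure \<phi>" and CM: "CM_hodge_structure \<phi>"
    and z0_norm: "norm z0 = 1" and z0_power: "\<And>k::int. z0 powi k = 1 \<Longrightarrow> k = 0"
begin

lemma hodge: "hodge_structure n \<phi>"
  using polarized by (simp add: polarized_hodge_structure_def)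

lemma z0_nonzero: "z0 \<noteq> 0"
  using z0_norm by auto

abbreviation complex_\<phi> :: "complex \<Rightarrow> complex^'n^'n" where
  "complex_\<phi> z \<equiv> map_matrix complex_of_real (\<phi> z)"

abbreviation hodge_part :: "int \<Rightarrow> (complex^'n) set" where
  "hodge_part k \<equiv> hodge_component \<phi> k (n - k)"

abbreviation MT :: "(complex^'n^'n) set" where
  "MT \<equiv> mumford_tate_group \<phi>"

lemma MT_circle: "norm z = 1 \<Longrightarrow> complex_\<phi> z \<in> MT"
  using mumford_tate_group_smallest(2)[OF hodge] by (auto simp: real_points_def image_subset_iff)

lemma MT_automorphism: "field_aut \<sigma> \<Longrightarrow> A \<in> MT \<Longrightarrow> map_matrix \<sigma> A \<in> MT"
  by (rule rational_algebraic_group_automorphism[OF _ mumford_tate_group_smallest(1)[OF hodge]])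

lemma MT_mult: "A \<in> MT \<Longrightarrow> B \<in> MT \<Longrightarrow> A ** B \<in> MT"
  and MT_one: "mat 1 \<in> MT"
  using mumford_tate_group_smallest(1)[OF hodge] by (auto simp: rational_algebraic_group_def)

lemma MT_commute: "A \<in> MT \<Longrightarrow> B \<in> MT \<Longrightarrow> A ** B = B ** A"
  using CM by (simp add: CM_hodge_structure_def)

lemma MT_isometry: "A \<in> MT \<Longrightarrow> complexify_form Q (A *v u) (A *v v) = complexify_form Q u v"
  using mumford_tate_group_isometries[OF polarized] by (auto simp: isometry_group_def)

definition conj_\<phi> :: "(complex \<Rightarrow> complex) \<Rightarrow> complex^'n^'n" where
  "conj_\<phi> \<sigma> = map_matrix \<sigma> (complex_\<phi> z0)"

lemma conj_\<phi>_in_MT: "field_aut \<sigma> \<Longrightarrow> conj_\<phi> \<sigma> \<in> MT"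
  unfolding conj_\<phi>_def using MT_automorphism MT_circle z0_norm by blast

lemma conj_\<phi>_id: "conj_\<phi> id = complex_\<phi> z0"
  by (simp add: conj_\<phi>_def vec_eq_iff)

lemma hodge_decomposition: "\<exists>X f. finite X \<and> (\<forall>k. f k \<in> hodge_part k) \<and> v = (\<Sum>k\<in>X. f k)"
  by (rule span_Union_decomposition[OF hodge_component_subspace])
    (use hodge in \<open>simp add: hodge_structure_def\<close>)

lemma z0_power_inj: "z0 powi k = z0 powi l \<Longrightarrow> k = l"
  using z0_power[of "k - l"] z0_nonzero by (simp add: power_int_diff)

text \<open>The line through \<open>v\<close> is stable under \<open>complex_\<phi> z0\<close>,
  whose eigenvalues on the Hodge components are distinct. So the line contains each component of
  \<open>v\<close>, and \<open>v\<close> is a multiple of a nonzero one.\<close>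

lemma eigenvector_hodge_part:
  assumes "complex_\<phi> z0 *v v = c *s v"
  shows "\<exists>k. v \<in> hodge_part k"
proof (cases "v = 0")
  case True
  then show ?thesis using vec.subspace_0[OF hodge_component_subspace] by blast
next
  case False
  obtain X f where f: "finite X" "\<And>k. f k \<in> hodge_part k" "v = (\<Sum>k\<in>X. f k)"
    using hodge_decomposition by blast
  have "\<exists>k\<in>X. f k \<noteq> 0"
  proof (rule ccontr)
    assume "\<not> ?thesis"
    then have "(\<Sum>k\<in>X. f k) = 0" by (intro sum.neutral) auto
    then show False using False f(3) by simp
  qed
  then obtain k where k: "k \<in> X" "f k \<noteq> 0" by blast
  have "f k \<in> vec.span {v}"
  proof (rule eigen_components_in_subspace[where X = X and I = "{()}" and A = "\<lambda>_. complex_\<phi> z0"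
        and e = "\<lambda>k _. z0 powi (2 * k - n)"])
    show "complex_\<phi> z0 *v f k = (z0 powi (2 * k - n)) *s f k" for k
      by (rule hodge_component_circle[OF f(2) z0_norm])
    show "\<exists>i\<in>{()}. z0 powi (2 * k - n) \<noteq> z0 powi (2 * l - n)" if "k \<noteq> l" for k l
      using z0_power_inj[of "2 * k - n" "2 * l - n"] that by auto
    show "vec.subspace (vec.span {v})" by simp
    show "complex_\<phi> z0 *v u \<in> vec.span {v}" if u: "u \<in> vec.span {v}" for u
    proof -
      obtain d where "u = d *s v" using u by (auto simp: vec.span_singleton)
      then have "complex_\<phi> z0 *v u = (d * c) *s v"
        using assms by (simp add: mat_scale)
      then show ?thesis by (auto simp: vec.span_singleton)
    qed
    show "(\<Sum>x\<in>X. f x) \<in> vec.span {v}" using f(3) vec.span_base[of v "{v}"] by simp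
  qed (use f(1) k in auto)
  then obtain d where d: "f k = d *s v" by (auto simp: vec.span_singleton)
  then have "d \<noteq> 0" using k(2) by auto
  then have "v = inverse d *s f k" using d by simp
  then show ?thesis using vec.subspace_scale[OF hodge_component_subspace f(2)[of k]] by metis
qed

lemma hodge_part_stable: "v \<in> hodge_part k \<Longrightarrow> z \<noteq> 0 \<Longrightarrow> \<exists>c. complex_\<phi> z *v v = c *s v"
  by (auto simp: hodge_component_def)

text \<open>Applying \<tau> to the entries composes the index of \<open>conj_\<phi>\<close> with
  \<tau> on the left, hence the inverse of \<tau> in the assumption.\<close>

lemma conj_\<phi>_eigen:
  assumes "field_aut \<tau>" "conj_\<phi> (inv_into UNIV \<tau> \<circ> \<sigma>) *v v = c *s v"
  shows "conj_\<phi> \<sigma> *v map_vec \<tau> v = \<tau> c *s map_vec \<tau> v"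
proof -
  have "\<tau> \<circ> (inv_into UNIV \<tau> \<circ> \<sigma>) = \<sigma>"
    using field_aut_bij[OF assms(1)] by (simp add: fun_eq_iff bij_is_surj surj_f_inv_f)
  then have "map_matrix \<tau> (conj_\<phi> (inv_into UNIV \<tau> \<circ> \<sigma>)) = conj_\<phi> \<sigma>"
    unfolding conj_\<phi>_def map_matrix_comp by (metis comp_assoc)
  then show ?thesis
    using arg_cong[OF assms(2), of "map_vec \<tau>"]
    by (simp add: map_vec_matrix_vector[OF assms(1)] map_vec_scale[OF assms(1)])
qed

lemma conj_\<phi>_diagonalizable:
  assumes \<sigma>: "field_aut \<sigma>"
  shows "vec.span {v. \<exists>c. conj_\<phi> \<sigma> *v v = c *s v} = UNIV"
proof -
  have "v \<in> vec.span {v. \<exists>c. conj_\<phi> \<sigma> *v v = c *s v}" for v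
  proof -
    have "map_vec (inv_into UNIV \<sigma>) v \<in> vec.span (\<Union>k. hodge_part k)"
      using hodge by (simp add: hodge_structure_def)
    then have "map_vec \<sigma> (map_vec (inv_into UNIV \<sigma>) v) \<in> vec.span (map_vec \<sigma> ` (\<Union>k. hodge_part k))"
      by (rule map_vec_in_span[OF \<sigma>])
    moreover have "map_vec \<sigma> (map_vec (inv_into UNIV \<sigma>) v) = v"
      using field_aut_bij[OF \<sigma>] by (simp add: vec_eq_iff bij_is_surj surj_f_inv_f)
    moreover have "map_vec \<sigma> ` (\<Union>k. hodge_part k) \<subseteq> {v. \<exists>c. conj_\<phi> \<sigma> *v v = c *s v}"
    proof clarify
      fix u k assume "u \<in> hodge_part k"
      then obtain c where "conj_\<phi> id *v u = c *s u"
        unfolding conj_\<phi>_id using hodge_part_stable z0_nonzero by blast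
      moreover have "inv_into UNIV \<sigma> \<circ> \<sigma> = id" using field_aut_bij[OF \<sigma>] by (simp add: bij_is_inj)
      ultimately show "\<exists>c. conj_\<phi> \<sigma> *v map_vec \<sigma> u = c *s map_vec \<sigma> u"
        using conj_\<phi>_eigen[OF \<sigma>, of \<sigma>] by auto
    qed
    ultimately show ?thesis using vec.span_mono[THEN subsetD] by (simp only:)
  qed
  then show ?thesis by blast
qed

lemma ex_stable_eigen_decomposition:
  "\<exists>S. eigen_decomposition automorphisms conj_\<phi> S \<and> S \<noteq> {} \<and>
     (\<forall>\<sigma>. field_aut \<sigma> \<longrightarrow> map_vec \<sigma> ` S = S)"
proof -
  have "UNIV \<subseteq> vec.span {u\<in>UNIV. \<forall>\<sigma>\<in>automorphisms. \<exists>c. conj_\<phi> \<sigma> *v u = c *s u}"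
    by (rule simultaneous_eigenvectors_span)
      (auto simp: automorphisms_def conj_\<phi>_diagonalizable conj_\<phi>_in_MT intro!: MT_commute)
  \<comment> \<open>Any nonzero rational vector would serve here.\<close>
  then have "axis undefined 1 \<in> vec.span {u. \<forall>\<sigma>\<in>automorphisms. \<exists>c. conj_\<phi> \<sigma> *v u = c *s u}" by auto
  then obtain S where S: "eigen_decomposition automorphisms conj_\<phi> S" "axis undefined 1 = \<Sum>S"
    using ex_eigen_decomposition by blast
  have "S \<noteq> {}"
  proof
    assume "S = {}"
    then have "axis undefined 1 = (0 :: complex^'n)" using S(2) by simp
    then show False by (simp add: axis_eq_0_iff)
  qed
  moreover have "map_vec \<tau> ` S = S" if \<tau>: "field_aut \<tau>" for \<tau>
  proof -
    have bij: "bij \<tau>" using field_aut_bij[OF \<tau>] .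
    have eig: "conj_\<phi> \<sigma> *v map_vec \<tau> s = \<tau> (eigenvalue_of (conj_\<phi> (inv_into UNIV \<tau> \<circ> \<sigma>)) s) *s map_vec \<tau> s"
      if "s \<in> S" "\<sigma> \<in> automorphisms" for s \<sigma>
    proof (rule conj_\<phi>_eigen[OF \<tau>])
      have "inv_into UNIV \<tau> \<circ> \<sigma> \<in> automorphisms"
        using that(2) field_aut_comp field_aut_inv[OF \<tau>] by (simp add: automorphisms_def)
      then show "conj_\<phi> (inv_into UNIV \<tau> \<circ> \<sigma>) *v s = eigenvalue_of (conj_\<phi> (inv_into UNIV \<tau> \<circ> \<sigma>)) s *s s"
        using S(1) that(1) by (simp add: eigen_decomposition_def)
    qed
    have ev: "eigenvalue_of (conj_\<phi> \<sigma>) (map_vec \<tau> s) = \<tau> (eigenvalue_of (conj_\<phi> (inv_into UNIV \<tau> \<circ> \<sigma>)) s)"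
      if "s \<in> S" "\<sigma> \<in> automorphisms" for s \<sigma>
      using eig[OF that] S(1) that(1)
      by (intro eigenvalue_of_eq) (auto simp: map_vec_eq_0_iff[OF \<tau>] eigen_decomposition_def)
    have T: "eigen_decomposition automorphisms conj_\<phi> (map_vec \<tau> ` S)"
      unfolding eigen_decomposition_def
    proof (intro conjI ballI impI)
      show "finite (map_vec \<tau> ` S)" using S(1) by (simp add: eigen_decomposition_def)
      have "0 \<notin> S" using S(1) by (simp add: eigen_decomposition_def)
      then show "0 \<notin> map_vec \<tau> ` S" using map_vec_eq_0_iff[OF \<tau>] by (metis imageE)
      fix t \<sigma> assume "t \<in> map_vec \<tau> ` S" "\<sigma> \<in> automorphisms"
      then show "conj_\<phi> \<sigma> *v t = eigenvalue_of (conj_\<phi> \<sigma>) t *s t" using eig ev by auto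
    next
      fix s' t' assume "s' \<in> map_vec \<tau> ` S" "t' \<in> map_vec \<tau> ` S" "s' \<noteq> t'"
      then obtain s t where st: "s \<in> S" "t \<in> S" "s \<noteq> t" "s' = map_vec \<tau> s" "t' = map_vec \<tau> t" by blast
      then obtain \<sigma> where \<sigma>: "\<sigma> \<in> automorphisms" "eigenvalue_of (conj_\<phi> \<sigma>) s \<noteq> eigenvalue_of (conj_\<phi> \<sigma>) t"
        using S(1) unfolding eigen_decomposition_def by blast
      have c: "\<tau> \<circ> \<sigma> \<in> automorphisms"
        using \<sigma>(1) field_aut_comp[OF \<tau>] by (simp add: automorphisms_def)
      have "inv_into UNIV \<tau> \<circ> (\<tau> \<circ> \<sigma>) = \<sigma>" using bij by (simp add: fun_eq_iff bij_is_inj)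
      then have "eigenvalue_of (conj_\<phi> (\<tau> \<circ> \<sigma>)) s' \<noteq> eigenvalue_of (conj_\<phi> (\<tau> \<circ> \<sigma>)) t'"
        using ev[OF st(1) c] ev[OF st(2) c] \<sigma>(2) st bij by (simp add: bij_is_inj inj_eq)
      then show "\<exists>\<sigma>\<in>automorphisms. eigenvalue_of (conj_\<phi> \<sigma>) s' \<noteq> eigenvalue_of (conj_\<phi> \<sigma>) t'"
        using c by blast
    qed
    \<comment> \<open>\<tau> fixes the rational vector, so \<open>S\<close> and its image decompose
      the same vector and coincide by uniqueness.\<close>
    have "\<Sum>(map_vec \<tau> ` S) = map_vec \<tau> (\<Sum>S)"
      by (subst sum.reindex[OF inj_on_subset[OF inj_map_vec[OF \<tau>] subset_UNIV]]) (simp add: map_vec_sum[OF \<tau>])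
    also have "\<dots> = \<Sum>S"
      unfolding S(2)[symmetric]
      by (simp add: vec_eq_iff axis_def field_aut_0[OF \<tau>] field_aut_1[OF \<tau>])
    finally show ?thesis
      using eigen_decomposition_subset[OF S(1) T] eigen_decomposition_subset[OF T S(1)] by simp
  qed
  ultimately show ?thesis using S(1) by blast
qed

end

locale cm_eigenbasis = cm_structure Q \<phi> n z0
  for Q :: "rat^'n \<Rightarrow> rat^'n \<Rightarrow> rat" and \<phi> :: "complex \<Rightarrow> real^'n^'n" and n z0 +
  fixes S :: "(complex^'n) set"
  assumes S: "eigen_decomposition automorphisms conj_\<phi> S" "S \<noteq> {}"
    and S_stable: "\<And>\<sigma>. field_aut \<sigma> \<Longrightarrow> map_vec \<sigma> ` S = S"
begin

lemma finite_S: "finite S" and S_nonzero: "s \<in> S \<Longrightarrow> s \<noteq> 0"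
  using S(1) by (auto simp: eigen_decomposition_def)

lemma S_image: "field_aut \<sigma> \<Longrightarrow> s \<in> S \<Longrightarrow> map_vec \<sigma> s \<in> S"
  using S_stable by blast

lemma S_hodge_part: "s \<in> S \<Longrightarrow> \<exists>k. s \<in> hodge_part k"
  using S(1) field_aut_id eigenvector_hodge_part
  by (metis automorphisms_def conj_\<phi>_id eigen_decomposition_def mem_Collect_eq)

definition hodge_index :: "complex^'n \<Rightarrow> int" where
  "hodge_index s = (SOME k. s \<in> hodge_part k)"

text \<open>For a Hodge index \<open>k\<close> this is \<open>k - (n - k)\<close>, the exponent with
  which the unit circle acts on the line of \<open>s\<close>.\<close>

definition weight :: "complex^'n \<Rightarrow> int" where
  "weight s = 2 * hodge_index s - n"

lemma hodge_index: "s \<in> S \<Longrightarrow> s \<in> hodge_part (hodge_index s)"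
  unfolding hodge_index_def using S_hodge_part by (rule someI_ex)

lemma odd_weight_S: "odd (weight s)"
  using odd_weight by (simp add: weight_def)

lemma circle_action: "s \<in> S \<Longrightarrow> norm z = 1 \<Longrightarrow> complex_\<phi> z *v s = (z powi weight s) *s s"
  unfolding weight_def using hodge_component_circle[OF hodge_index] by blast

text \<open>Members of \<open>S\<close> are Hodge vectors, so the span of \<open>T\<close> is stable
  under \<phi> as well as under automorphisms, and irreducibility applies. Taking \<open>T\<close>
  to be \<open>S\<close> or a single orbit gives the basis property and transitivity.\<close>

lemma span_stable_UNIV:
  assumes T: "T \<subseteq> S" "T \<noteq> {}" and stable: "\<And>\<sigma>. field_aut \<sigma> \<Longrightarrow> map_vec \<sigma> ` T \<subseteq> T"
  shows "vec.span T = UNIV"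
proof -
  have "vec.span T = {0} \<or> vec.span T = UNIV"
  proof (rule irreducible_stable_subspace[OF irreducible])
    show "map_vec \<sigma> v \<in> vec.span T" if "field_aut \<sigma>" "v \<in> vec.span T" for \<sigma> v
      using map_vec_in_span[OF that] stable[OF that(1)] vec.span_mono by blast
    show "complex_\<phi> z *v v \<in> vec.span T" if z: "z \<noteq> 0" and v: "v \<in> vec.span T" for z v
      using v
    proof (induction rule: vec.span_induct_alt)
      case base
      then show ?case by (simp add: matrix_vector_mult_0_right vec.span_zero)
    next
      case (step c s w)
      obtain d where "complex_\<phi> z *v s = d *s s" using hodge_part_stable[OF hodge_index z] T(1) step(1) by blast
      then show ?case
        using step by (simp add: matrix_vector_right_distrib mat_scale
            vec.span_add vec.span_scale vec.span_base)
    qed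
  qed simp
  moreover obtain t where "t \<in> T" using T(2) by blast
  moreover have "t \<noteq> 0" using \<open>t \<in> T\<close> T(1) S_nonzero by blast
  ultimately show ?thesis using vec.span_base by blast
qed

lemma span_S: "vec.span S = UNIV"
  by (rule span_stable_UNIV) (use S(2) S_stable in auto)

lemma independent_S: "vec.independent S"
  by (rule eigen_decomposition_independent[OF S(1)])

lemma card_S: "card S = CARD('n)"
  using vec.dim_eq_card_independent[OF independent_S] vec.dim_span[of S] span_S vec_dim_card[where 'n = 'n and 'a = complex]
  by simp

text \<open>An orbit missing \<open>t\<close> would already span everything, making \<open>t\<close>
  dependent on the remaining members of the basis.\<close>

lemma S_transitive:
  assumes "s \<in> S" "t \<in> S"
  shows "\<exists>\<sigma>. field_aut \<sigma> \<and> map_vec \<sigma> s = t"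
proof (rule ccontr)
  assume no: "\<not> ?thesis"
  let ?T = "{map_vec \<sigma> s | \<sigma>. field_aut \<sigma>}"
  have T: "?T \<subseteq> S - {t}" using S_image[OF _ assms(1)] no by blast
  have "vec.span ?T = UNIV"
  proof (rule span_stable_UNIV)
    show "?T \<noteq> {}" using field_aut_id by blast
    show "map_vec \<sigma> ` ?T \<subseteq> ?T" if "field_aut \<sigma>" for \<sigma>
      using field_aut_comp[OF that] by (auto simp: map_vec_comp)
  qed (use T in blast)
  then have "t \<in> vec.span (S - {t})" using vec.span_mono[OF T] by blast
  then show False using independent_S assms(2) vec.dependent_def by blast
qed

lemma eigenvalue_conj_\<phi>:
  assumes "s \<in> S" "field_aut \<sigma>"
  shows "eigenvalue_of (conj_\<phi> \<sigma>) s = \<sigma> (z0 powi weight (map_vec (inv_into UNIV \<sigma>) s))"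
proof (rule eigenvalue_of_eq[OF S_nonzero[OF assms(1)]])
  let ?t = "map_vec (inv_into UNIV \<sigma>) s"
  have t: "?t \<in> S" by (rule S_image[OF field_aut_inv[OF assms(2)] assms(1)])
  have b: "bij \<sigma>" using field_aut_bij[OF assms(2)] .
  have "map_vec \<sigma> ?t = s" using b by (simp add: vec_eq_iff bij_is_surj surj_f_inv_f)
  moreover have "inv_into UNIV \<sigma> \<circ> \<sigma> = id" using b by (simp add: bij_is_inj)
  moreover have "conj_\<phi> id *v ?t = (z0 powi weight ?t) *s ?t"
    unfolding conj_\<phi>_id by (rule circle_action[OF t z0_norm])
  ultimately show "conj_\<phi> \<sigma> *v s = \<sigma> (z0 powi weight ?t) *s s"
    using conj_\<phi>_eigen[OF assms(2), of \<sigma> ?t] by simp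
qed

text \<open>The eigenvalue of \<open>conj_\<phi> \<sigma>\<close> at \<open>s\<close> is determined
  by \<sigma> and the weight of the inverse translate of \<open>s\<close>. Different eigenvalues
  thus force different weights of translates.\<close>

lemma weight_separates:
  assumes "s \<in> S" "t \<in> S" "s \<noteq> t"
  shows "\<exists>\<sigma>. field_aut \<sigma> \<and> weight (map_vec \<sigma> s) \<noteq> weight (map_vec \<sigma> t)"
proof -
  obtain \<sigma> where \<sigma>: "field_aut \<sigma>" "eigenvalue_of (conj_\<phi> \<sigma>) s \<noteq> eigenvalue_of (conj_\<phi> \<sigma>) t"
    using S(1) assms unfolding eigen_decomposition_def automorphisms_def by blast
  then have "weight (map_vec (inv_into UNIV \<sigma>) s) \<noteq> weight (map_vec (inv_into UNIV \<sigma>) t)"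
    using eigenvalue_conj_\<phi> assms by metis
  then show ?thesis using field_aut_inv[OF \<sigma>(1)] by blast
qed

text \<open>\<open>Q\<close> is rational, so the translates by \<sigma> still pair nontrivially.
  Invariance under the circle then makes the weights of a nontrivial pair cancel, because
  \<open>z0\<close> is not a root of unity.\<close>

lemma weight_opposite:
  assumes "s \<in> S" "t \<in> S" "complexify_form Q s t \<noteq> 0" "field_aut \<sigma>"
  shows "weight (map_vec \<sigma> t) = - weight (map_vec \<sigma> s)"
proof -
  let ?s = "map_vec \<sigma> s" and ?t = "map_vec \<sigma> t"
  have st: "?s \<in> S" "?t \<in> S" using S_image assms by auto
  have ne: "complexify_form Q ?s ?t \<noteq> 0"
    using assms(3) by (simp add: complexify_form_automorphism[OF assms(4)] field_aut_eq_0_iff[OF assms(4)])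
  have "complexify_form Q (complex_\<phi> z0 *v ?s) (complex_\<phi> z0 *v ?t) = complexify_form Q ?s ?t"
    by (rule MT_isometry[OF MT_circle[OF z0_norm]])
  then have "z0 powi weight ?t * z0 powi weight ?s = 1"
    using ne by (simp add: circle_action st z0_norm complexify_form_scale_left complexify_form_scale_right)
  then have "z0 powi (weight ?t + weight ?s) = 1" using z0_nonzero by (simp add: power_int_add)
  then show ?thesis using z0_power by fastforce
qed

text \<open>The second bilinear relation, applied to the Hodge vector \<open>s\<close>, makes a
  multiple of this number positive.\<close>

lemma form_cnj_nonzero:
  assumes "s \<in> S"
  shows "complexify_form Q s (map_vec cnj s) \<noteq> 0"
proof -
  have "polarization n Q \<phi>" using polarized by (simp add: polarized_hodge_structure_def)
  then have "\<forall>k l. k + l = n \<longrightarrow> (\<forall>u\<in>hodge_component \<phi> k l. u \<noteq> 0 \<longrightarrow>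
      (\<exists>r>0. \<i> powi (k - l) * complexify_form Q u (\<chi> i. cnj (u $ i)) = complex_of_real r))"
    unfolding polarization_def by (elim conjE)
  from this[rule_format, OF _ hodge_index[OF assms] S_nonzero[OF assms]]
  obtain r where r: "r > 0" "\<i> powi (hodge_index s - (n - hodge_index s)) * complexify_form Q s (map_vec cnj s) = complex_of_real r"
    unfolding map_vec_def by auto
  then show ?thesis by auto
qed

text \<open>Both \<open>?a\<close> and \<open>?b\<close> pair nontrivially with
  \<open>map_vec \<sigma> s\<close>. All their translates therefore have the same weight, opposite
  to that of the translate of \<open>map_vec \<sigma> s\<close>, and translates of the weight
  separate points.\<close>

lemma cnj_commutes:
  assumes "s \<in> S" "field_aut \<sigma>"
  shows "map_vec cnj (map_vec \<sigma> s) = map_vec \<sigma> (map_vec cnj s)"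
proof (rule ccontr)
  let ?a = "map_vec cnj (map_vec \<sigma> s)" and ?b = "map_vec \<sigma> (map_vec cnj s)"
  assume "?a \<noteq> ?b"
  moreover have S': "map_vec \<sigma> s \<in> S" "?a \<in> S" "?b \<in> S" using S_image field_aut_cnj assms by auto
  ultimately obtain \<tau> where \<tau>: "field_aut \<tau>" "weight (map_vec \<tau> ?a) \<noteq> weight (map_vec \<tau> ?b)"
    using weight_separates by blast
  have "complexify_form Q (map_vec \<sigma> s) ?b \<noteq> 0"
    using form_cnj_nonzero[OF assms(1)]
    by (simp add: complexify_form_automorphism[OF assms(2)] field_aut_eq_0_iff[OF assms(2)])
  then have "weight (map_vec \<tau> ?b) = - weight (map_vec \<tau> (map_vec \<sigma> s))"
    by (rule weight_opposite[OF S'(1,3) _ \<tau>(1)])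
  moreover have "weight (map_vec \<tau> ?a) = - weight (map_vec \<tau> (map_vec \<sigma> s))"
    by (rule weight_opposite[OF S'(1,2) form_cnj_nonzero[OF S'(1)] \<tau>(1)])
  ultimately show False using \<tau>(2) by simp
qed

lemma weight_cnj: "s \<in> S \<Longrightarrow> weight (map_vec cnj s) = - weight s"
proof -
  assume s: "s \<in> S"
  have "map_vec id v = v" for v :: "complex^'n" by (simp add: vec_eq_iff)
  then show ?thesis
    using weight_opposite[OF s S_image[OF field_aut_cnj s] form_cnj_nonzero[OF s] field_aut_id] by simp
qed

text \<open>The finite group through which automorphisms act on \<open>S\<close>. Members are the
  identity off \<open>S\<close>, as \<open>permutes\<close> demands, and agree with
  \<open>map_vec \<sigma>\<close> only on \<open>S\<close>.\<close>

definition induced_perms :: "(complex^'n \<Rightarrow> complex^'n) set" where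
  "induced_perms = {g. g permutes S \<and> (\<exists>\<sigma>. field_aut \<sigma> \<and> (\<forall>s\<in>S. g s = map_vec \<sigma> s))}"

lemma ex_induced_perm:
  assumes "field_aut \<sigma>"
  shows "\<exists>g\<in>induced_perms. \<forall>s\<in>S. g s = map_vec \<sigma> s"
proof -
  let ?g = "\<lambda>s. if s \<in> S then map_vec \<sigma> s else s"
  have "bij_betw (map_vec \<sigma>) S S"
    unfolding bij_betw_def using S_stable[OF assms] inj_map_vec[OF assms] inj_on_subset by blast
  then have "bij_betw ?g S S" by (rule bij_betw_cong[THEN iffD1, rotated]) simp
  then have "?g permutes S" by (rule bij_imp_permutes) simp
  then have "?g \<in> induced_perms" using assms by (auto simp: induced_perms_def)
  then show ?thesis by (rule bexI[rotated]) simp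
qed

lemma permutation_monoid_induced: "permutation_monoid S induced_perms"
proof
  show "finite S" by (rule finite_S)
  have "map_vec id v = v" for v :: "complex^'n" by (simp add: vec_eq_iff)
  then show "id \<in> induced_perms"
    using field_aut_id by (auto simp: induced_perms_def permutes_id)
  fix f g assume f: "f \<in> induced_perms" and g: "g \<in> induced_perms"
  show "g permutes S" using g by (simp add: induced_perms_def)
  obtain \<sigma> \<tau> where "field_aut \<sigma>" "field_aut \<tau>" "\<forall>s\<in>S. f s = map_vec \<sigma> s" "\<forall>s\<in>S. g s = map_vec \<tau> s"
    using f g by (auto simp: induced_perms_def)
  moreover have "f \<circ> g permutes S" using f g permutes_compose by (auto simp: induced_perms_def)
  ultimately show "f \<circ> g \<in> induced_perms"
    using S_image field_aut_comp[of \<sigma> \<tau>] by (auto simp: induced_perms_def map_vec_comp intro!: exI[of _ "\<sigma> \<circ> \<tau>"])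
qed

lemma ex_spanning_translates:
  assumes p: "prime p" "p > 2" "CARD('n) = 2 * p"
  obtains \<rho> a where "\<And>i. field_aut (\<rho> i)" "\<And>j. a j \<in> S" "inj_on a {..<p}"
    "S = a ` {..<p} \<union> map_vec cnj ` a ` {..<p}" "a ` {..<p} \<inter> map_vec cnj ` a ` {..<p} = {}"
    "\<And>w. \<exists>u. \<forall>j<p. (\<Sum>i<p. u i * of_int (weight (map_vec (\<rho> i) (a j)))) = (w j :: complex)"
proof -
  interpret permutation_monoid S induced_perms by (rule permutation_monoid_induced)
  have aut: "\<exists>\<sigma>. field_aut \<sigma> \<and> (\<forall>s\<in>S. g s = map_vec \<sigma> s)" if "g \<in> induced_perms" for g
    using that by (simp add: induced_perms_def)
  obtain \<rho> a where \<rho>: "\<And>i. \<rho> i \<in> induced_perms" and a: "\<And>j. a j \<in> S" "inj_on a {..<p}"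
    "S = a ` {..<p} \<union> map_vec cnj ` a ` {..<p}" "a ` {..<p} \<inter> map_vec cnj ` a ` {..<p} = {}"
    and u: "\<And>w. \<exists>u. \<forall>j<p. (\<Sum>i<p. u i * of_int (weight (\<rho> i (a j)))) = (w j :: complex)"
  proof (rule translates_of_weight_span[OF p(1,2), where \<iota> = "map_vec cnj" and h = weight])
    show "card S = 2 * p" using card_S p(3) by simp
    show "\<exists>g\<in>induced_perms. g s = t" if "s \<in> S" "t \<in> S" for s t
      using S_transitive[OF that] ex_induced_perm that(1) by metis
    show "map_vec cnj s \<in> S" if "s \<in> S" for s using S_image[OF field_aut_cnj that] .
    show "map_vec cnj (map_vec cnj s) = s" for s :: "complex^'n" by (simp add: vec_eq_iff)
    show "map_vec cnj (g s) = g (map_vec cnj s)" if "g \<in> induced_perms" "s \<in> S" for g s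
      using aut[OF that(1)] cnj_commutes[OF that(2)] that(2) S_image[OF field_aut_cnj that(2)] by metis
    show "odd (weight s)" for s by (rule odd_weight_S)
    show "weight (map_vec cnj s) = - weight s" if "s \<in> S" for s using weight_cnj[OF that] .
    show "\<exists>g\<in>induced_perms. weight (g s) \<noteq> weight (g t)" if "s \<in> S" "t \<in> S" "s \<noteq> t" for s t
      using weight_separates[OF that] ex_induced_perm that(1,2) by metis
  qed (rule that)
  obtain \<sigma> where \<sigma>: "\<And>i. field_aut (\<sigma> i)" "\<And>i s. s \<in> S \<Longrightarrow> \<rho> i s = map_vec (\<sigma> i) s"
    using aut[OF \<rho>] by metis
  show thesis
    by (rule that[of \<sigma> a]) (use \<sigma> a u in auto)
qed

end

section \<open>The Mumford-Tate group is a torus\<close>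

context cm_eigenbasis
begin

lemma matrix_eq_on_S:
  assumes "\<And>s. s \<in> S \<Longrightarrow> A *v s = B *v s"
  shows "A = B"
proof -
  have "A *v v = B *v v" if "v \<in> vec.span S" for v
    using that
  proof (induction rule: vec.span_induct_alt)
    case (step c s w)
    then show ?case
      using assms by (simp add: matrix_vector_right_distrib mat_scale)
  qed (simp add: matrix_vector_mult_0_right)
  then show ?thesis using span_S by (simp add: matrix_eq)
qed

definition diag :: "(complex^'n \<Rightarrow> complex) \<Rightarrow> complex^'n^'n" where
  "diag x = (SOME D. \<forall>s\<in>S. D *v s = x s *s s)"

lemma diag_apply: "s \<in> S \<Longrightarrow> diag x *v s = x s *s s"
proof -
  have "\<exists>D. \<forall>s\<in>S. D *v s = x s *s s"
  proof -
    obtain g where g: "Vector_Spaces.linear (*s) (*s) g" "\<forall>s\<in>S. g s = x s *s s"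
      using vec.linear_independent_extend[OF independent_S, of "\<lambda>s. x s *s s"] by blast
    then show ?thesis using matrix_works[OF g(1)] by (intro exI[of _ "matrix g"]) simp
  qed
  then have "\<forall>s\<in>S. diag x *v s = x s *s s" unfolding diag_def by (rule someI_ex)
  then show "diag x *v s = x s *s s" if "s \<in> S" using that by blast
qed

lemma diag_eqI: "(\<And>s. s \<in> S \<Longrightarrow> A *v s = x s *s s) \<Longrightarrow> A = diag x"
  by (rule matrix_eq_on_S) (simp add: diag_apply)

lemma diag_mult: "diag x ** diag y = diag (\<lambda>s. x s * y s)"
  by (rule diag_eqI)
    (simp add: diag_apply mat_scale mult.commute flip: matrix_vector_mul_assoc)

lemma diag_one: "diag (\<lambda>_. 1) = mat 1"
  by (rule diag_eqI[symmetric]) (simp add: matrix_vector_mul_lid)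

definition proj :: "complex^'n \<Rightarrow> complex^'n^'n" where
  "proj t = diag (\<lambda>s. if s = t then 1 else 0)"

lemma proj_apply: "s \<in> S \<Longrightarrow> proj t *v s = (if s = t then s else 0)"
  by (simp add: proj_def diag_apply)

lemma lincomb_matrix_apply:
  fixes c :: "'i \<Rightarrow> complex" and A :: "'i \<Rightarrow> complex^'n^'n"
  shows "(\<chi> k l. \<Sum>i\<in>I. A i $ k $ l * c i) *v v = (\<Sum>i\<in>I. c i *s (A i *v v))"
  by (auto simp: vec_eq_iff matrix_vector_mult_def sum_distrib_left sum_distrib_right mult_ac
      intro!: trans[OF sum.swap] sum.cong)

text \<open>The entries are linear in the eigenvalues, so \<open>diag\<close> depends
  holomorphically on parameters whenever the eigenvalues do.\<close>

lemma diag_entry: "diag x $ k $ l = (\<Sum>t\<in>S. proj t $ k $ l * x t)"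
proof -
  have "(\<chi> k l. \<Sum>t\<in>S. proj t $ k $ l * x t) = diag x"
    by (rule diag_eqI) (simp add: lincomb_matrix_apply proj_apply finite_S if_distrib cong: if_cong)
  then show ?thesis by (simp flip: \<open>_ = diag x\<close>)
qed

text \<open>Commuting with all \<open>conj_\<phi> \<sigma>\<close> makes \<open>X\<close> diagonal
  in the basis \<open>S\<close>. Preserving the nonzero number
  \<open>complexify_form Q s (map_vec cnj s)\<close> makes the eigenvalues at conjugate vectors
  inverse to each other.\<close>

lemma MT_diagonal:
  assumes "X \<in> MT"
  obtains x where "X = diag x" "\<And>s. s \<in> S \<Longrightarrow> x s * x (map_vec cnj s) = 1"
proof -
  have "\<exists>c. X *v s = c *s s" if "s \<in> S" for s
    by (rule commuting_matrix_diagonal[OF S(1) span_S _ that])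
      (use MT_commute[OF assms] conj_\<phi>_in_MT in \<open>auto simp: automorphisms_def\<close>)
  then obtain x where x: "\<And>s. s \<in> S \<Longrightarrow> X *v s = x s *s s" by metis
  have "x s * x (map_vec cnj s) = 1" if s: "s \<in> S" for s
  proof -
    let ?t = "map_vec cnj s"
    have "?t \<in> S" using S_image[OF field_aut_cnj s] .
    then have "complexify_form Q (X *v s) (X *v ?t) = x s * x ?t * complexify_form Q s ?t"
      using x s by (simp add: complexify_form_scale_left complexify_form_scale_right)
    then show ?thesis using MT_isometry[OF assms, of s ?t] form_cnj_nonzero[OF s] by simp
  qed
  then show thesis using that[of x] diag_eqI[OF x] by blast
qed

text \<open>The unit circle is Zariski dense in its complexification, so \<open>\<phi>\<close> extends to \<open>\<complex>\<^sup>*\<close> inside the group.\<close>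

lemma MT_weight_exp: "diag (\<lambda>s. exp (u * of_int (weight s))) \<in> MT"
proof -
  obtain F where F: "F \<subseteq> polynomial_functions \<rat>" "MT = {A\<in>general_linear. \<forall>f\<in>F. f A = 0}"
    using mumford_tate_group_smallest(1)[OF hodge]
    unfolding rational_algebraic_group_def closedin_subtopology by (auto simp: closedin_zariski)
  define e where "e u = diag (\<lambda>s. exp (u * of_int (weight s)))" for u
  have real: "e (\<i> * of_real t) \<in> MT" for t
  proof -
    have norm: "norm (exp (\<i> * of_real t)) = 1" by (simp add: norm_exp_i_times)
    have "complex_\<phi> (exp (\<i> * of_real t)) = e (\<i> * of_real t)"
      unfolding e_def
    proof (rule diag_eqI)
      fix s assume "s \<in> S"
      then show "complex_\<phi> (exp (\<i> * of_real t)) *v s = exp (\<i> * of_real t * of_int (weight s)) *s s"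
        using circle_action[OF _ norm] by (simp only: exp_power_int mult.commute)
    qed
    then show ?thesis using MT_circle[OF norm] by simp
  qed
  have "f (e u) = 0" if f: "f \<in> F" for f
  proof -
    have hol: "(\<lambda>u. f (e u)) holomorphic_on UNIV"
      by (rule polynomial_function_compose_holomorphic[where K = \<rat>])
        (use f F(1) in \<open>auto simp: e_def diag_entry intro!: holomorphic_intros\<close>)
    \<comment> \<open>The entire function \<open>f (e u)\<close> vanishes on the imaginary axis,
      where \<open>e\<close> takes values in the circle; the axis accumulates at 0.\<close>
    show ?thesis
    proof (rule analytic_continuation[OF hol _ _ subset_UNIV])
      show "0 islimpt range (\<lambda>t. \<i> * complex_of_real t)"
        unfolding islimpt_approachable
      proof (intro allI impI)
        fix d :: real assume "d > 0"
        then show "\<exists>x'\<in>range (\<lambda>t. \<i> * complex_of_real t). x' \<noteq> 0 \<and> dist x' 0 < d"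
          by (intro bexI[OF _ rangeI[of _ "d / 2"]]) (auto simp: norm_mult)
      qed
      show "f (e z) = 0" if "z \<in> range (\<lambda>t. \<i> * complex_of_real t)" for z
        using that real F(2) f by auto
    qed auto
  qed
  moreover have "e u \<in> general_linear"
  proof -
    have "e v ** e (- v) = mat 1" for v
      by (simp add: e_def diag_mult diag_one flip: exp_add)
    from this[of u] this[of "- u"] have "e u ** e (- u) = mat 1" "e (- u) ** e u = mat 1" by auto
    then show ?thesis by (auto simp: general_linear_def invertible_def)
  qed
  ultimately show ?thesis using F(2) by (simp add: e_def)
qed

text \<open>The element for weight multiples of \<open>v\<close> depends only on
  \<open>exp v\<close>, as weights are integers. Choosing \<open>v\<close> as a logarithm of
  \<open>\<sigma> (exp u)\<close> and applying the inverse of \<sigma> to the matrix turns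
  \<open>exp v\<close> back into \<open>exp u\<close> and moves the weight by \<sigma>.\<close>

lemma MT_weight_conj_exp:
  assumes \<sigma>: "field_aut \<sigma>"
  shows "diag (\<lambda>s. exp (u * of_int (weight (map_vec \<sigma> s)))) \<in> MT"
proof -
  let ?\<tau> = "inv_into UNIV \<sigma>"
  have \<tau>: "field_aut ?\<tau>" by (rule field_aut_inv[OF \<sigma>])
  have b: "bij \<sigma>" using field_aut_bij[OF \<sigma>] .
  have nz: "\<sigma> (exp u) \<noteq> 0" using field_aut_eq_0_iff[OF \<sigma>] by simp
  obtain v where v: "exp v = \<sigma> (exp u)" using exp_Ln[OF nz] by blast
  have "map_matrix ?\<tau> (diag (\<lambda>s. exp (v * of_int (weight s)))) = diag (\<lambda>s. exp (u * of_int (weight (map_vec \<sigma> s))))"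
  proof (rule diag_eqI)
    fix s assume s: "s \<in> S"
    have "map_vec ?\<tau> (map_vec \<sigma> s) = s" using b by (simp add: vec_eq_iff bij_is_inj)
    then have "map_matrix ?\<tau> (diag (\<lambda>s. exp (v * of_int (weight s)))) *v s =
        map_vec ?\<tau> (diag (\<lambda>s. exp (v * of_int (weight s))) *v map_vec \<sigma> s)"
      by (simp add: map_vec_matrix_vector[OF \<tau>])
    also have "\<dots> = ?\<tau> (\<sigma> (exp u) powi weight (map_vec \<sigma> s)) *s s"
      using \<open>map_vec ?\<tau> (map_vec \<sigma> s) = s\<close>
      by (simp add: diag_apply S_image[OF \<sigma> s] map_vec_scale[OF \<tau>] mult.commute[of v] exp_power_int v flip: exp_power_int)
    also have "?\<tau> (\<sigma> (exp u) powi weight (map_vec \<sigma> s)) = exp u powi weight (map_vec \<sigma> s)"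
      using b by (simp add: bij_is_inj flip: field_aut_power_int[OF \<sigma>])
    also have "\<dots> = exp (u * of_int (weight (map_vec \<sigma> s)))" by (simp only: exp_power_int mult.commute)
    finally show "map_matrix ?\<tau> (diag (\<lambda>s. exp (v * of_int (weight s)))) *v s =
        exp (u * of_int (weight (map_vec \<sigma> s))) *s s" .
  qed
  then show ?thesis using MT_automorphism[OF \<tau> MT_weight_exp] by metis
qed

text \<open>The eigenvalues \<open>y j\<close> at the \<open>a j\<close> are free coordinates, and
  those at \<open>map_vec cnj (a j)\<close> are their inverses. With \<open>A j\<close> and
  \<open>B j\<close> the projections to these lines, \<open>m\<close> has the form required for the
  dimension of a torus.\<close>

lemma MT_dim:
  assumes p: "prime p" "p > 2" "CARD('n) = 2 * p"
  shows "algebraic_group_dim MT = enat p"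
proof -
  obtain \<rho> a where \<rho>: "\<And>i. field_aut (\<rho> i)" and a: "\<And>j. a j \<in> S" "inj_on a {..<p}"
    and S_eq: "S = a ` {..<p} \<union> map_vec cnj ` a ` {..<p}"
    and disj: "a ` {..<p} \<inter> map_vec cnj ` a ` {..<p} = {}"
    and solve: "\<And>w. \<exists>u. \<forall>j<p. (\<Sum>i<p. u i * of_int (weight (map_vec (\<rho> i) (a j)))) = (w j :: complex)"
    by (rule ex_spanning_translates[OF p]) (rule that)
  let ?b = "\<lambda>j. map_vec cnj (a j)"
  have bS: "?b j \<in> S" for j using S_image[OF field_aut_cnj a(1)] .
  have cc: "map_vec cnj (map_vec cnj v) = v" for v :: "complex^'n" by (simp add: vec_eq_iff)
  have S_cases: "(\<exists>j<p. s = a j) \<or> (\<exists>j<p. s = ?b j)" if "s \<in> S" for s using that S_eq by blast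
  have ab: "a i \<noteq> ?b j" if "i < p" "j < p" for i j using disj that by blast
  define A where "A j = proj (a j)" for j
  define B where "B j = proj (?b j)" for j
  define m where "m = (\<lambda>y. \<chi> k l. \<Sum>j<p. A j $ k $ l * y j + B j $ k $ l * inverse (y j))"
  have m_apply: "m y *v v = (\<Sum>j<p. y j *s (A j *v v) + inverse (y j) *s (B j *v v))" for y v
  proof -
    have "m y = (\<chi> k l. \<Sum>j<p. A j $ k $ l * y j) + (\<chi> k l. \<Sum>j<p. B j $ k $ l * inverse (y j))"
      by (simp add: m_def vec_eq_iff sum.distrib)
    then show ?thesis
      by (simp only: matrix_vector_mult_add_rdistrib lincomb_matrix_apply sum.distrib)
  qed
  have m_a: "m y *v a i = y i *s a i" if "i < p" for y i
  proof -
    have "y j *s (A j *v a i) + inverse (y j) *s (B j *v a i) = (if j = i then y i *s a i else 0)" if "j < p" for j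
      using that \<open>i < p\<close> a ab[of i j] by (auto simp: A_def B_def proj_apply inj_on_eq_iff)
    then show ?thesis unfolding m_apply using that by simp
  qed
  have m_b: "m y *v ?b i = inverse (y i) *s ?b i" if "i < p" for y i
  proof -
    have "?b i = ?b j \<longleftrightarrow> i = j" if "j < p" for j
      using that \<open>i < p\<close> a(2) cc by (metis inj_onD lessThan_iff)
    then have "y j *s (A j *v ?b i) + inverse (y j) *s (B j *v ?b i) = (if j = i then inverse (y i) *s ?b i else 0)"
      if "j < p" for j
      using that \<open>i < p\<close> bS ab[of j i] by (auto simp: A_def B_def proj_apply)
    then show ?thesis unfolding m_apply using that by simp
  qed
  have MT_eq: "MT = m ` torus_points p"
  proof (intro equalityI subsetI)
    fix X assume "X \<in> MT"
    then obtain x where x: "X = diag x" "\<And>s. s \<in> S \<Longrightarrow> x s * x (map_vec cnj s) = 1" using MT_diagonal by blast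
    have "diag x = m (\<lambda>j. x (a j))"
    proof (rule diag_eqI[symmetric])
      fix s assume "s \<in> S"
      from S_cases[OF this] show "m (\<lambda>j. x (a j)) *v s = x s *s s"
      proof (elim disjE exE conjE)
        fix j assume "j < p" "s = ?b j"
        moreover have "inverse (x (a j)) = x (?b j)" using x(2)[OF a(1)] by (metis inverse_unique)
        ultimately show ?thesis using m_b by simp
      qed (simp add: m_a)
    qed
    moreover have "x (a j) \<noteq> 0" for j using x(2)[OF a(1)[of j]] by auto
    then have "(\<lambda>j. x (a j)) \<in> torus_points p" by (simp add: torus_points_def)
    ultimately show "X \<in> m ` torus_points p" using x(1) by blast
  next
    fix X assume "X \<in> m ` torus_points p"
    then obtain y where y: "X = m y" "\<And>j. j < p \<Longrightarrow> y j \<noteq> 0" by (auto simp: torus_points_def)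
    \<comment> \<open>Taking logarithms of the eigenvalues makes the problem linear: the solution
      \<open>u\<close> expresses \<open>m y\<close> as a product of \<open>p\<close> conjugates of
      elements of the complexified circle.\<close>
    obtain u where u: "\<And>j. j < p \<Longrightarrow> (\<Sum>i<p. u i * of_int (weight (map_vec (\<rho> i) (a j)))) = Ln (y j)"
      using solve[of "\<lambda>j. Ln (y j)"] by blast
    have prod: "diag (\<lambda>s. exp (\<Sum>i<q. u i * of_int (weight (map_vec (\<rho> i) s)))) \<in> MT" for q
    proof (induction q)
      case 0
      then show ?case using MT_one by (simp add: diag_one)
    next
      case (Suc q)
      then show ?case using MT_mult[OF Suc MT_weight_conj_exp[OF \<rho>, of "u q" q]]
        by (simp add: diag_mult flip: exp_add)
    qed
    have "m y = diag (\<lambda>s. exp (\<Sum>i<p. u i * of_int (weight (map_vec (\<rho> i) s))))"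
    proof (rule diag_eqI)
      fix s assume "s \<in> S"
      from S_cases[OF this] show "m y *v s = exp (\<Sum>i<p. u i * of_int (weight (map_vec (\<rho> i) s))) *s s"
      proof (elim disjE exE conjE)
        fix j assume "j < p" "s = a j"
        then show ?thesis using u y(2) by (simp add: m_a)
      next
        fix j assume j: "j < p" "s = ?b j"
        have "weight (map_vec (\<rho> i) (?b j)) = - weight (map_vec (\<rho> i) (a j))" for i
          by (rule weight_opposite[OF a(1) bS form_cnj_nonzero[OF a(1)] \<rho>])
        then have "(\<Sum>i<p. u i * of_int (weight (map_vec (\<rho> i) (?b j)))) = - Ln (y j)"
          using u[OF j(1)] by (simp add: sum_negf)
        then show ?thesis using y(2) j by (simp add: m_b exp_minus)
      qed
    qed
    then show "X \<in> MT" using prod y(1) by simp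
  qed
  have "a j \<noteq> 0" for j using a(1) S_nonzero by blast
  then have "\<exists>k. a j $ k \<noteq> 0" for j by (simp add: vec_eq_iff)
  then obtain k where k: "\<And>j. a j $ k j \<noteq> 0" by metis
  \<comment> \<open>Coordinate \<open>k j\<close> of \<open>X *v a j\<close> divided by the nonzero
    coordinate \<open>k j\<close> of \<open>a j\<close>: on diagonal matrices this linear function
    of \<open>X\<close> is the eigenvalue at \<open>a j\<close>.\<close>
  define x where "x j X = (\<Sum>l\<in>UNIV. X $ k j $ l * (a j $ l / a j $ k j))" for j and X :: "complex^'n^'n"
  have x_eq: "x j X = (X *v a j) $ k j / a j $ k j" for j X
    by (simp add: x_def matrix_vector_mult_def sum_divide_distrib)
  have "krull_dim (subtopology (zariski_topology UNIV) (m ` torus_points p)) = enat p"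
    unfolding m_def
  proof (rule krull_dim_torus)
    show "x j \<in> polynomial_functions UNIV" for j
      unfolding x_def
      by (intro polynomial_functions_sum polynomial_functions.mult polynomial_functions.entry polynomial_functions.const) auto
    show "x j (\<chi> i k. \<Sum>j<p. A j $ i $ k * y j + B j $ i $ k * inverse (y j)) = y j" if "j < p" for j y
      using m_a[OF that, of y] k[of j] unfolding x_eq m_def by simp
  qed
  then show ?thesis unfolding algebraic_group_dim_def MT_eq .
qed

end

theorem theorem3p2:
  fixes Q :: "rat^'n \<Rightarrow> rat^'n \<Rightarrow> rat"
    and \<phi> :: "complex \<Rightarrow> real^'n^'n"
    and n :: int
    and p :: nat
  assumes "polarized_hodge_structure n Q \<phi>"
    and "odd n"
    and "irreducible_hodge_structure \<phi>"
    and "CM_hodge_structure \<phi>"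
    and "vec.dim (UNIV :: (rat^'n) set) = 2 * p"
    and "prime p"
    and "p > 2"
  shows "algebraic_group_dim (mumford_tate_group \<phi>) = enat p"
proof -
  obtain z0 :: complex where z0: "norm z0 = 1" "\<And>k::int. z0 powi k = 1 \<Longrightarrow> k = 0"
    using ex_unit_non_root_of_unity by blast
  interpret cm_structure Q \<phi> n z0
    by unfold_locales (fact assms(1-4) z0)+
  obtain S where S: "eigen_decomposition automorphisms conj_\<phi> S" "S \<noteq> {}"
    "\<And>\<sigma>. field_aut \<sigma> \<Longrightarrow> map_vec \<sigma> ` S = S"
    using ex_stable_eigen_decomposition by blast
  interpret cm_eigenbasis Q \<phi> n z0 S
    by unfold_locales (fact S)+
  have "CARD('n) = 2 * p" using assms(5) vec_dim_card[where 'a = rat and 'n = 'n] by simp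
  then show ?thesis using MT_dim assms(6,7) by blast
qed

end
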